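(* The problem \textsc{Labelled Directed Token Moving} (LDTM) is W[1]-hard when parameterized by $\ell+f$, where $f=|V(D)|-|S\cup T|$.
   Context: Tokens sit on vertices of a digraph $D$. A labelled configuration is a sequence $(v_1,\dots,v_k)$ of distinct vertices, meaning the token with label $i$ is on $v_i$; we also write $S$ for its set of vertices. A move is a pair $(s,t)$; executing it moves the token on $s$, with its label, to $t$. A vertex is free if it carries no token; a directed path is free if all its intermediate vertices are free. A move $(s,t)$ in a sequence is valid if, after executing the preceding moves, there is a token on $s$, $t$ is free, and there is a free directed path from $s$ to $t$. A transforming sequence from $S$ to $T$ is a sequence of valid moves whose execution from $S$ puts every labelled token on the vertex prescribed for its label by $T$. LDTM: given a digraph $D$, labelled configurations $S,T$ with $|S|=|T|=k$, and an integer $\ell$, decide whether there is a transforming sequence from $S$ to $T$ of length at most $\ell$. *)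

theory Defs
  imports "Graph_Theory.Pair_Digraph" "Graph_Theory.Vertex_Walk"
begin

section \<open>Machine model\<close>

text \<open>
  Structured programs for a unit-cost random access machine. The memory consists of named arrays
  of natural numbers (a scalar is an array that is only used at index 0); a program mentions only
  finitely many names. The arithmetic operations are addition, truncated subtraction and halving.
  There is deliberately no unit-cost multiplication: in time \<open>t\<close> the bit length of a value grows
  by at most \<open>O(t)\<close>, so running times agree with those of Turing machines up to a polynomial.
\<close>

datatype aexp =
    Const nat
  | Read string aexp
  | Add aexp aexp
  | Sub aexp aexp
  | Half aexp

datatype com =
    Skip
  | Write string aexp aexp
  | Seq com com
  | If aexp com com
  | While aexp com

type_synonym store = "string \<Rightarrow> nat \<Rightarrow> nat"

primrec aval :: "aexp \<Rightarrow> store \<Rightarrow> nat" where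
  "aval (Const c) s = c"
| "aval (Read a e) s = s a (aval e s)"
| "aval (Add e1 e2) s = aval e1 s + aval e2 s"
| "aval (Sub e1 e2) s = aval e1 s - aval e2 s"
| "aval (Half e) s = aval e s div 2"

primrec acost :: "aexp \<Rightarrow> nat" where
  "acost (Const c) = 1"
| "acost (Read a e) = 1 + acost e"
| "acost (Add e1 e2) = 1 + acost e1 + acost e2"
| "acost (Sub e1 e2) = 1 + acost e1 + acost e2"
| "acost (Half e) = 1 + acost e"

text \<open>
  \<open>exec p s t s'\<close>: started in store \<open>s\<close>, the program \<open>p\<close> halts after \<open>t\<close> steps in store \<open>s'\<close>.
  A condition counts as true iff its value is nonzero.
\<close>

inductive exec :: "com \<Rightarrow> store \<Rightarrow> nat \<Rightarrow> store \<Rightarrow> bool" where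
  Skip: "exec Skip s 1 s"
| Write: "exec (Write a i e) s (1 + acost i + acost e) (s(a := (s a)(aval i s := aval e s)))"
| Seq: "exec c1 s t1 s1 \<Longrightarrow> exec c2 s1 t2 s2 \<Longrightarrow> exec (Seq c1 c2) s (t1 + t2) s2"
| If_true: "aval b s \<noteq> 0 \<Longrightarrow> exec c1 s t s' \<Longrightarrow> exec (If b c1 c2) s (1 + acost b + t) s'"
| If_false: "aval b s = 0 \<Longrightarrow> exec c2 s t s' \<Longrightarrow> exec (If b c1 c2) s (1 + acost b + t) s'"
| While_false: "aval b s = 0 \<Longrightarrow> exec (While b c) s (1 + acost b) s"
| While_true: "aval b s \<noteq> 0 \<Longrightarrow> exec c s t1 s1 \<Longrightarrow> exec (While b c) s1 t2 s2 \<Longrightarrow>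
    exec (While b c) s (1 + acost b + t1 + t2) s2"

inductive_cases exec_SkipE: "exec Skip s t s'"
inductive_cases exec_WriteE: "exec (Write a i e) s t s'"
inductive_cases exec_SeqE: "exec (Seq c1 c2) s t s'"
inductive_cases exec_IfE: "exec (If b c1 c2) s t s'"
inductive_cases exec_WhileE: "exec (While b c) s t s'"

lemma exec_deterministic:
  "exec p s t s' \<Longrightarrow> exec p s u s'' \<Longrightarrow> u = t \<and> s'' = s'"
proof (induction arbitrary: u s'' rule: exec.induct)
  case (Skip s)
  from Skip.prems show ?case by (rule exec_SkipE) simp
next
  case (Write a i e s)
  from Write.prems show ?case by (rule exec_WriteE) simp
next
  case (Seq c1 s t1 s1 c2 t2 s2)
  from Seq.prems obtain u1 r u2
    where u: "u = u1 + u2" and c1: "exec c1 s u1 r" and c2: "exec c2 r u2 s''"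
    by (rule exec_SeqE)
  from Seq.IH(1)[OF c1] have r: "u1 = t1" "r = s1" by blast+
  from Seq.IH(2)[OF c2[unfolded r]] u r show ?case by blast
next
  case (If_true b s c1 t s' c2)
  from If_true.prems If_true.hyps(1) obtain u1
    where u: "u = Suc (acost b + u1)" and c: "exec c1 s u1 s''"
    by (elim exec_IfE) simp_all
  from If_true.IH[OF c] show ?case unfolding u by simp
next
  case (If_false b s c2 t s' c1)
  from If_false.prems If_false.hyps(1) obtain u1
    where u: "u = Suc (acost b + u1)" and c: "exec c2 s u1 s''"
    by (elim exec_IfE) simp_all
  from If_false.IH[OF c] show ?case unfolding u by simp
next
  case (While_false b s c)
  from While_false.prems show ?case by (rule exec_WhileE) (use While_false.hyps in simp_all)
next
  case (While_true b s c t1 s1 t2 s2)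
  from While_true.prems obtain u1 r u2
    where u: "u = Suc (acost b + u1 + u2)" and c: "exec c s u1 r" and w: "exec (While b c) r u2 s''"
    by (rule exec_WhileE) (use While_true.hyps(1) in simp_all)
  from While_true.IH(1)[OF c] have r: "u1 = t1" "r = s1" by blast+
  from While_true.IH(2)[OF w[unfolded r]] show ?case unfolding u r by simp
qed

text \<open>
  The same three arrays are used for input and output: \<open>bits\<close> holds a binary string, \<open>len\<close> its
  length, and \<open>par\<close> the parameter. On output, all other memory cells are irrelevant.
\<close>

definition init_store :: "bool list \<Rightarrow> nat \<Rightarrow> store" where
  "init_store x k =
     (\<lambda>a i. if a = ''bits'' \<and> i < length x then of_bool (x ! i)
            else if a = ''len'' \<and> i = 0 then length x
            else if a = ''par'' \<and> i = 0 then k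
            else 0)"

definition holds_instance :: "store \<Rightarrow> bool list \<Rightarrow> nat \<Rightarrow> bool" where
  "holds_instance s x k \<longleftrightarrow>
     s ''len'' 0 = length x \<and> s ''par'' 0 = k \<and> (\<forall>i<length x. s ''bits'' i = of_bool (x ! i))"

definition computable :: "(nat \<Rightarrow> nat) \<Rightarrow> bool" where
  "computable f \<longleftrightarrow> (\<exists>p. \<forall>n. \<exists>t s'. exec p (init_store [] n) t s' \<and> s' ''par'' 0 = f n)"


section \<open>Parameterized problems, fpt-reductions and W[1]\<close>

type_synonym param_problem = "(bool list \<times> nat) set"

definition fpt_reducible :: "param_problem \<Rightarrow> param_problem \<Rightarrow> bool" (infix \<open>\<le>\<^sub>f\<^sub>p\<^sub>t\<close> 50) where
  "A \<le>\<^sub>f\<^sub>p\<^sub>t B \<longleftrightarrow>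
     (\<exists>p f g c. computable f \<and> computable g \<and>
        (\<forall>x k. \<exists>x' k' t s'.
            exec p (init_store x k) t s' \<and> holds_instance s' x' k' \<and>
            t \<le> f k * (length x + 1) ^ c \<and>
            k' \<le> g k \<and>
            ((x, k) \<in> A \<longleftrightarrow> (x', k') \<in> B)))"

text \<open>
  Numbers are written in binary, least significant bit first and without leading zeros. Lists of
  numbers are encoded self-delimitingly: every bit is preceded by \<open>True\<close>, every number is terminated
  by \<open>False\<close>.
\<close>

fun bits_of_nat :: "nat \<Rightarrow> bool list" where
  "bits_of_nat n = (if n = 0 then [] else odd n # bits_of_nat (n div 2))"

declare bits_of_nat.simps [simp del]

definition encode_nat :: "nat \<Rightarrow> bool list" where
  "encode_nat n = concat (map (\<lambda>b. [True, b]) (bits_of_nat n)) @ [False]"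

definition encode_nats :: "nat list \<Rightarrow> bool list" where
  "encode_nats ns = concat (map encode_nat ns)"

text \<open>A literal \<open>(v, b)\<close> is the variable \<open>v\<close> if \<open>b\<close> holds and its negation otherwise.\<close>

type_synonym literal = "nat \<times> bool"
type_synonym clause = "literal list"
type_synonym cnf = "clause list"

definition cnf_vars :: "cnf \<Rightarrow> nat set" where
  "cnf_vars F = (\<Union>C\<in>set F. fst ` set C)"

definition cnf_satisfied :: "nat set \<Rightarrow> cnf \<Rightarrow> bool" where
  "cnf_satisfied X F \<longleftrightarrow> (\<forall>C\<in>set F. \<exists>(v, b)\<in>set C. (v \<in> X) = b)"

definition encode_cnf :: "cnf \<Rightarrow> bool list" where
  "encode_cnf F = encode_nats
     (length F # concat (map (\<lambda>C. length C # concat (map (\<lambda>(v, b). [v, of_bool b]) C)) F))"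

text \<open>
  Weighted satisfiability for \<open>\<Gamma>\<^sub>1\<^sub>,\<^sub>d\<close>, the class of conjunctions of disjunctions of at most \<open>d\<close>
  literals: is there a satisfying assignment setting exactly \<open>k\<close> variables of the formula to true?
  The parameter is \<open>k\<close>.
\<close>

definition WSAT_Gamma1 :: "nat \<Rightarrow> param_problem" where
  "WSAT_Gamma1 d =
     {(encode_cnf F, k) | F k.
        (\<forall>C\<in>set F. length C \<le> d) \<and>
        (\<exists>X\<subseteq>cnf_vars F. card X = k \<and> cnf_satisfied X F)}"

text \<open>
  W[1] is the closure under fpt-reductions of the weighted satisfiability problems for \<open>\<Gamma>\<^sub>1\<^sub>,\<^sub>d\<close>,
  \<open>d \<ge> 1\<close>.
\<close>

definition W1 :: "param_problem set" where
  "W1 = {A. \<exists>d\<ge>1. A \<le>\<^sub>f\<^sub>p\<^sub>t WSAT_Gamma1 d}"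

definition W1_hard :: "param_problem \<Rightarrow> bool" where
  "W1_hard B \<longleftrightarrow> (\<forall>A\<in>W1. A \<le>\<^sub>f\<^sub>p\<^sub>t B)"


section \<open>Labelled directed token moving\<close>

text \<open>The label of a token is its position in the list.\<close>

type_synonym 'a configuration = "'a list"
type_synonym 'a move = "'a \<times> 'a"

definition labelled_configuration :: "'a pair_pre_digraph \<Rightarrow> 'a configuration \<Rightarrow> bool" where
  "labelled_configuration D c \<longleftrightarrow> distinct c \<and> set c \<subseteq> pverts D"

definition is_free :: "'a pair_pre_digraph \<Rightarrow> 'a configuration \<Rightarrow> 'a \<Rightarrow> bool" where
  "is_free D c v \<longleftrightarrow> v \<in> pverts D \<and> v \<notin> set c"

definition free_path :: "'a pair_pre_digraph \<Rightarrow> 'a configuration \<Rightarrow> 'a list \<Rightarrow> bool" where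
  "free_path D c p \<longleftrightarrow> vpath p (with_proj D) \<and> (\<forall>v\<in>set (butlast (tl p)). is_free D c v)"

fun valid_move :: "'a pair_pre_digraph \<Rightarrow> 'a configuration \<Rightarrow> 'a move \<Rightarrow> bool" where
  "valid_move D c (s, t) \<longleftrightarrow>
     s \<in> set c \<and> is_free D c t \<and> (\<exists>p. free_path D c p \<and> hd p = s \<and> last p = t)"

fun execute_move :: "'a move \<Rightarrow> 'a configuration \<Rightarrow> 'a configuration" where
  "execute_move (s, t) c = map (\<lambda>v. if v = s then t else v) c"

fun valid_moves :: "'a pair_pre_digraph \<Rightarrow> 'a configuration \<Rightarrow> 'a move list \<Rightarrow> bool" where
  "valid_moves D c [] \<longleftrightarrow> True"
| "valid_moves D c (m # ms) \<longleftrightarrow> valid_move D c m \<and> valid_moves D (execute_move m c) ms"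

definition transforming_sequence ::
    "'a pair_pre_digraph \<Rightarrow> 'a configuration \<Rightarrow> 'a configuration \<Rightarrow> 'a move list \<Rightarrow> bool" where
  "transforming_sequence D S T ms \<longleftrightarrow> valid_moves D S ms \<and> fold execute_move ms S = T"

definition ldtm_instance ::
    "'a pair_pre_digraph \<Rightarrow> 'a configuration \<Rightarrow> 'a configuration \<Rightarrow> bool" where
  "ldtm_instance D S T \<longleftrightarrow>
     pair_digraph D \<and> labelled_configuration D S \<and> labelled_configuration D T \<and>
     length S = length T"

definition ldtm_yes ::
    "'a pair_pre_digraph \<Rightarrow> 'a configuration \<Rightarrow> 'a configuration \<Rightarrow> nat \<Rightarrow> bool" where
  "ldtm_yes D S T l \<longleftrightarrow> (\<exists>ms. transforming_sequence D S T ms \<and> length ms \<le> l)"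

definition free_count :: "'a pair_pre_digraph \<Rightarrow> 'a configuration \<Rightarrow> 'a configuration \<Rightarrow> nat" where
  "free_count D S T = card (pverts D) - card (set S \<union> set T)"

text \<open>
  For the encoding, the vertices are \<open>0, \<dots>, n - 1\<close>. An instance is the list of numbers consisting
  of \<open>n\<close>, the adjacency matrix row by row, the number of tokens, \<open>S\<close>, \<open>T\<close> and the length bound.
\<close>

definition encode_ldtm ::
    "nat pair_pre_digraph \<Rightarrow> nat configuration \<Rightarrow> nat configuration \<Rightarrow> nat \<Rightarrow> bool list" where
  "encode_ldtm D S T l =
     (let n = card (pverts D) in
      encode_nats ([n] @ [of_bool ((u, v) \<in> parcs D). u \<leftarrow> [0..<n], v \<leftarrow> [0..<n]]
                   @ [length S] @ S @ T @ [l]))"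

definition LDTM :: param_problem where
  "LDTM =
     {(encode_ldtm D S T l, l + free_count D S T) | D S T l.
        (\<exists>n. pverts D = {0..<n}) \<and> ldtm_instance D S T \<and> ldtm_yes D S T l}"

lemma bits_of_nat_inject: "bits_of_nat m = bits_of_nat n \<Longrightarrow> m = n"
proof (induction m arbitrary: n rule: less_induct)
  case (less m)
  note eq = less.prems
  show ?case
  proof (cases "m = 0 \<or> n = 0")
    case True
    then show ?thesis using eq
      by (auto simp: bits_of_nat.simps[of m] bits_of_nat.simps[of n] split: if_splits)
  next
    case False
    then have "odd m = odd n" "bits_of_nat (m div 2) = bits_of_nat (n div 2)"
      using eq by (auto simp: bits_of_nat.simps[of m] bits_of_nat.simps[of n])
    moreover from this(2) False have "m div 2 = n div 2"
      by (intro less.IH) auto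
    ultimately show ?thesis
      by (metis odd_two_times_div_two_succ dvd_mult_div_cancel)
  qed
qed

lemma encode_nat_append_inject:
  assumes "encode_nat m @ xs = encode_nat n @ ys"
  shows "m = n \<and> xs = ys"
proof -
  let ?e = "\<lambda>bs. concat (map (\<lambda>b. [True, b]) bs)"
  have inj: "?e bs @ False # xs = ?e cs @ False # ys \<Longrightarrow> bs = cs \<and> xs = ys" for bs cs
  proof (induction bs arbitrary: cs)
    case Nil
    then show ?case by (cases cs) auto
  next
    case (Cons b bs)
    then show ?case by (cases cs) auto
  qed
  have "?e (bits_of_nat m) @ False # xs = ?e (bits_of_nat n) @ False # ys"
    using assms unfolding encode_nat_def by simp
  from inj[OF this] show ?thesis using bits_of_nat_inject[of m n] by blast
qed

lemma encode_nats_inject: "encode_nats ms = encode_nats ns \<Longrightarrow> ms = ns"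
proof (induction ms arbitrary: ns)
  case Nil
  then show ?case by (cases ns) (auto simp: encode_nats_def encode_nat_def)
next
  case (Cons m ms)
  then show ?case
  proof (cases ns)
    case Nil
    then show ?thesis using Cons.prems by (auto simp: encode_nats_def encode_nat_def)
  next
    case (Cons n ns')
    then have "encode_nat m @ encode_nats ms = encode_nat n @ encode_nats ns'"
      using Cons.prems by (simp add: encode_nats_def)
    with encode_nat_append_inject have "m = n" "encode_nats ms = encode_nats ns'" by blast+
    with Cons.IH Cons show ?thesis by simp
  qed
qed

lemma encode_cnf_inject: "encode_cnf F = encode_cnf G \<Longrightarrow> F = G"
proof -
  let ?lit = "\<lambda>(v, b). [v, of_bool b :: nat]"
  let ?cl = "\<lambda>C :: clause. length C # concat (map ?lit C)"
  have lits: "length C = length C' \<Longrightarrow> concat (map ?lit C) @ xs = concat (map ?lit C') @ ys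
      \<Longrightarrow> C = C' \<and> xs = ys" for C C' :: clause and xs ys
    by (induction C C' rule: list_induct2) (auto simp: of_bool_def split: if_splits)
  have "length F = length G \<Longrightarrow> concat (map ?cl F) = concat (map ?cl G) \<Longrightarrow> F = G"
  proof (induction F G rule: list_induct2)
    case (Cons C F C' G)
    then show ?case using lits[of C C'] by auto
  qed simp
  then show "encode_cnf F = encode_cnf G \<Longrightarrow> F = G"
    unfolding encode_cnf_def by (auto dest: encode_nats_inject)
qed

lemma matrix_inject:
  "(concat (map (\<lambda>u. map (\<lambda>v. of_bool (P u v)) ys) xs) :: nat list) @ as
     = concat (map (\<lambda>u. map (\<lambda>v. of_bool (Q u v)) ys) xs) @ bs
   \<Longrightarrow> (\<forall>u\<in>set xs. \<forall>v\<in>set ys. P u v = Q u v) \<and> as = bs"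
proof (induction xs)
  case Nil
  then show ?case by simp
next
  case (Cons u xs)
  let ?C = "\<lambda>P. concat (map (\<lambda>u. map (\<lambda>v. of_bool (P u v) :: nat) ys) xs)"
  let ?r = "\<lambda>P. map (\<lambda>v. of_bool (P u v) :: nat) ys"
  from Cons.prems have eq: "?r P @ (?C P @ as) = ?r Q @ (?C Q @ bs)"
    by (simp only: list.map concat.simps append_assoc)
  then have r: "?r P = ?r Q" and c: "?C P @ as = ?C Q @ bs"
    using append_eq_append_conv[of "?r P" "?r Q" "?C P @ as" "?C Q @ bs"] by simp_all
  from r have "\<forall>v\<in>set ys. P u v = Q u v" by (simp add: of_bool_eq_iff)
  with Cons.IH[OF c] show ?case unfolding list.set ball_simps by blast
qed

lemma encode_ldtm_inject:
  assumes D: "pair_digraph D" "pverts D = {0..<n}" and D': "pair_digraph D'" "pverts D' = {0..<n'}"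
    and len: "length S = length T" "length S' = length T'"
    and eq: "encode_ldtm D S T l = encode_ldtm D' S' T' l'"
  shows "D = D' \<and> S = S' \<and> T = T' \<and> l = l'"
proof -
  let ?M = "\<lambda>D. concat (map (\<lambda>u. map (\<lambda>v. of_bool ((u, v) \<in> parcs D)) [0..<n]) [0..<n]) :: nat list"
  have n: "n = n'" and rest: "?M D @ (length S # S @ T @ [l]) = ?M D' @ (length S' # S' @ T' @ [l'])"
    using encode_nats_inject[OF eq[unfolded encode_ldtm_def Let_def]] D(2) D'(2) by auto
  from matrix_inject[OF rest]
  have arcs: "\<forall>u<n. \<forall>v<n. (u, v) \<in> parcs D \<longleftrightarrow> (u, v) \<in> parcs D'"
    and tail: "length S # S @ T @ [l] = length S' # S' @ T' @ [l']" by auto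
  interpret D: pair_digraph D by fact
  interpret D': pair_digraph D' by fact
  have "u < n \<and> v < n" if "(u, v) \<in> parcs D" for u v
    using D.arc_fst_in_verts[OF that] D.arc_snd_in_verts[OF that] D(2) by simp
  moreover have "u < n \<and> v < n" if "(u, v) \<in> parcs D'" for u v
    using D'.arc_fst_in_verts[OF that] D'.arc_snd_in_verts[OF that] D'(2) n by simp
  ultimately have "parcs D = parcs D'" using arcs by (intro set_eqI) (metis surj_pair)
  then have "D = D'" using D(2) D'(2) n by (simp add: pair_pre_digraph.equality)
  with tail len show ?thesis by auto
qed

end

theory Submission
  imports Defs
begin

text \<open>
  A weighted satisfiability instance with clauses of at most \<open>d\<close> literals becomes a constraint
  satisfaction problem with \<open>f(k)\<close> left and \<open>k + 1\<close> right slots in which all constraints are between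
  a left and a right slot. The right slots hold the true variables. For every tuple of more than \<open>d\<close>
  right slots, a left slot certifies by a path in a bounded search tree that the true variables hit
  all clauses whose negated variables occur in the tuple.

  This problem becomes a token moving instance in which every item of a slot is a vertex with a
  token. For each pair of slots, a token has to travel through an item of the left slot and a
  compatible item of the right one. The length bound permits exactly one direct move of each of these
  tokens, and one item per slot to step aside into a buffer and back, so that all of them
  pass through the same choice of items. Only the buffers are free vertices outside of the two
  configurations.
\<close>

text \<open>On its way to the sink a token crosses one left and one right item, so a single move
  tests only a binary constraint between the two sides. The number of slots, unlike that of items,
  must stay bounded in the parameter, because every slot contributes to the free vertices and to the
  length bound. No slot can therefore inspect a whole clause or all true variables. Tuples of
  \<open>d + 1\<close> right slots suffice since a clause has at most \<open>d\<close> negated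
  variables, and \<open>d + 1 \<ge> 2\<close> lets tuples enforce that distinct right slots hold
  distinct variables. The budget \<open>2 * (A + B) + A * B\<close> equals the sum of unavoidable
  moves: one for each travelling token, and two for an item of each slot, which has to leave and to
  return.

  The second obstacle is the composition with an arbitrary reduction to weighted satisfiability. The
  running time of that reduction bounds the number of ones in its output but not the announced
  length, which can be exponential in it. So the time of the second program has to be bounded in
  terms of the ones.\<close>

declare execute_move.simps [simp del] valid_move.simps [simp del]

section \<open>Counting the moves of each token\<close>

text \<open>A move names vertices, not labels; following the configuration tells which token it
  moves.\<close>

primrec move_count :: "nat \<Rightarrow> 'a move list \<Rightarrow> 'a configuration \<Rightarrow> nat" where
  "move_count i [] c = 0"
| "move_count i (m # ms) c = of_bool (c ! i = fst m) + move_count i ms (execute_move m c)"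

lemma length_execute_move [simp]: "length (execute_move m c) = length c"
  by (cases m) (simp add: execute_move.simps)

lemma length_fold_execute_move [simp]: "length (fold execute_move ms c) = length c"
  by (induction ms arbitrary: c) auto

lemma nth_execute_move:
  "i < length c \<Longrightarrow> execute_move m c ! i = (if c ! i = fst m then snd m else c ! i)"
  by (cases m) (simp add: execute_move.simps)

lemma distinct_execute_move:
  assumes "distinct c" "valid_move D c m"
  shows "distinct (execute_move m c)"
  using assms by (cases m) (auto simp: execute_move.simps valid_move.simps distinct_map is_free_def inj_on_def)

lemma valid_moves_append:
  "valid_moves D c (xs @ ys) \<longleftrightarrow> valid_moves D c xs \<and> valid_moves D (fold execute_move xs c) ys"
  by (induction xs arbitrary: c) auto

lemma distinct_fold_execute_move:
  "distinct c \<Longrightarrow> valid_moves D c ms \<Longrightarrow> distinct (fold execute_move ms c)"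
  by (induction ms arbitrary: c) (auto dest: distinct_execute_move)

lemma move_count_append:
  "move_count i (xs @ ys) c = move_count i xs c + move_count i ys (fold execute_move xs c)"
  by (induction xs arbitrary: c) auto

text \<open>The source of a valid move is occupied and configurations stay distinct, so each move
  belongs to exactly one label. This turns the length bound into a budget shared by the
  tokens.\<close>

lemma sum_move_count:
  "distinct c \<Longrightarrow> valid_moves D c ms \<Longrightarrow> (\<Sum>i<length c. move_count i ms c) = length ms"
proof (induction ms arbitrary: c)
  case (Cons m ms)
  have "fst m \<in> set c" using Cons.prems by (cases m) (auto simp: valid_move.simps)
  then obtain j where j: "j < length c" "c ! j = fst m" by (auto simp: in_set_conv_nth)
  then have "c ! i = fst m \<longleftrightarrow> i = j" if "i < length c" for i
    using that Cons.prems(1) nth_eq_iff_index_eq by fastforce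
  then have "(\<Sum>i<length c. of_bool (c ! i = fst m)) = (\<Sum>i<length c. if i = j then 1 else 0 :: nat)"
    by (intro sum.cong) auto
  also have "\<dots> = 1" using j by simp
  finally show ?case
    using Cons.IH[of "execute_move m c"] Cons.prems distinct_execute_move[of c D m]
    by (simp add: sum.distrib)
qed simp

lemma nth_fold_move_count_0:
  "i < length c \<Longrightarrow> move_count i ms c = 0 \<Longrightarrow> fold execute_move ms c ! i = c ! i"
  by (induction ms arbitrary: c) (auto simp: nth_execute_move split: if_splits)

text \<open>Cutting at the first move finds the token still at home. With \<open>k = 0\<close> this
  is its only move, which must lead directly to its target.\<close>

lemma first_move:
  assumes "i < length c" "move_count i ms c = Suc k"
  shows "\<exists>ms1 t ms2. ms = ms1 @ (c ! i, t) # ms2 \<and>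
    move_count i ms2 (execute_move (c ! i, t) (fold execute_move ms1 c)) = k \<and>
    fold execute_move ms1 c ! i = c ! i"
  using assms
proof (induction ms arbitrary: c)
  case (Cons m ms)
  show ?case
  proof (cases "c ! i = fst m")
    case True
    then show ?thesis using Cons.prems
      by (intro exI[of _ "[]"] exI[of _ "snd m"] exI[of _ ms]) auto
  next
    case False
    then have eq: "execute_move m c ! i = c ! i" using Cons.prems by (simp add: nth_execute_move)
    from False Cons.prems Cons.IH[of "execute_move m c"] obtain ms1 t ms2
      where "ms = ms1 @ (c ! i, t) # ms2"
       "move_count i ms2 (execute_move (c ! i, t) (fold execute_move ms1 (execute_move m c))) = k"
       "fold execute_move ms1 (execute_move m c) ! i = c ! i"
      unfolding eq by auto
    then show ?thesis by (intro exI[of _ "m # ms1"] exI[of _ t] exI[of _ ms2]) auto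
  qed
qed simp

text \<open>This gives access to the arc by which a token enters its final vertex; it serves the
  right slots as \<open>first_move\<close> serves the left ones.\<close>

lemma last_move:
  assumes "i < length c" "move_count i ms c \<noteq> 0"
  shows "\<exists>ms1 s ms2. ms = ms1 @ (s, fold execute_move ms c ! i) # ms2 \<and>
    fold execute_move ms1 c ! i = s"
  using assms
proof (induction ms arbitrary: c)
  case (Cons m ms)
  show ?case
  proof (cases "move_count i ms (execute_move m c) = 0")
    case True
    with Cons.prems have "c ! i = fst m" by (auto split: if_splits)
    moreover from this have "fold execute_move (m # ms) c ! i = snd m"
      using nth_fold_move_count_0[OF _ True] Cons.prems by (simp add: nth_execute_move)
    ultimately show ?thesis
      by (intro exI[of _ "[]"] exI[of _ "fst m"] exI[of _ ms]) auto
  next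
    case False
    with Cons.prems Cons.IH[of "execute_move m c"] obtain ms1 s ms2
      where "ms = ms1 @ (s, fold execute_move ms (execute_move m c) ! i) # ms2"
       "fold execute_move ms1 (execute_move m c) ! i = s" by auto
    then show ?thesis by (intro exI[of _ "m # ms1"] exI[of _ s] exI[of _ ms2]) auto
  qed
qed simp

lemma valid_moves_split:
  assumes "valid_moves D c (ms1 @ (s, t) # ms2)"
  shows "valid_move D (fold execute_move ms1 c) (s, t)"
  using assms by (auto simp: valid_moves_append)

text \<open>A single move that brings the token home would have as its target the vertex on which
  the token stands, which is not free.\<close>

lemma move_count_return:
  assumes "i < length c" "valid_moves D c ms" "fold execute_move ms c ! i = c ! i"
    "move_count i ms c \<noteq> 0"
  shows "2 \<le> move_count i ms c"
proof (rule ccontr)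
  assume "\<not> ?thesis"
  with assms(4) have "move_count i ms c = Suc 0" by auto
  from first_move[OF assms(1) this] obtain ms1 t ms2 where
    ms: "ms = ms1 @ (c ! i, t) # ms2" and
    0: "move_count i ms2 (execute_move (c ! i, t) (fold execute_move ms1 c)) = 0" and
    i: "fold execute_move ms1 c ! i = c ! i" by blast
  have "is_free D (fold execute_move ms1 c) t"
    using valid_moves_split[of D c ms1 "c ! i" t ms2] assms(2) ms by (auto simp: valid_move.simps)
  moreover have "t \<in> set (fold execute_move ms1 c)"
  proof -
    have "fold execute_move ms c ! i = t"
      unfolding ms using nth_fold_move_count_0[OF _ 0] assms(1) i by (simp add: nth_execute_move)
    then have "t = fold execute_move ms1 c ! i" using assms(3) i by simp
    then show ?thesis using assms(1) by simp
  qed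
  ultimately show False by (simp add: is_free_def)
qed

section \<open>Valid moves as walks with free interior\<close>

lemma successively_vwalk:
  "vwalk p (with_proj D) \<Longrightarrow> successively (\<lambda>u v. (u, v) \<in> parcs D) p"
proof (induction p)
  case (Cons a p)
  then show ?case
    by (cases p) (auto simp: vwalk_def arcs_ends_def arc_to_ends_def)
qed simp

text \<open>The source is occupied and the target free, so they differ and the path splits as
  \<open>s # p @ [t]\<close>. Only its arcs and its free interior are kept, since the later
  arguments treat arbitrary walks.\<close>

lemma valid_moveD:
  assumes "valid_move D c (s, t)"
  shows "is_free D c t"
    and "\<exists>p. successively (\<lambda>u v. (u, v) \<in> parcs D) (s # p @ [t]) \<and> set p \<subseteq> {v. is_free D c v}"
proof -
  show "is_free D c t" using assms by (simp add: valid_move.simps)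
  from assms obtain q where q: "free_path D c q" "hd q = s" "last q = t" and s: "s \<in> set c"
    by (auto simp: valid_move.simps)
  then have "q \<noteq> []" by (auto simp: free_path_def vpath_def vwalk_def)
  moreover have "s \<noteq> t" using s \<open>is_free D c t\<close> by (auto simp: is_free_def)
  ultimately have "tl q \<noteq> []" using q by (cases q) auto
  then have "q = s # butlast (tl q) @ [t]" using q \<open>q \<noteq> []\<close>
    by (metis append_butlast_last_id last_tl list.collapse)
  moreover have "successively (\<lambda>u v. (u, v) \<in> parcs D) q"
    using q(1) successively_vwalk by (auto simp: free_path_def vpath_def)
  ultimately have "successively (\<lambda>u v. (u, v) \<in> parcs D) (s # butlast (tl q) @ [t])" by simp
  then show "\<exists>p. successively (\<lambda>u v. (u, v) \<in> parcs D) (s # p @ [t]) \<and> set p \<subseteq> {v. is_free D c v}"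
    using q(1) unfolding free_path_def by blast
qed

lemma valid_moveI:
  assumes "s \<in> set c" "is_free D c t" "set (s # p @ [t]) \<subseteq> pverts D"
    "successively (\<lambda>u v. (u, v) \<in> parcs D) (s # p @ [t])" "distinct (s # p @ [t])"
    "\<And>v. v \<in> set p \<Longrightarrow> is_free D c v"
  shows "valid_move D c (s, t)"
proof -
  have arcs: "set (vwalk_arcs q) \<subseteq> arcs_ends (with_proj D)"
    if "successively (\<lambda>u v. (u, v) \<in> parcs D) q" for q
    using that by (induction q rule: vwalk_arcs.induct) (auto simp: arcs_ends_def arc_to_ends_def)
  have "vpath (s # p @ [t]) (with_proj D)"
    unfolding vpath_def vwalk_def using assms(3,5) arcs[OF assms(4)] by simp
  then have "free_path D c (s # p @ [t])"
    unfolding free_path_def using assms(6) by (simp add: butlast_append)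
  then have "\<exists>q. free_path D c q \<and> hd q = s \<and> last q = t"
    by (intro exI[of _ "s # p @ [t]"]) simp
  then show ?thesis using assms(1,2) by (simp add: valid_move.simps)
qed

text \<open>Executes a phase of moves along a prescribed chain of configurations, so that only a
  single step has to be checked.\<close>

lemma valid_moves_map_upt:
  assumes "\<And>j. j < k \<Longrightarrow> valid_move D (c j) (f j) \<and> execute_move (f j) (c j) = c (Suc j)"
  shows "valid_moves D (c 0) (map f [0..<k]) \<and> fold execute_move (map f [0..<k]) (c 0) = c k"
  using assms by (induction k) (auto simp: valid_moves_append)

section \<open>Token moving and bipartite constraint satisfaction\<close>

text \<open>
  There are \<open>A\<close> left and \<open>B\<close> right slots, each to be filled with one of \<open>Q\<close> items.
\<close>

definition fillable :: "nat \<Rightarrow> nat \<Rightarrow> nat \<Rightarrow> (nat \<Rightarrow> nat \<Rightarrow> nat \<Rightarrow> nat \<Rightarrow> bool) \<Rightarrow> bool" where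
  "fillable A B Q C \<longleftrightarrow> (\<exists>h x. (\<forall>\<sigma><A. h \<sigma> < Q) \<and> (\<forall>\<tau><B. x \<tau> < Q) \<and> (\<forall>\<sigma><A. \<forall>\<tau><B. C \<sigma> (h \<sigma>) \<tau> (x \<tau>)))"

text \<open>
  Vertices in order: the \<open>(A + B) * Q\<close> items, grouped by slots; a source and a sink for each pair
  of a left and a right slot; and one buffer for each slot.
\<close>

definition slot_adj ::
    "nat \<Rightarrow> nat \<Rightarrow> nat \<Rightarrow> (nat \<Rightarrow> nat \<Rightarrow> nat \<Rightarrow> nat \<Rightarrow> bool) \<Rightarrow> nat \<Rightarrow> nat \<Rightarrow> bool" where
  "slot_adj A B Q C u v \<longleftrightarrow> (let m = (A + B) * Q; k = A * B in
     (u < m \<and> v < m \<and> u div Q < A \<and> A \<le> v div Q \<and> C (u div Q) (u mod Q) (v div Q - A) (v mod Q)) \<or>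
     (m \<le> u \<and> u < m + k \<and> v < m \<and> v div Q = (u - m) div B) \<or>
     (u < m \<and> m + k \<le> v \<and> v < m + 2 * k \<and> u div Q = A + (v - (m + k)) mod B) \<or>
     (u < m \<and> v = m + 2 * k + u div Q) \<or>
     (v < m \<and> u = m + 2 * k + v div Q))"

definition slot_size :: "nat \<Rightarrow> nat \<Rightarrow> nat \<Rightarrow> nat" where
  "slot_size A B Q = (A + B) * Q + 2 * (A * B) + (A + B)"

definition slot_digraph ::
    "nat \<Rightarrow> nat \<Rightarrow> nat \<Rightarrow> (nat \<Rightarrow> nat \<Rightarrow> nat \<Rightarrow> nat \<Rightarrow> bool) \<Rightarrow> nat pair_pre_digraph" where
  "slot_digraph A B Q C = \<lparr>pverts = {0..<slot_size A B Q},
     parcs = {(u, v). u < slot_size A B Q \<and> v < slot_size A B Q \<and> slot_adj A B Q C u v}\<rparr>"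

definition slot_start :: "nat \<Rightarrow> nat \<Rightarrow> nat \<Rightarrow> nat list" where
  "slot_start A B Q = map (\<lambda>i. i) [0..<(A + B) * Q + A * B]"

definition slot_target :: "nat \<Rightarrow> nat \<Rightarrow> nat \<Rightarrow> nat list" where
  "slot_target A B Q =
     map (\<lambda>i. if i < (A + B) * Q then i else i + A * B) [0..<(A + B) * Q + A * B]"

section \<open>The slot digraph and its walks\<close>

locale slots =
  fixes A B Q :: nat and C :: "nat \<Rightarrow> nat \<Rightarrow> nat \<Rightarrow> nat \<Rightarrow> bool"
  assumes pos: "0 < A" "0 < B" "0 < Q"
begin

definition "m = (A + B) * Q"
definition "k = A * B"
definition "n = m + 2 * k + (A + B)"

abbreviation "D \<equiv> slot_digraph A B Q C"
abbreviation "S \<equiv> slot_start A B Q"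
abbreviation "T \<equiv> slot_target A B Q"

lemma verts_D [simp]: "pverts D = {0..<n}"
  by (simp add: slot_digraph_def n_def m_def k_def slot_size_def)

text \<open>The disjuncts are, in order: constraint arcs from left to right items, arcs from a
  source to its left slot, from a right slot to its sinks, from an item to the buffer of its slot,
  and back. Pair number \<open>e\<close> joins left slot \<open>e div B\<close> to right slot
  \<open>e mod B\<close>.\<close>

lemma arcs_D: "(u, v) \<in> parcs D \<longleftrightarrow> u < n \<and> v < n \<and>
     ((u < m \<and> v < m \<and> u div Q < A \<and> A \<le> v div Q \<and> C (u div Q) (u mod Q) (v div Q - A) (v mod Q)) \<or>
     (m \<le> u \<and> u < m + k \<and> v < m \<and> v div Q = (u - m) div B) \<or>
     (u < m \<and> m + k \<le> v \<and> v < m + 2 * k \<and> u div Q = A + (v - (m + k)) mod B) \<or>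
     (u < m \<and> v = m + 2 * k + u div Q) \<or>
     (v < m \<and> u = m + 2 * k + v div Q))"
  by (simp add: slot_digraph_def n_def m_def k_def slot_size_def slot_adj_def Let_def)

lemma S_eq: "S = [0..<m + k]"
  by (simp add: slot_start_def m_def k_def)

lemma T_eq: "T = map (\<lambda>i. if i < m then i else i + k) [0..<m + k]"
  by (simp add: slot_target_def m_def k_def)

lemma set_T: "set T = {0..<m} \<union> {m + k..<m + 2 * k}"
proof -
  let ?f = "\<lambda>i. if i < m then i else i + k"
  have "x \<in> ?f ` {0..<m + k}" if "x \<in> {0..<m} \<union> {m + k..<m + 2 * k}" for x
  proof (cases "x < m")
    case True
    then show ?thesis by (intro image_eqI[of _ _ x]) auto
  next
    case False
    with that show ?thesis by (intro image_eqI[of _ _ "x - k"]) auto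
  qed
  moreover have "?f i \<in> {0..<m} \<union> {m + k..<m + 2 * k}" if "i \<in> {0..<m + k}" for i
    using that by auto
  ultimately show ?thesis unfolding T_eq set_map set_upt by blast
qed

lemma slot_less: "u < m \<Longrightarrow> u div Q < A + B"
  unfolding m_def by (simp add: less_mult_imp_div_less)

lemma pair_digraph_D: "pair_digraph D"
proof
  show "finite (parcs D)"
    by (rule finite_subset[of _ "{0..<n} \<times> {0..<n}"]) (auto simp: arcs_D)
qed (auto simp: arcs_D)

lemma instance_D: "ldtm_instance D S T"
  unfolding ldtm_instance_def labelled_configuration_def
  using pair_digraph_D by (auto simp: S_eq T_eq distinct_map inj_on_def n_def)

lemma free_count_D: "free_count D S T = A + B"
proof -
  have "set S \<union> set T = {0..<m + 2 * k}" by (auto simp: S_eq set_T)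
  then show ?thesis by (simp add: free_count_def n_def)
qed

text \<open>The items of a slot with its buffer. A path may make detours through the buffer, so it
  is followed zone by zone instead of vertex by vertex.\<close>

definition zone :: "nat \<Rightarrow> nat \<Rightarrow> bool" where
  "zone sl v \<longleftrightarrow> v < m \<and> v div Q = sl \<or> v = m + 2 * k + sl"

text \<open>Arcs from a right zone stay inside or enter a sink of that slot, and sinks have no
  outgoing arcs, so the first sink on the walk is its last vertex.\<close>

lemma right_zone_walk:
  assumes "successively (\<lambda>u v. (u, v) \<in> parcs D) p" "p \<noteq> []" "zone sl (hd p)" "A \<le> sl" "sl < A + B"
    "e < k" "last p = m + k + e"
  shows "sl = A + e mod B"
  using assms
proof (induction p)
  case (Cons u p)
  have "p \<noteq> []" using Cons.prems by (auto simp: zone_def)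
  then have uv: "(u, hd p) \<in> parcs D" and suc: "successively (\<lambda>u v. (u, v) \<in> parcs D) p"
    using Cons.prems by (auto simp: successively_Cons)
  have "zone sl (hd p) \<or> (m + k \<le> hd p \<and> hd p < m + 2 * k \<and> sl = A + (hd p - (m + k)) mod B)"
    using uv Cons.prems(3-5) by (auto simp: arcs_D zone_def n_def)
  then show ?case
  proof
    assume "zone sl (hd p)"
    then show ?thesis using Cons \<open>p \<noteq> []\<close> suc by auto
  next
    assume *: "m + k \<le> hd p \<and> hd p < m + 2 * k \<and> sl = A + (hd p - (m + k)) mod B"
    then have "tl p = []" using suc \<open>p \<noteq> []\<close> by (cases p; cases "tl p") (auto simp: arcs_D)
    then have "hd p = last p" using \<open>p \<noteq> []\<close> by (cases p) auto
    then show ?thesis using * Cons.prems(7) \<open>p \<noteq> []\<close> by auto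
  qed
qed simp

text \<open>A left zone can be left only over a constraint arc. From there the walk is in a right
  zone, whose slot is fixed by the sink. Both ends of the arc precede the sink, so they are free
  when the walk is the rest of the path of a source token.\<close>

lemma left_zone_walk:
  assumes "successively (\<lambda>u v. (u, v) \<in> parcs D) p" "p \<noteq> []" "zone sl (hd p)" "sl < A"
    "e < k" "last p = m + k + e"
  shows "\<exists>u\<in>set (butlast p). \<exists>v\<in>set (butlast p). u < m \<and> v < m \<and> u div Q = sl \<and> v div Q = A + e mod B \<and>
    C sl (u mod Q) (e mod B) (v mod Q)"
  using assms
proof (induction p)
  case (Cons u p)
  have "p \<noteq> []" using Cons.prems by (auto simp: zone_def)
  then have uv: "(u, hd p) \<in> parcs D" and suc: "successively (\<lambda>u v. (u, v) \<in> parcs D) p"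
    using Cons.prems by (auto simp: successively_Cons)
  have "zone sl (hd p) \<or>
     (u < m \<and> u div Q = sl \<and> hd p < m \<and> A \<le> hd p div Q \<and> C sl (u mod Q) (hd p div Q - A) (hd p mod Q))"
    using uv Cons.prems(3-4) by (auto simp: arcs_D zone_def n_def)
  then show ?case
  proof
    assume "zone sl (hd p)"
    then show ?thesis using Cons \<open>p \<noteq> []\<close> suc by auto
  next
    assume *: "u < m \<and> u div Q = sl \<and> hd p < m \<and> A \<le> hd p div Q \<and>
      C sl (u mod Q) (hd p div Q - A) (hd p mod Q)"
    have e: "hd p div Q = A + e mod B"
      by (rule right_zone_walk[OF suc \<open>p \<noteq> []\<close>])
        (use * Cons.prems \<open>p \<noteq> []\<close> slot_less in \<open>auto simp: zone_def\<close>)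
    have "hd p \<in> set (butlast p)"
      using * Cons.prems(6) \<open>p \<noteq> []\<close> by (cases p; cases "tl p") auto
    then show ?thesis using * e \<open>p \<noteq> []\<close> by (intro bexI[of _ u] bexI[of _ "hd p"]) auto
  qed
qed simp

text \<open>A token that never moves keeps its item occupied by itself.\<close>

lemma moved_if_vacated:
  assumes "valid_moves D S (ms1 @ ms2)" "v < m"
    "is_free D (fold execute_move ms1 S) v \<or>
     (\<exists>i<m + k. i \<noteq> v \<and> fold execute_move ms1 S ! i = v)"
  shows "move_count v (ms1 @ ms2) S \<noteq> 0"
proof
  assume "move_count v (ms1 @ ms2) S = 0"
  then have "fold execute_move ms1 S ! v = v"
    using nth_fold_move_count_0[of v S ms1] assms(2) by (simp add: S_eq move_count_append)
  moreover have "distinct (fold execute_move ms1 S)"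
    using assms(1) distinct_fold_execute_move[of S D ms1] by (simp add: S_eq valid_moves_append)
  moreover have "v < length (fold execute_move ms1 S)" using assms(2) by (simp add: S_eq)
  ultimately show False
    using assms(3) nth_mem[of v "fold execute_move ms1 S"]
    by (auto simp: is_free_def nth_eq_iff_index_eq S_eq)
qed

text \<open>Each source token moves at least once, and each slot contains an item whose token moves
  and, having to return, moves at least twice. These demands exhaust the length bound. So exactly
  one item per slot ever moves, and each source token crosses the graph in a single move that can
  only use these items.\<close>

lemma fillable_if_yes:
  assumes "ldtm_yes D S T (2 * (A + B) + A * B)"
  shows "fillable A B Q C"
proof -
  from assms obtain ms where valid: "valid_moves D S ms" and final: "fold execute_move ms S = T"
    and len: "length ms \<le> 2 * (A + B) + k"
    unfolding ldtm_yes_def transforming_sequence_def k_def by blast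
  let ?c = "\<lambda>i. move_count i ms S"
  define M where "M = {v. v < m \<and> ?c v \<noteq> 0}"
  have lenS: "length S = m + k" and nthS: "i < m + k \<Longrightarrow> S ! i = i" for i by (auto simp: S_eq)
  have nthT: "i < m + k \<Longrightarrow> T ! i = (if i < m then i else i + k)" for i by (auto simp: T_eq)
  have total: "(\<Sum>i<m + k. ?c i) \<le> 2 * (A + B) + k"
    using sum_move_count[OF _ valid] len by (simp add: lenS) (simp add: S_eq)
  have source: "?c (m + e) \<noteq> 0" if "e < k" for e
  proof
    assume "?c (m + e) = 0"
    from nth_fold_move_count_0[OF _ this] that final lenS nthS[of "m + e"] nthT[of "m + e"]
    show False by simp
  qed
  \<comment> \<open>The first vertex after the source lies in the left slot and is free at that
    time, so its own token has moved.\<close>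
  have left: "\<exists>v\<in>M. v div Q = e div B" if e: "e < k" for e
  proof -
    from source[OF e] obtain j where "?c (m + e) = Suc j" using not0_implies_Suc by blast
    from first_move[OF _ this] e obtain ms1 t ms2 where
      ms: "ms = ms1 @ (m + e, t) # ms2"
      using lenS nthS[of "m + e"] by auto
    from valid_moves_split[of D S ms1 "m + e" t ms2] valid ms
    have v: "valid_move D (fold execute_move ms1 S) (m + e, t)" by simp
    from valid_moveD[OF v] obtain p where
      p: "successively (\<lambda>u v. (u, v) \<in> parcs D) ((m + e) # p @ [t])"
      "set p \<subseteq> {v. is_free D (fold execute_move ms1 S) v}" and
      t: "is_free D (fold execute_move ms1 S) t" by blast
    let ?v = "hd (p @ [t])"
    have free: "is_free D (fold execute_move ms1 S) ?v" using p(2) t by (cases p) auto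
    have "(m + e, ?v) \<in> parcs D" using p(1) by (simp add: successively_Cons)
    then have v: "?v < m" "?v div Q = e div B" using e by (auto simp: arcs_D)
    with free moved_if_vacated[of ms1 "(m + e, t) # ms2" ?v] valid ms
    have "?v \<in> M" by (auto simp: M_def)
    then show ?thesis using v by blast
  qed
  have right: "\<exists>v\<in>M. v div Q = A + e mod B" if e: "e < k" for e
  proof -
    from last_move[OF _ source[OF e]] e obtain ms1 s ms2 where
      ms: "ms = ms1 @ (s, m + k + e) # ms2" and s: "fold execute_move ms1 S ! (m + e) = s"
      using lenS final nthT[of "m + e"] by (auto simp: add.commute add.left_commute)
    let ?c1 = "fold execute_move ms1 S"
    from valid_moves_split[of D S ms1 s "m + k + e" ms2] valid ms
    have v: "valid_move D ?c1 (s, m + k + e)" by simp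
    from valid_moveD[OF v] obtain p where
      p: "successively (\<lambda>u v. (u, v) \<in> parcs D) ((s # p) @ [m + k + e])"
      "set p \<subseteq> {v. is_free D ?c1 v}" by auto
    let ?v = "last (s # p)"
    from p(1) have "(?v, m + k + e) \<in> parcs D"
      unfolding successively_append_iff by simp
    then have v: "?v < m" "?v div Q = A + e mod B" using e by (auto simp: arcs_D)
    \<comment> \<open>The vertex before the sink is either inside the path, hence free, or the start
      of the move, hence occupied by a token other than its own.\<close>
    have "is_free D ?c1 ?v \<or> (\<exists>i<m + k. i \<noteq> ?v \<and> ?c1 ! i = ?v)"
    proof (cases "p = []")
      case True
      then show ?thesis using e s v by (intro disjI2 exI[of _ "m + e"]) auto
    next
      case False
      then have "last p \<in> set p" by simp
      from subsetD[OF p(2) this] False show ?thesis by simp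
    qed
    from moved_if_vacated[OF _ v(1) this, of "(s, m + k + e) # ms2"] valid ms v
    have "?v \<in> M" by (auto simp: M_def)
    then show ?thesis using v by blast
  qed
  \<comment> \<open>A left slot is reached through its pair with right slot \<open>0\<close>, a
    right slot through its pair with left slot \<open>0\<close>.\<close>
  have "sl \<in> (\<lambda>v. v div Q) ` M" if "sl < A + B" for sl
  proof (cases "sl < A")
    case True
    then have "sl * B < k" unfolding k_def using pos by simp
    from left[OF this] show ?thesis using pos by force
  next
    case False
    then have "sl - A < B" using that by simp
    then have "sl - A < k" "(sl - A) mod B = sl - A"
      unfolding k_def using pos by (auto intro: less_le_trans)
    with right[of "sl - A"] False show ?thesis by force
  qed
  then have sub: "{..<A + B} \<subseteq> (\<lambda>v. v div Q) ` M" by blast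
  have finM: "finite M" by (simp add: M_def)
  have cardM: "A + B \<le> card M"
    using surj_card_le[OF finM sub] by simp
  have two: "2 \<le> ?c v" if "v \<in> M" for v
    using that move_count_return[OF _ valid, of v] final nthS[of v] nthT[of v] lenS
    by (auto simp: M_def)
  have "2 * card M = (\<Sum>v\<in>M. 2)" by simp
  also have "\<dots> \<le> (\<Sum>v\<in>M. ?c v)" using two by (rule sum_mono)
  also have "\<dots> \<le> (\<Sum>v<m. ?c v)" by (rule sum_mono2) (auto simp: M_def)
  finally have items: "2 * card M \<le> (\<Sum>v<m. ?c v)" .
  have split: "(\<Sum>i<m + j. ?c i) = (\<Sum>v<m. ?c v) + (\<Sum>e<j. ?c (m + e))" for j
    by (induction j) auto
  have "(\<Sum>e<k. 1) \<le> (\<Sum>e<k. ?c (m + e))" using source by (intro sum_mono) (simp add: Suc_leI)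
  then have "k \<le> (\<Sum>e<k. ?c (m + e))" by simp
  \<comment> \<open>The lower bounds \<open>2 * (A + B)\<close> for items and \<open>k\<close> for
    sources add up to the whole budget, so both are attained.\<close>
  have arith: "a \<le> A + B \<and> y \<le> k" if "z = x + y" "2 * a \<le> x" "z \<le> 2 * (A + B) + k" "A + B \<le> a" "k \<le> y"
    for a x y z :: nat using that by simp
  from arith[OF split items total cardM \<open>k \<le> (\<Sum>e<k. ?c (m + e))\<close>]
  have "card M \<le> A + B" and sources: "(\<Sum>e<k. ?c (m + e)) \<le> k" by auto
  then have "card M = A + B" using cardM by simp
  have one: "?c (m + e) = Suc 0" if "e < k" for e
  proof (rule ccontr)
    assume "?c (m + e) \<noteq> Suc 0"
    with source[OF that] have "1 < ?c (m + e)" by simp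
    then have "(\<Sum>e<k. 1) < (\<Sum>e<k. ?c (m + e))"
      using that source by (intro sum_strict_mono_ex1) (auto simp: Suc_leI)
    with sources show False by simp
  qed
  have "card ((\<lambda>v. v div Q) ` M) \<ge> A + B" using card_mono[OF _ sub] finM by simp
  then have inj: "inj_on (\<lambda>v. v div Q) M"
    using \<open>card M = A + B\<close> card_image_le[OF finM, of "\<lambda>v. v div Q"] finM
    by (intro eq_card_imp_inj_on) auto
  \<comment> \<open>The only moved item of each slot. It is the same for all pairs, which makes the
    choices consistent.\<close>
  define g where "g sl = (SOME v. v \<in> M \<and> v div Q = sl)" for sl
  have g: "g sl \<in> M \<and> g sl div Q = sl" if "sl < A + B" for sl
    unfolding g_def by (rule someI_ex) (use sub that in auto)
  have g_unique: "v = g sl" if "v \<in> M" "v div Q = sl" for v sl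
  proof -
    have "sl < A + B" using that slot_less by (auto simp: M_def)
    with g[of sl] that inj show ?thesis by (auto simp: inj_on_def)
  qed
  have C: "C \<sigma> (g \<sigma> mod Q) \<tau> (g (A + \<tau>) mod Q)" if \<sigma>: "\<sigma> < A" and \<tau>: "\<tau> < B" for \<sigma> \<tau>
  proof -
    define e where "e = \<sigma> * B + \<tau>"
    have e: "e < k" "e div B = \<sigma>" "e mod B = \<tau>"
    proof -
      have "(\<sigma> + 1) * B \<le> A * B" using \<sigma> by (intro mult_right_mono) auto
      then show "e < k" using \<tau> by (simp add: e_def k_def)
    qed (use \<tau> in \<open>auto simp: e_def\<close>)
    from first_move[OF _ one[OF e(1)]] e obtain ms1 t ms2 where
      ms: "ms = ms1 @ (m + e, t) # ms2" and
      0: "move_count (m + e) ms2 (execute_move (m + e, t) (fold execute_move ms1 S)) = 0" and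
      i: "fold execute_move ms1 S ! (m + e) = m + e"
      using lenS nthS[of "m + e"] by auto
    let ?c1 = "fold execute_move ms1 S"
    from valid_moves_split[of D S ms1 "m + e" t ms2] valid ms
    have v: "valid_move D ?c1 (m + e, t)" by simp
    \<comment> \<open>The only move of this source token ends on its sink, so one free path crosses
      both slots.\<close>
    have "T ! (m + e) = t"
      unfolding final[symmetric] ms
      using nth_fold_move_count_0[OF _ 0] e lenS i by (simp add: nth_execute_move)
    then have t: "t = m + k + e" using nthT[of "m + e"] e by simp
    from valid_moveD[OF v] obtain p where
      p: "successively (\<lambda>u v. (u, v) \<in> parcs D) ((m + e) # p @ [t])"
      "set p \<subseteq> {v. is_free D ?c1 v}" by blast
    have "p \<noteq> []" using p(1) t e by (auto simp: arcs_D)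
    have arc: "(m + e, hd p) \<in> parcs D" and suc: "successively (\<lambda>u v. (u, v) \<in> parcs D) (p @ [t])"
      using p(1) \<open>p \<noteq> []\<close> by (simp_all add: successively_Cons)
    from arc e(1) have "hd p < m \<and> hd p div Q = e div B" by (auto simp: arcs_D)
    then have "zone \<sigma> (hd p)" using e(2) by (simp add: zone_def)
    with left_zone_walk[OF suc _ _ \<sigma> e(1)] t \<open>p \<noteq> []\<close> e obtain u v where
      uv: "u \<in> set p" "v \<in> set p" "u < m" "v < m" "u div Q = \<sigma>" "v div Q = A + \<tau>"
      "C \<sigma> (u mod Q) \<tau> (v mod Q)" by auto
    have "z \<in> M" if "z \<in> set p" "z < m" for z
      using moved_if_vacated[of ms1 "(m + e, t) # ms2" z] valid ms that subsetD[OF p(2) that(1)]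
      by (simp add: M_def)
    then have "u = g \<sigma>" "v = g (A + \<tau>)" using uv g_unique by simp_all
    then show ?thesis using uv(7) by simp
  qed
  show ?thesis unfolding fillable_def
    using C pos by (intro exI[of _ "\<lambda>\<sigma>. g \<sigma> mod Q"] exI[of _ "\<lambda>\<tau>. g (A + \<tau>) mod Q"]) auto
qed

text \<open>The phases out, through and back take \<open>A + B\<close>, \<open>A * B\<close> and
  \<open>A + B\<close> moves. Source tokens do not block each other, since each passes the vacated
  items within one move and stops on its own sink.\<close>

lemma yes_if_fillable:
  assumes "fillable A B Q C"
  shows "ldtm_yes D S T (2 * (A + B) + A * B)"
proof -
  from assms obtain h x where h: "\<And>\<sigma>. \<sigma> < A \<Longrightarrow> h \<sigma> < Q" and x: "\<And>\<tau>. \<tau> < B \<Longrightarrow> x \<tau> < Q"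
    and C: "\<And>\<sigma> \<tau>. \<sigma> < A \<Longrightarrow> \<tau> < B \<Longrightarrow> C \<sigma> (h \<sigma>) \<tau> (x \<tau>)"
    unfolding fillable_def by blast
  define g where "g sl = sl * Q + (if sl < A then h sl else x (sl - A))" for sl
  have item: "(if sl < A then h sl else x (sl - A)) < Q" if "sl < A + B" for sl
    using that h x[of "sl - A"] by auto
  have g_div: "g sl div Q = sl" and g_mod: "g sl mod Q = (if sl < A then h sl else x (sl - A))"
    and g_less: "g sl < m" if "sl < A + B" for sl
  proof -
    note item = item[OF that]
    show "g sl div Q = sl" "g sl mod Q = (if sl < A then h sl else x (sl - A))"
      using item pos unfolding g_def by auto
    have "g sl < (sl + 1) * Q" using item unfolding g_def by simp
    also have "\<dots> \<le> m" unfolding m_def using that by (intro mult_right_mono) auto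
    finally show "g sl < m" .
  qed
  let ?b = "\<lambda>sl. m + 2 * k + sl"
  \<comment> \<open>The place of token \<open>i\<close> while the chosen items of the slots in
    \<open>R\<close> are in their buffers and the first \<open>y\<close> source tokens have
    arrived.\<close>
  define pl where "pl R y i = (if i < m then (if i div Q \<in> R \<and> i = g (i div Q) then ?b (i div Q) else i)
     else if i < m + y then i + k else i)" for R y i
  define cfg where "cfg R y = map (pl R y) [0..<m + k]" for R y
  have step: "execute_move (s, t) (cfg R y) = cfg R' y'"
    if "\<And>i. i < m + k \<Longrightarrow> pl R' y' i = (if pl R y i = s then t else pl R y i)" for s t R y R' y'
    using that by (simp add: cfg_def execute_move.simps)
  have free: "is_free D (cfg R y) v" if "v < n" "\<And>i. i < m + k \<Longrightarrow> pl R y i \<noteq> v" for R y v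
    using that by (fastforce simp: is_free_def cfg_def)
  have occ: "v \<in> set (cfg R y)" if "i < m + k" "pl R y i = v" for R y i v
    using that by (auto simp: cfg_def)
  have outwards: "valid_move D (cfg {..<j} 0) (g j, ?b j) \<and>
      execute_move (g j, ?b j) (cfg {..<j} 0) = cfg {..<Suc j} 0" if j: "j < A + B" for j
  proof
    show "valid_move D (cfg {..<j} 0) (g j, ?b j)"
    proof (rule valid_moveI[of _ _ _ _ "[]"])
      show "g j \<in> set (cfg {..<j} 0)"
        by (rule occ[of "g j"]) (use j g_less[OF j] in \<open>auto simp: pl_def g_div\<close>)
      show "is_free D (cfg {..<j} 0) (?b j)"
        by (rule free) (use j in \<open>auto simp: pl_def n_def\<close>)
    qed (use j g_less[OF j] g_div[OF j] in \<open>auto simp: n_def arcs_D\<close>)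
    show "execute_move (g j, ?b j) (cfg {..<j} 0) = cfg {..<Suc j} 0"
      by (rule step) (use j g_less[OF j] in \<open>auto simp: pl_def g_div less_Suc_eq\<close>)
  qed
  have inwards: "valid_move D (cfg {j..<A + B} k) (?b j, g j) \<and>
      execute_move (?b j, g j) (cfg {j..<A + B} k) = cfg {Suc j..<A + B} k" if j: "j < A + B" for j
  proof
    show "valid_move D (cfg {j..<A + B} k) (?b j, g j)"
    proof (rule valid_moveI[of _ _ _ _ "[]"])
      show "?b j \<in> set (cfg {j..<A + B} k)"
        by (rule occ[of "g j"]) (use j g_less[OF j] in \<open>auto simp: pl_def g_div\<close>)
      show "is_free D (cfg {j..<A + B} k) (g j)"
        by (rule free) (use j g_less[OF j] in \<open>auto simp: pl_def n_def g_div\<close>)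
    qed (use j g_less[OF j] g_div[OF j] in \<open>auto simp: n_def arcs_D\<close>)
    show "execute_move (?b j, g j) (cfg {j..<A + B} k) = cfg {Suc j..<A + B} k"
      by (rule step) (use j g_less[OF j] in \<open>auto simp: pl_def g_div Suc_le_eq le_less\<close>)
  qed
  have through: "valid_move D (cfg {..<A + B} e) (m + e, m + k + e) \<and>
      execute_move (m + e, m + k + e) (cfg {..<A + B} e) = cfg {..<A + B} (Suc e)" if e: "e < k" for e
  proof
    let ?s = "e div B" and ?t = "e mod B"
    have st: "?s < A" "?t < B" using e pos by (auto simp: k_def less_mult_imp_div_less)
    then have st': "?s < A + B" "A + ?t < A + B" by auto
    note g = g_less[OF st'(1)] g_less[OF st'(2)] g_div[OF st'(1)] g_div[OF st'(2)]
    show "valid_move D (cfg {..<A + B} e) (m + e, m + k + e)"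
    proof (rule valid_moveI[of _ _ _ _ "[g ?s, g (A + ?t)]"])
      show "m + e \<in> set (cfg {..<A + B} e)"
        by (rule occ[of "m + e"]) (use e in \<open>auto simp: pl_def\<close>)
      show "is_free D (cfg {..<A + B} e) (m + k + e)"
        by (rule free) (use e in \<open>auto simp: pl_def n_def\<close>)
      show "successively (\<lambda>u v. (u, v) \<in> parcs D) ((m + e) # [g ?s, g (A + ?t)] @ [m + k + e])"
        using g st C[OF st] g_mod[OF st'(1)] g_mod[OF st'(2)] e by (auto simp: arcs_D n_def)
      show "distinct ((m + e) # [g ?s, g (A + ?t)] @ [m + k + e])"
        using g st e by (auto simp: n_def)
      show "is_free D (cfg {..<A + B} e) v" if "v \<in> set [g ?s, g (A + ?t)]" for v
        by (rule free) (use that e g st slot_less in \<open>auto simp: pl_def n_def\<close>)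
    qed (use e g in \<open>auto simp: n_def\<close>)
    show "execute_move (m + e, m + k + e) (cfg {..<A + B} e) = cfg {..<A + B} (Suc e)"
      by (rule step) (use e in \<open>auto simp: pl_def\<close>)
  qed
  let ?P1 = "map (\<lambda>j. (g j, ?b j)) [0..<A + B]" and ?P2 = "map (\<lambda>e. (m + e, m + k + e)) [0..<k]"
    and ?P3 = "map (\<lambda>j. (?b j, g j)) [0..<A + B]"
  note P1 = valid_moves_map_upt[of "A + B" D "\<lambda>j. cfg {..<j} 0", OF outwards]
  note P2 = valid_moves_map_upt[of k D "\<lambda>e. cfg {..<A + B} e", OF through]
  note P3 = valid_moves_map_upt[of "A + B" D "\<lambda>j. cfg {j..<A + B} k", OF inwards]
  have start: "cfg {..<0} 0 = S" unfolding S_eq cfg_def by (rule map_idI) (auto simp: pl_def)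
  have target: "cfg {A + B..<A + B} k = T" unfolding T_eq cfg_def by (rule map_cong) (auto simp: pl_def)
  have "fold execute_move ?P2 (fold execute_move ?P1 S) = cfg {0..<A + B} k"
    unfolding start[symmetric] using P1 P2 by (simp add: atLeast0LessThan)
  with P1 P2 P3 have "valid_moves D S (?P1 @ ?P2 @ ?P3)" "fold execute_move (?P1 @ ?P2 @ ?P3) S = T"
    unfolding start[symmetric] target[symmetric] valid_moves_append fold_append comp_apply by simp_all
  then have "transforming_sequence D S T (?P1 @ ?P2 @ ?P3)"
    unfolding transforming_sequence_def by blast
  moreover have "length (?P1 @ ?P2 @ ?P3) = 2 * (A + B) + A * B" by (simp add: k_def)
  ultimately show ?thesis unfolding ldtm_yes_def by (intro exI[of _ "?P1 @ ?P2 @ ?P3"]) simp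
qed

end

section \<open>Weighted satisfiability as bipartite constraint satisfaction\<close>

text \<open>
  A right slot \<open>\<tau>\<close> holds a literal occurrence \<open>pos c a\<close> in the formula, standing for its variable, or
  \<open>0\<close>, which stands for a dummy variable; slot \<open>0\<close> holds the dummy. Together they hold the set of
  true variables. A left slot \<open>\<sigma>\<close> is a tuple of \<open>D > d\<close> right slots, and its item \<open>p\<close> contains a copy
  \<open>yd p\<close> of their contents. It also certifies that the true variables hit every clause that is active,
  i.e. whose negated variables are in this tuple. The certificate is a path in the search tree
  that repeatedly takes an unhit active clause and picks its literal number \<open>ad p t\<close>; since only the
  choices are stored, there are few items. The picked variable must occur in the right slot \<open>pd p t\<close>,
  which makes all constraints binary.
\<close>

locale csp =
  fixes F :: cnf and d k L A D Q :: nat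
    and pos :: "nat \<Rightarrow> nat \<Rightarrow> nat" and vn :: "nat \<Rightarrow> nat"
    and sd yd ad pd :: "nat \<Rightarrow> nat \<Rightarrow> nat"
  assumes clause: "\<And>C. C \<in> set F \<Longrightarrow> length C \<le> d" "d < D" "1 \<le> d"
    and vn_0: "vn 0 = 0"
    and vn_pos: "\<And>c a. c < length F \<Longrightarrow> a < length (F ! c) \<Longrightarrow> vn (pos c a) = Suc (fst (F ! c ! a))"
    and pos_le: "\<And>c a. c < length F \<Longrightarrow> a < length (F ! c) \<Longrightarrow> pos c a \<le> L"
    and A_pos: "0 < A" and L_less: "L < Q"
    and sd_less: "\<And>\<sigma> e. sd \<sigma> e < Suc k"
    and sd_surj: "\<And>f. (\<And>e. e < D \<Longrightarrow> f e < Suc k) \<Longrightarrow> \<exists>\<sigma><A. \<forall>e<D. sd \<sigma> e = f e"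
    and item_surj: "\<And>fy fa fp. (\<And>e. e < D \<Longrightarrow> fy e \<le> L) \<Longrightarrow> (\<And>t. t < Suc k \<Longrightarrow> fa t < d) \<Longrightarrow>
      (\<And>t. t < Suc k \<Longrightarrow> fp t < Suc k) \<Longrightarrow>
      \<exists>p<Q. (\<forall>e<D. yd p e = fy e) \<and> (\<forall>t<Suc k. ad p t = fa t \<and> pd p t = fp t)"
begin

abbreviation "nc \<equiv> length F"
abbreviation "cl c \<equiv> length (F ! c)"

definition active :: "(nat \<Rightarrow> nat) \<Rightarrow> nat \<Rightarrow> bool" where
  "active y c \<longleftrightarrow> (\<forall>a<cl c. \<not> snd (F ! c ! a) \<longrightarrow> (\<exists>e<D. vn (y e) = vn (pos c a)))"

definition hit :: "nat list \<Rightarrow> nat \<Rightarrow> bool" where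
  "hit l c \<longleftrightarrow> (\<exists>a<cl c. snd (F ! c ! a) \<and> (\<exists>z\<in>set l. vn z = vn (pos c a)))"

text \<open>Written as the loop that the machine will run: the result is the largest index of an
  unhit active clause, and \<open>nc\<close> if there is none.\<close>

definition unhit :: "(nat \<Rightarrow> nat) \<Rightarrow> nat list \<Rightarrow> nat" where
  "unhit y l = rec_nat nc (\<lambda>i x. if active y i \<and> \<not> hit l i then i else x) nc"

text \<open>A choice that names no positive literal yields the dummy \<open>0\<close>, so every
  number is a legal choice and the picks are always defined.\<close>

definition pick :: "(nat \<Rightarrow> nat) \<Rightarrow> nat \<Rightarrow> nat list \<Rightarrow> nat" where
  "pick y a l = (let c = unhit y l in if c < nc \<and> a < cl c \<and> snd (F ! c ! a) then pos c a else 0)"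

text \<open>The newest pick is at the head, so list index and step differ: the choice
  \<open>ad p t\<close> belongs to step \<open>t\<close>, the slot \<open>pd p t\<close> to list
  index \<open>t\<close>.\<close>

definition picks :: "(nat \<Rightarrow> nat) \<Rightarrow> (nat \<Rightarrow> nat) \<Rightarrow> nat \<Rightarrow> nat list" where
  "picks y \<alpha> t = rec_nat [] (\<lambda>t l. pick y (\<alpha> t) l # l) t"

definition occurrence :: "nat \<Rightarrow> bool" where
  "occurrence q \<longleftrightarrow> q = 0 \<or> (\<exists>c<nc. \<exists>a<cl c. q = pos c a)"

text \<open>The distinctness condition makes the number of true variables exactly \<open>k\<close>.
  The next two conditions tie the copies and the picks to the right slot at hand; those that concern
  one side only are repeated in every pair.\<close>

definition compatible :: "nat \<Rightarrow> nat \<Rightarrow> nat \<Rightarrow> nat \<Rightarrow> bool" where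
  "compatible \<sigma> p \<tau> q \<longleftrightarrow> occurrence q \<and> (\<tau> = 0 \<longrightarrow> q = 0) \<and>
     (\<forall>e<D. \<forall>e'<D. sd \<sigma> e \<noteq> sd \<sigma> e' \<longrightarrow> vn (yd p e) \<noteq> vn (yd p e')) \<and>
     (\<forall>e<D. sd \<sigma> e = \<tau> \<longrightarrow> vn q = vn (yd p e)) \<and>
     (\<forall>t<Suc k. pd p t < Suc k \<and> (pd p t = \<tau> \<longrightarrow> vn q = vn (picks (yd p) (ad p) (Suc k) ! t))) \<and>
     (\<forall>c<nc. active (yd p) c \<longrightarrow> hit (picks (yd p) (ad p) (Suc k)) c)"

lemma compatibleD:
  assumes "compatible \<sigma> p \<tau> q"
  shows "occurrence q" "\<tau> = 0 \<Longrightarrow> q = 0"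
    "e < D \<Longrightarrow> e' < D \<Longrightarrow> sd \<sigma> e \<noteq> sd \<sigma> e' \<Longrightarrow> vn (yd p e) \<noteq> vn (yd p e')"
    "e < D \<Longrightarrow> sd \<sigma> e = \<tau> \<Longrightarrow> vn q = vn (yd p e)"
    "t < Suc k \<Longrightarrow> pd p t < Suc k"
    "t < Suc k \<Longrightarrow> pd p t = \<tau> \<Longrightarrow> vn q = vn (picks (yd p) (ad p) (Suc k) ! t)"
    "c < nc \<Longrightarrow> active (yd p) c \<Longrightarrow> hit (picks (yd p) (ad p) (Suc k)) c"
  using assms unfolding compatible_def by blast+

section \<open>Correctness of the search tree certificates\<close>

lemma unhit_aux:
  "rec_nat n (\<lambda>i x. if P i then i else x) m = n \<and> (\<forall>i<m. \<not> P i) \<or>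
   rec_nat n (\<lambda>i x. if P i then i else x) m < m \<and> P (rec_nat n (\<lambda>i x. if P i then i else x) m)"
  by (induction m) (auto simp: less_Suc_eq)

lemma unhit_cases:
  "unhit y l = nc \<and> (\<forall>c<nc. active y c \<longrightarrow> hit l c) \<or>
   unhit y l < nc \<and> active y (unhit y l) \<and> \<not> hit l (unhit y l)"
  unfolding unhit_def
  using unhit_aux[where P = "\<lambda>i. active y i \<and> \<not> hit l i" and n = nc and m = nc] by blast

lemma picks_simps:
  "picks y \<alpha> 0 = []" "picks y \<alpha> (Suc t) = pick y (\<alpha> t) (picks y \<alpha> t) # picks y \<alpha> t"
  by (simp_all add: picks_def)

lemma length_picks [simp]: "length (picks y \<alpha> t) = t"
  by (induction t) (auto simp: picks_simps)

lemma active_cong: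
  assumes "\<And>e. e < D \<Longrightarrow> y e = y' e"
  shows "active y = active y'"
proof -
  have "(\<exists>e<D. vn (y e) = i) \<longleftrightarrow> (\<exists>e<D. vn (y' e) = i)" for i using assms by metis
  then show ?thesis by (simp add: active_def fun_eq_iff)
qed

lemma picks_cong:
  assumes "\<And>e. e < D \<Longrightarrow> y e = y' e" "\<And>s. s < t \<Longrightarrow> \<alpha> s = \<alpha>' s"
  shows "picks y \<alpha> t = picks y' \<alpha>' t"
  using assms(2) by (induction t) (simp_all add: picks_simps pick_def unhit_def active_cong[OF assms(1)])

lemma hit_mono: "hit l c \<Longrightarrow> set l \<subseteq> set l' \<Longrightarrow> hit l' c"
  by (auto simp: hit_def)

text \<open>The choices are guided by the satisfying assignment: in an unhit active clause, a
  positive literal with a true variable is picked. Each such variable is new, and there are only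
  \<open>k\<close> of them.\<close>

lemma search_succeeds:
  assumes X: "X \<subseteq> cnf_vars F" "card X = k" "cnf_satisfied X F"
    and y: "\<And>e. e < D \<Longrightarrow> vn (y e) \<in> insert 0 (Suc ` X)"
  shows "\<exists>\<alpha>. (\<forall>t. \<alpha> t < d) \<and> (\<forall>z\<in>set (picks y \<alpha> (Suc k)). vn z \<in> insert 0 (Suc ` X)) \<and>
    (\<forall>c<nc. active y c \<longrightarrow> hit (picks y \<alpha> (Suc k)) c)"
proof -
  have fin: "finite X" using X(1) by (rule finite_subset) (auto simp: cnf_vars_def)
  \<comment> \<open>The negated variables of an active clause belong to the tuple and are therefore
    true, so a satisfied literal of the clause is positive.\<close>
  have lit: "\<exists>a<d. a < cl c \<and> snd (F ! c ! a) \<and> fst (F ! c ! a) \<in> X" if c: "c < nc" "active y c" for c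
  proof -
    from X(3) c(1) obtain v b where vb: "(v, b) \<in> set (F ! c)" "(v \<in> X) = b"
      unfolding cnf_satisfied_def by fastforce
    then obtain a where a: "a < cl c" "F ! c ! a = (v, b)" by (auto simp: in_set_conv_nth)
    have b
    proof (rule ccontr)
      assume "\<not> b"
      then obtain e where "e < D" "vn (y e) = vn (pos c a)"
        using c a unfolding active_def by fastforce
      then have "Suc v \<in> insert 0 (Suc ` X)" using y vn_pos[OF c(1) a(1)] a by fastforce
      with vb \<open>\<not> b\<close> show False by auto
    qed
    moreover have "cl c \<le> d" using clause(1) c(1) by simp
    ultimately show ?thesis using a vb by (intro exI[of _ a]) auto
  qed
  define ch where "ch l = (if unhit y l < nc
      then SOME a. a < d \<and> a < cl (unhit y l) \<and> snd (F ! unhit y l ! a) \<and> fst (F ! unhit y l ! a) \<in> X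
      else 0)" for l
  have ch: "ch l < d" "unhit y l < nc \<Longrightarrow> ch l < cl (unhit y l) \<and> snd (F ! unhit y l ! ch l) \<and>
      fst (F ! unhit y l ! ch l) \<in> X" for l
  proof -
    have *: "ch l < d \<and> ch l < cl (unhit y l) \<and> snd (F ! unhit y l ! ch l) \<and>
      fst (F ! unhit y l ! ch l) \<in> X" if u: "unhit y l < nc"
    proof -
      have "active y (unhit y l)" using unhit_cases[of y l] u by auto
      from someI_ex[OF lit[OF u this, simplified]] show ?thesis
        using u by (simp add: ch_def)
    qed
    then show "ch l < d" using clause(3) by (cases "unhit y l < nc") (auto simp: ch_def)
    show "unhit y l < nc \<Longrightarrow> ch l < cl (unhit y l) \<and> snd (F ! unhit y l ! ch l) \<and>
      fst (F ! unhit y l ! ch l) \<in> X" using * by blast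
  qed
  define l where "l t = rec_nat [] (\<lambda>t l. pick y (ch l) l # l) t" for t :: nat
  have l_simps: "l 0 = []" "l (Suc t) = pick y (ch (l t)) (l t) # l t" for t
    by (simp_all add: l_def)
  have l_picks: "picks y (\<lambda>t. ch (l t)) t = l t" for t
    by (induction t) (simp_all add: l_simps picks_simps)
  have pick: "vn (pick y (ch l) l) \<in> insert 0 (Suc ` X)"
    "unhit y l < nc \<Longrightarrow> vn (pick y (ch l) l) \<in> Suc ` X - vn ` set l" for l
  proof -
    have *: "vn (pick y (ch l) l) \<in> Suc ` X - vn ` set l" if u: "unhit y l < nc"
    proof -
      have "\<not> hit l (unhit y l)" using unhit_cases[of y l] u by auto
      then show ?thesis using ch(2)[OF u] u vn_pos[OF u] unfolding hit_def
        by (force simp: pick_def)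
    qed
    then show "vn (pick y (ch l) l) \<in> insert 0 (Suc ` X)"
      by (cases "unhit y l < nc") (auto simp: pick_def vn_0)
    show "unhit y l < nc \<Longrightarrow> vn (pick y (ch l) l) \<in> Suc ` X - vn ` set l" using * .
  qed
  \<comment> \<open>As long as an active clause is unhit, the next pick adds a true variable that no
    earlier pick names.\<close>
  have progress: "(\<forall>c<nc. active y c \<longrightarrow> hit (l t) c) \<or> t \<le> card (vn ` set (l t) \<inter> Suc ` X)" for t
  proof (induction t)
    case (Suc t)
    show ?case
    proof (cases "\<forall>c<nc. active y c \<longrightarrow> hit (l t) c")
      case True
      then show ?thesis using hit_mono[of "l t" _ "l (Suc t)"] by (auto simp: l_simps)
    next
      case False
      then have u: "unhit y (l t) < nc" using unhit_cases[of y "l t"] by auto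
      have "vn ` set (l (Suc t)) \<inter> Suc ` X = insert (vn (pick y (ch (l t)) (l t))) (vn ` set (l t) \<inter> Suc ` X)"
        using pick(2)[OF u] by (auto simp: l_simps)
      then show ?thesis using pick(2)[OF u] Suc False by simp
    qed
  qed (simp add: l_simps)
  have "card (vn ` set (l (Suc k)) \<inter> Suc ` X) \<le> card (Suc ` X)"
    using fin by (intro card_mono) auto
  also have "\<dots> = k" using X(2) by (simp add: card_image)
  \<comment> \<open>\<open>Suc k\<close> different variables do not fit into \<open>X\<close>, so
    the search has ended by then.\<close>
  finally have "\<forall>c<nc. active y c \<longrightarrow> hit (l (Suc k)) c" using progress[of "Suc k"] by (metis not_less_eq_eq)
  moreover have "vn z \<in> insert 0 (Suc ` X)" if "z \<in> set (l t)" for z t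
    using that by (induction t) (use pick(1) in \<open>auto simp: l_simps\<close>)
  ultimately show ?thesis
    by (intro exI[of _ "\<lambda>t. ch (l t)"]) (use ch(1) in \<open>simp add: l_picks\<close>)
qed

text \<open>Slot \<open>0\<close> gets the dummy and the other slots one occurrence of each true
  variable. Along a path guided by \<open>X\<close> the picks name true variables or the dummy, so
  each pick finds a right slot that \<open>pd\<close> can point to.\<close>

lemma fillable_if_satisfiable:
  assumes X: "X \<subseteq> cnf_vars F" "card X = k" "cnf_satisfied X F"
  shows "fillable A (Suc k) Q compatible"
proof -
  have fin: "finite X" using X(1) by (rule finite_subset) (auto simp: cnf_vars_def)
  then obtain xs where xs: "distinct xs" "set xs = X" using finite_distinct_list by blast
  then have len: "length xs = k" using X(2) distinct_card by fastforce
  have "\<exists>q. occurrence q \<and> q \<le> L \<and> vn q = Suc v" if v: "v \<in> X" for v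
  proof -
    from v X(1) obtain C b where "C \<in> set F" "(v, b) \<in> set C" unfolding cnf_vars_def by auto
    then obtain c a where "c < nc" "a < cl c" "F ! c ! a = (v, b)"
      by (metis in_set_conv_nth)
    then show ?thesis using vn_pos pos_le by (intro exI[of _ "pos c a"]) (auto simp: occurrence_def)
  qed
  then obtain po where po: "\<And>v. v \<in> X \<Longrightarrow> occurrence (po v) \<and> po v \<le> L \<and> vn (po v) = Suc v" by metis
  define x where "x \<tau> = (case \<tau> of 0 \<Rightarrow> 0 | Suc i \<Rightarrow> po (xs ! i))" for \<tau>
  have x: "occurrence (x \<tau>)" "x \<tau> \<le> L" "vn (x \<tau>) \<in> insert 0 (Suc ` X)"
    "vn (x \<tau>) = (case \<tau> of 0 \<Rightarrow> 0 | Suc i \<Rightarrow> Suc (xs ! i))" if "\<tau> < Suc k" for \<tau>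
    using that po[of "xs ! (\<tau> - 1)"] len xs(2) nth_mem[of "\<tau> - 1" xs]
    by (auto simp: x_def occurrence_def vn_0 split: nat.split)
  have x_inj: "vn (x \<tau>) \<noteq> vn (x \<tau>')" if "\<tau> < Suc k" "\<tau>' < Suc k" "\<tau> \<noteq> \<tau>'" for \<tau> \<tau>'
    using that x(4) xs(1) len by (auto simp: nth_eq_iff_index_eq split: nat.split)
  have x_surj: "\<exists>\<tau><Suc k. vn (x \<tau>) = i" if "i \<in> insert 0 (Suc ` X)" for i
  proof (cases "i = 0")
    case True
    then show ?thesis using x(4)[of 0] by (intro exI[of _ 0]) auto
  next
    case False
    with that xs(2) len obtain j where "j < k" "i = Suc (xs ! j)" by (auto simp: in_set_conv_nth)
    then show ?thesis using x(4)[of "Suc j"] by (intro exI[of _ "Suc j"]) auto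
  qed
  have "\<exists>p<Q. \<forall>\<tau><Suc k. compatible \<sigma> p \<tau> (x \<tau>)" for \<sigma>
  proof -
    define y where "y e = x (sd \<sigma> e)" for e
    have vy: "vn (y e) \<in> insert 0 (Suc ` X)" if "e < D" for e
      using x(3)[OF sd_less] by (simp add: y_def)
    from search_succeeds[of X y, OF X vy] obtain \<alpha> where \<alpha>: "\<And>t. \<alpha> t < d"
      "\<And>z. z \<in> set (picks y \<alpha> (Suc k)) \<Longrightarrow> vn z \<in> insert 0 (Suc ` X)"
      "\<And>c. c < nc \<Longrightarrow> active y c \<Longrightarrow> hit (picks y \<alpha> (Suc k)) c" by blast
    have "\<exists>\<tau><Suc k. vn (x \<tau>) = vn (picks y \<alpha> (Suc k) ! t)" if "t < Suc k" for t
      by (rule x_surj, rule \<alpha>(2), rule nth_mem) (use that in simp)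
    then obtain \<pi> where \<pi>: "\<And>t. t < Suc k \<Longrightarrow> \<pi> t < Suc k \<and> vn (x (\<pi> t)) = vn (picks y \<alpha> (Suc k) ! t)"
      by metis
    obtain p where p: "p < Q" "\<And>e. e < D \<Longrightarrow> yd p e = y e" "\<And>t. t < Suc k \<Longrightarrow> ad p t = \<alpha> t"
      "\<And>t. t < Suc k \<Longrightarrow> pd p t = \<pi> t"
      using item_surj[of y \<alpha> \<pi>] x(2)[OF sd_less] \<alpha>(1) \<pi> unfolding y_def by blast
    have P: "picks (yd p) (ad p) (Suc k) = picks y \<alpha> (Suc k)"
      by (rule picks_cong) (use p in auto)
    have Ac: "active (yd p) = active y" by (rule active_cong) (use p in auto)
    have "compatible \<sigma> p \<tau> (x \<tau>)" if \<tau>: "\<tau> < Suc k" for \<tau>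
      unfolding compatible_def P Ac
    proof (intro conjI allI impI)
      show "occurrence (x \<tau>)" using x(1)[OF \<tau>] .
      show "x \<tau> = 0" if "\<tau> = 0" using that by (simp add: x_def)
      show "vn (yd p e) \<noteq> vn (yd p e')" if "e < D" "e' < D" "sd \<sigma> e \<noteq> sd \<sigma> e'" for e e'
        using that p(2) x_inj[OF sd_less sd_less] by (simp add: y_def)
      show "vn (x \<tau>) = vn (yd p e)" if "e < D" "sd \<sigma> e = \<tau>" for e
        using that p(2) by (simp add: y_def)
      show "pd p t < Suc k" if "t < Suc k" for t using that p(4) \<pi> by simp
      show "vn (x \<tau>) = vn (picks y \<alpha> (Suc k) ! t)" if "t < Suc k" "pd p t = \<tau>" for t
        using that p(4) \<pi>[of t] by (auto)
    qed (use \<alpha>(3) in blast)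
    with p(1) show ?thesis by blast
  qed
  then obtain h where "\<And>\<sigma>. h \<sigma> < Q \<and> (\<forall>\<tau><Suc k. compatible \<sigma> (h \<sigma>) \<tau> (x \<tau>))" by metis
  then show ?thesis unfolding fillable_def
    by (intro exI[of _ h] exI[of _ x]) (use x(2) L_less in \<open>auto intro: le_less_trans\<close>)
qed

text \<open>If the variables in the right slots violated a clause, all its negated variables would
  be in right slots. A tuple listing these makes the clause active, so its certificate hits it by a
  pick, and the picked variable occurs in a right slot: a positive literal of the clause is true
  after all.\<close>

lemma satisfiable_if_fillable:
  assumes "fillable A (Suc k) Q compatible"
  shows "\<exists>X\<subseteq>cnf_vars F. card X = k \<and> cnf_satisfied X F"
proof -
  from assms obtain h x where
    comp: "\<And>\<sigma> \<tau>. \<sigma> < A \<Longrightarrow> \<tau> < Suc k \<Longrightarrow> compatible \<sigma> (h \<sigma>) \<tau> (x \<tau>)"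
    unfolding fillable_def by blast
  have occ: "occurrence (x \<tau>)" if "\<tau> < Suc k" for \<tau>
    using compatibleD(1)[OF comp[OF A_pos that]] .
  have x0: "x 0 = 0" using compatibleD(2)[OF comp[OF A_pos, of 0]] by simp
  have copy: "vn (yd (h \<sigma>) e) = vn (x (sd \<sigma> e))" if "\<sigma> < A" "e < D" for \<sigma> e
    using compatibleD(4)[OF comp[OF that(1) sd_less[of \<sigma> e]] that(2)] by simp
  have x_inj: "vn (x \<tau>) \<noteq> vn (x \<tau>')" if "\<tau> < Suc k" "\<tau>' < Suc k" "\<tau> \<noteq> \<tau>'" for \<tau> \<tau>'
  proof -
    \<comment> \<open>A tuple with \<open>\<tau>\<close> in position \<open>0\<close> and
      \<open>\<tau>'\<close> in position \<open>1\<close>, which exists because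
      \<open>D \<ge> 2\<close>.\<close>
    define f where "f e = (if e = 0 then \<tau> else \<tau>')" for e :: nat
    have "f e < Suc k" for e using that by (simp add: f_def)
    then obtain \<sigma> where \<sigma>: "\<sigma> < A" "\<forall>e<D. sd \<sigma> e = f e" using sd_surj[of f] by blast
    have D: "0 < D" "1 < D" using clause(2,3) by simp_all
    have sd: "sd \<sigma> 0 = \<tau>" "sd \<sigma> 1 = \<tau>'" using \<sigma>(2) D by (auto simp: f_def)
    have "vn (yd (h \<sigma>) 0) \<noteq> vn (yd (h \<sigma>) 1)"
      using compatibleD(3)[OF comp[OF \<sigma>(1), of 0], of 0 1] sd D that(3) by simp
    with sd show ?thesis using copy[OF \<sigma>(1) D(1)] copy[OF \<sigma>(1) D(2)] by simp
  qed
  define X where "X = {v. \<exists>\<tau><Suc k. vn (x \<tau>) = Suc v}"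
  \<comment> \<open>By distinctness only slot \<open>0\<close> holds the dummy, so the other
    \<open>k\<close> slots name \<open>k\<close> different variables.\<close>
  have img: "Suc ` X = (\<lambda>\<tau>. vn (x \<tau>)) ` {1..k}"
  proof
    show "Suc ` X \<subseteq> (\<lambda>\<tau>. vn (x \<tau>)) ` {1..k}"
    proof
      fix i assume "i \<in> Suc ` X"
      then obtain \<tau> where \<tau>: "\<tau> < Suc k" "vn (x \<tau>) = i" "i \<noteq> 0" by (auto simp: X_def)
      then have "\<tau> \<noteq> 0" using x0 vn_0 by (intro notI) simp
      with \<tau> show "i \<in> (\<lambda>\<tau>. vn (x \<tau>)) ` {1..k}" by (intro image_eqI[of _ _ \<tau>]) auto
    qed
    show "(\<lambda>\<tau>. vn (x \<tau>)) ` {1..k} \<subseteq> Suc ` X"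
    proof
      fix i assume "i \<in> (\<lambda>\<tau>. vn (x \<tau>)) ` {1..k}"
      then obtain \<tau> where \<tau>: "1 \<le> \<tau>" "\<tau> < Suc k" "i = vn (x \<tau>)" by auto
      with x_inj[of 0 \<tau>] x0 vn_0 have "i \<noteq> 0" by auto
      then obtain v where "i = Suc v" using not0_implies_Suc by blast
      moreover from this \<tau> have "v \<in> X" unfolding X_def by (intro CollectI exI[of _ \<tau>]) simp
      ultimately show "i \<in> Suc ` X" by simp
    qed
  qed
  have "card X = card (Suc ` X)" by (simp add: card_image)
  also have "\<dots> = card {1..k}" unfolding img
    by (intro card_image inj_onI, rule ccontr) (use x_inj in \<open>auto simp: less_Suc_eq_le\<close>)
  finally have card: "card X = k" by simp
  have sub: "X \<subseteq> cnf_vars F"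
  proof
    fix v assume "v \<in> X"
    then obtain \<tau> where "\<tau> < Suc k" "vn (x \<tau>) = Suc v" by (auto simp: X_def)
    with occ[of \<tau>] vn_0 obtain c a where "c < nc" "a < cl c" "vn (pos c a) = Suc v"
      unfolding occurrence_def by force
    moreover from this have "fst (F ! c ! a) = v" using vn_pos by simp
    ultimately show "v \<in> cnf_vars F" unfolding cnf_vars_def
      by (intro UN_I[of "F ! c"] image_eqI[of _ _ "F ! c ! a"]) auto
  qed
  have "\<exists>(v, b)\<in>set (F ! c). (v \<in> X) = b" if c: "c < nc" for c
  proof (rule ccontr)
    assume unsat: "\<not> ?thesis"
    have lit: "(fst (F ! c ! a) \<in> X) \<noteq> snd (F ! c ! a)" if "a < cl c" for a
      using unsat nth_mem[OF that] by (cases "F ! c ! a") auto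
    have "\<exists>\<tau><Suc k. vn (x \<tau>) = vn (pos c a)" if "a < cl c" "\<not> snd (F ! c ! a)" for a
      using lit[OF that(1)] that vn_pos[OF c that(1)] by (auto simp: X_def)
    then obtain f where f: "\<And>a. a < cl c \<Longrightarrow> \<not> snd (F ! c ! a) \<Longrightarrow> f a < Suc k \<and> vn (x (f a)) = vn (pos c a)"
      by metis
    \<comment> \<open>Position \<open>a\<close> of the tuple is reserved for literal
      \<open>a\<close>, which is possible as \<open>cl c \<le> d < D\<close>; the remaining
      positions are padded with slot \<open>0\<close>.\<close>
    define f' where "f' e = (if e < cl c \<and> \<not> snd (F ! c ! e) then f e else 0)" for e
    have "f' e < Suc k" for e using f by (simp add: f'_def)
    then obtain \<sigma> where \<sigma>: "\<sigma> < A" "\<And>e. e < D \<Longrightarrow> sd \<sigma> e = f' e" using sd_surj[of f'] by blast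
    have "cl c \<le> d" using clause(1) c by simp
    then have "a < D \<and> vn (yd (h \<sigma>) a) = vn (pos c a)" if "a < cl c" "\<not> snd (F ! c ! a)" for a
      using that f[OF that] f'_def[of a] \<sigma>(2)[of a] copy[OF \<sigma>(1), of a] clause(2) by simp
    then have "active (yd (h \<sigma>)) c" unfolding active_def by blast
    then have "hit (picks (yd (h \<sigma>)) (ad (h \<sigma>)) (Suc k)) c"
      using compatibleD(7)[OF comp[OF \<sigma>(1), of 0] c] by simp
    then obtain a z where a: "a < cl c" "snd (F ! c ! a)" and
      z: "z \<in> set (picks (yd (h \<sigma>)) (ad (h \<sigma>)) (Suc k))" "vn z = vn (pos c a)"
      unfolding hit_def by blast
    from z obtain t where t: "t < Suc k"
      "vn (picks (yd (h \<sigma>)) (ad (h \<sigma>)) (Suc k) ! t) = vn (pos c a)"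
      unfolding in_set_conv_nth length_picks by auto
    have pd: "pd (h \<sigma>) t < Suc k" using compatibleD(5)[OF comp[OF \<sigma>(1), of 0] t(1)] by simp
    have "vn (x (pd (h \<sigma>) t)) = vn (pos c a)"
      using compatibleD(6)[OF comp[OF \<sigma>(1) pd] t(1)] t(2) by simp
    with pd have "fst (F ! c ! a) \<in> X"
      using vn_pos[OF c a(1)] by (auto simp: X_def)
    with lit[OF a(1)] a(2) show False by simp
  qed
  then have "cnf_satisfied X F" unfolding cnf_satisfied_def by (auto simp: in_set_conv_nth)
  with card sub show ?thesis by blast
qed

end

section \<open>Running times of programs\<close>

text \<open>Total correctness with a step bound. The postcondition is an argument, so that rules
  compose by nesting, as with weakest preconditions.\<close>

definition runs :: "com \<Rightarrow> store \<Rightarrow> nat \<Rightarrow> (store \<Rightarrow> bool) \<Rightarrow> bool" where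
  "runs p s b Q \<longleftrightarrow> (\<exists>t s'. exec p s t s' \<and> t \<le> b \<and> Q s')"

lemma runs_mono:
  "runs p s b Q \<Longrightarrow> b \<le> b' \<Longrightarrow> (\<And>s'. Q s' \<Longrightarrow> Q' s') \<Longrightarrow> runs p s b' Q'"
  unfolding runs_def by (meson order_trans)

lemma runs_Skip: "Q s \<Longrightarrow> 1 \<le> b \<Longrightarrow> runs Skip s b Q"
  unfolding runs_def using exec.Skip by blast

lemma runs_Write:
  "Q (s(a := (s a)(aval i s := aval e s))) \<Longrightarrow> 1 + acost i + acost e \<le> b \<Longrightarrow> runs (Write a i e) s b Q"
  unfolding runs_def using exec.Write by blast

lemma runs_Seq:
  "runs p s b1 (\<lambda>s'. runs q s' b2 Q) \<Longrightarrow> runs (Seq p q) s (b1 + b2) Q"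
  unfolding runs_def using exec.Seq by (meson add_mono)

lemma runs_If:
  "(aval b s \<noteq> 0 \<Longrightarrow> runs p s n Q) \<Longrightarrow> (aval b s = 0 \<Longrightarrow> runs q s n Q) \<Longrightarrow>
   1 + acost b + n \<le> m \<Longrightarrow> runs (If b p q) s m Q"
  unfolding runs_def
  by (cases "aval b s = 0") (meson exec.If_true exec.If_false add_left_mono order_trans)+

text \<open>The index of the invariant is the variant; the factor \<open>n + 1\<close> pays for at
  most \<open>n\<close> rounds and the final test.\<close>

lemma runs_While:
  assumes step: "\<And>n s. I n s \<Longrightarrow> aval b s \<noteq> 0 \<Longrightarrow> \<exists>n'<n. runs p s c (I n')"
    and "I n s"
  shows "runs (While b p) s ((n + 1) * (1 + acost b + c)) (\<lambda>s'. (\<exists>n. I n s') \<and> aval b s' = 0)"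
  using assms(2)
proof (induction n arbitrary: s rule: less_induct)
  case (less n)
  show ?case
  proof (cases "aval b s = 0")
    case True
    then have "exec (While b p) s (1 + acost b) s" by (rule exec.While_false)
    then show ?thesis unfolding runs_def using less.prems True
      by (intro exI[of _ "1 + acost b"] exI[of _ s]) auto
  next
    case False
    from step[OF less.prems False] obtain n' t1 s1
      where n': "n' < n" and e1: "exec p s t1 s1" "t1 \<le> c" "I n' s1"
      unfolding runs_def by blast
    from less.IH[OF n' e1(3)] obtain t2 s2
      where e2: "exec (While b p) s1 t2 s2" "t2 \<le> (n' + 1) * (1 + acost b + c)"
        "\<exists>n. I n s2" "aval b s2 = 0"
      unfolding runs_def by blast
    have "(n' + 1) * (1 + acost b + c) \<le> n * (1 + acost b + c)"
      using n' by (intro mult_right_mono) auto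
    with e1 e2 have "1 + acost b + t1 + t2 \<le> (n + 1) * (1 + acost b + c)"
      by (simp add: algebra_simps)
    with exec.While_true[OF False e1(1) e2(1)] e2(3,4) show ?thesis
      unfolding runs_def by blast
  qed
qed

section \<open>A functional expression language\<close>

text \<open>
  Expressions are evaluated in an array \<open>w\<close> that they cannot change and in an environment of local
  variables with de Bruijn indices.
\<close>

datatype ex =
    Num nat
  | Var nat
  | Inp ex
  | Plus ex ex
  | Minus ex ex
  | Halve ex
  | Cond ex ex ex
  | Bind ex ex
  | Iter ex ex ex

definition push :: "nat \<Rightarrow> (nat \<Rightarrow> nat) \<Rightarrow> nat \<Rightarrow> nat" where
  "push x \<rho> i = (case i of 0 \<Rightarrow> x | Suc j \<Rightarrow> \<rho> j)"

lemma push_simps [simp]: "push x \<rho> 0 = x" "push x \<rho> (Suc j) = \<rho> j"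
  by (simp_all add: push_def)

lemma push_numeral [simp]: "push x \<rho> (numeral k) = \<rho> (pred_numeral k)"
  by (simp add: numeral_eq_Suc)

primrec ev :: "(nat \<Rightarrow> nat) \<Rightarrow> (nat \<Rightarrow> nat) \<Rightarrow> ex \<Rightarrow> nat" where
  "ev w \<rho> (Num c) = c"
| "ev w \<rho> (Var i) = \<rho> i"
| "ev w \<rho> (Inp e) = w (ev w \<rho> e)"
| "ev w \<rho> (Plus a b) = ev w \<rho> a + ev w \<rho> b"
| "ev w \<rho> (Minus a b) = ev w \<rho> a - ev w \<rho> b"
| "ev w \<rho> (Halve a) = ev w \<rho> a div 2"
| "ev w \<rho> (Cond b x y) = (if ev w \<rho> b \<noteq> 0 then ev w \<rho> x else ev w \<rho> y)"
| "ev w \<rho> (Bind a b) = ev w (push (ev w \<rho> a) \<rho>) b"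
| "ev w \<rho> (Iter n a b) =
     rec_nat (ev w \<rho> a) (\<lambda>i x. ev w (push x (push i \<rho>)) b) (ev w \<rho> n)"

text \<open>The body of a loop has to obey the bound for all values of its variables, reachable or
  not, so the condition is checked without following the iteration.\<close>

primrec iter_le :: "nat \<Rightarrow> (nat \<Rightarrow> nat) \<Rightarrow> (nat \<Rightarrow> nat) \<Rightarrow> ex \<Rightarrow> bool" where
  "iter_le N w \<rho> (Num c) = True"
| "iter_le N w \<rho> (Var i) = True"
| "iter_le N w \<rho> (Inp e) = iter_le N w \<rho> e"
| "iter_le N w \<rho> (Plus a b) = (iter_le N w \<rho> a \<and> iter_le N w \<rho> b)"
| "iter_le N w \<rho> (Minus a b) = (iter_le N w \<rho> a \<and> iter_le N w \<rho> b)"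
| "iter_le N w \<rho> (Halve a) = iter_le N w \<rho> a"
| "iter_le N w \<rho> (Cond b x y) = (iter_le N w \<rho> b \<and> iter_le N w \<rho> x \<and> iter_le N w \<rho> y)"
| "iter_le N w \<rho> (Bind a b) = (iter_le N w \<rho> a \<and> iter_le N w (push (ev w \<rho> a) \<rho>) b)"
| "iter_le N w \<rho> (Iter n a b) =
     (iter_le N w \<rho> n \<and> iter_le N w \<rho> a \<and> ev w \<rho> n \<le> N \<and>
      (\<forall>i x. iter_le N w (push x (push i \<rho>)) b))"

text \<open>
  Variable \<open>i\<close> is stored in cell \<open>loc i\<close> of the array \<open>v\<close>, whose cells from \<open>h\<close> on are free. The
  result goes to cell \<open>h\<close>.
\<close>

abbreviation V :: "nat \<Rightarrow> aexp" where
  "V i \<equiv> Read ''v'' (Const i)"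

text \<open>For \<open>Iter\<close>, the cells \<open>h\<close>, \<open>h + 1\<close> and
  \<open>h + 2\<close> hold the number of rounds, the accumulator and the counter. Inside the body,
  index \<open>0\<close> is the accumulator and index \<open>1\<close> the counter.\<close>

primrec compile :: "ex \<Rightarrow> (nat \<Rightarrow> nat) \<Rightarrow> nat \<Rightarrow> com" where
  "compile (Num c) loc h = Write ''v'' (Const h) (Const c)"
| "compile (Var i) loc h = Write ''v'' (Const h) (V (loc i))"
| "compile (Inp e) loc h = Seq (compile e loc h) (Write ''v'' (Const h) (Read ''w'' (V h)))"
| "compile (Plus a b) loc h =
     Seq (compile a loc h) (Seq (compile b loc (h + 1))
       (Write ''v'' (Const h) (Add (V h) (V (h + 1)))))"
| "compile (Minus a b) loc h =
     Seq (compile a loc h) (Seq (compile b loc (h + 1))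
       (Write ''v'' (Const h) (Sub (V h) (V (h + 1)))))"
| "compile (Halve a) loc h = Seq (compile a loc h) (Write ''v'' (Const h) (Half (V h)))"
| "compile (Cond b x y) loc h =
     Seq (compile b loc h) (If (V h) (compile x loc h) (compile y loc h))"
| "compile (Bind a b) loc h =
     Seq (compile a loc h) (Seq (compile b (push h loc) (h + 1))
       (Write ''v'' (Const h) (V (h + 1))))"
| "compile (Iter n a b) loc h =
     Seq (compile n loc h) (Seq (compile a loc (h + 1)) (Seq (Write ''v'' (Const (h + 2)) (Const 0))
       (Seq (While (Sub (V h) (V (h + 2)))
          (Seq (compile b (push (h + 1) (push (h + 2) loc)) (h + 3))
            (Seq (Write ''v'' (Const (h + 1)) (V (h + 3)))
              (Write ''v'' (Const (h + 2)) (Add (V (h + 2)) (Const 1))))))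
         (Write ''v'' (Const h) (V (h + 1))))))"

text \<open>Every loop is charged \<open>N\<close> rounds and a final test, and a conditional both
  branches. The bound thus depends on the limit \<open>N\<close> alone and is a polynomial in it for
  fixed syntax.\<close>

primrec time :: "nat \<Rightarrow> ex \<Rightarrow> nat" where
  "time N (Num c) = 3"
| "time N (Var i) = 4"
| "time N (Inp e) = time N e + 5"
| "time N (Plus a b) = time N a + (time N b + 7)"
| "time N (Minus a b) = time N a + (time N b + 7)"
| "time N (Halve a) = time N a + 5"
| "time N (Cond b x y) = time N b + (3 + (time N x + time N y))"
| "time N (Bind a b) = time N a + (time N b + 4)"
| "time N (Iter n a b) =
     time N n + (time N a + (3 + ((N + 1) * (6 + (time N b + (4 + 6))) + 4)))"

text \<open>The frame condition carries the induction: cells below \<open>h\<close> hold the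
  variables and the intermediate results of enclosing expressions.\<close>

lemma runs_compile:
  assumes "\<And>i. loc i < h \<and> s ''v'' (loc i) = \<rho> i" "s ''w'' = w" "iter_le N w \<rho> e"
  shows "runs (compile e loc h) s (time N e)
    (\<lambda>s'. s' ''v'' h = ev w \<rho> e \<and> (\<forall>j<h. s' ''v'' j = s ''v'' j) \<and> (\<forall>a. a \<noteq> ''v'' \<longrightarrow> s' a = s a))"
  using assms
proof (induction e arbitrary: loc h s \<rho>)
  case (Num c)
  then show ?case by (auto intro!: runs_Write)
next
  case (Var i)
  then show ?case by (auto intro!: runs_Write)
next
  case (Inp e)
  show ?case unfolding compile.simps time.simps
    by (rule runs_Seq, rule runs_mono[OF Inp.IH[of loc h s \<rho>]])
      (use Inp.prems in \<open>auto intro!: runs_Write\<close>)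
next
  case (Plus a b)
  note le = less_SucI[OF conjunct1[OF Plus.prems(1)]] and lt = conjunct1[OF Plus.prems(1)]
  show ?case unfolding compile.simps time.simps
    apply (rule runs_Seq, rule runs_mono[OF Plus.IH(1)[of loc h s \<rho>]])
    using Plus.prems apply (auto intro!: runs_Write)
    apply (rule runs_Seq, rule runs_mono[OF Plus.IH(2)[of loc "Suc h" _ \<rho>]])
    using Plus.prems apply (auto intro!: runs_Write simp: le lt)
    done
next
  case (Minus a b)
  note le = less_SucI[OF conjunct1[OF Minus.prems(1)]] and lt = conjunct1[OF Minus.prems(1)]
  show ?case unfolding compile.simps time.simps
    apply (rule runs_Seq, rule runs_mono[OF Minus.IH(1)[of loc h s \<rho>]])
    using Minus.prems apply (auto intro!: runs_Write)
    apply (rule runs_Seq, rule runs_mono[OF Minus.IH(2)[of loc "Suc h" _ \<rho>]])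
    using Minus.prems apply (auto intro!: runs_Write simp: le lt)
    done
next
  case (Halve a)
  show ?case unfolding compile.simps time.simps
    by (rule runs_Seq, rule runs_mono[OF Halve.IH[of loc h s \<rho>]])
      (use Halve.prems in \<open>auto intro!: runs_Write\<close>)
next
  case (Cond b x y)
  note lt = conjunct1[OF Cond.prems(1)]
  show ?case unfolding compile.simps time.simps
    apply (rule runs_Seq, rule runs_mono[OF Cond.IH(1)[of loc h s \<rho>]])
    using Cond.prems apply auto[4]
    apply (rule runs_If[where n = "time N x + time N y"])
       apply (rule runs_mono[OF Cond.IH(2)[of loc h _ \<rho>]]; use Cond.prems in auto)
      apply (rule runs_mono[OF Cond.IH(3)[of loc h _ \<rho>]]; use Cond.prems in auto)
     apply auto
    done
next
  case (Bind a b)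
  note lt = conjunct1[OF Bind.prems(1)]
  show ?case unfolding compile.simps time.simps
    apply (rule runs_Seq, rule runs_mono[OF Bind.IH(1)[of loc h s \<rho>]])
    using Bind.prems apply auto
    apply (rule runs_Seq, rule runs_mono[OF Bind.IH(2)[of "push h loc" "Suc h" _ "push (ev w \<rho> a) \<rho>"]])
    subgoal for s' i
      using Bind.prems by (cases i) (auto simp: less_SucI[OF lt] lt)
    using Bind.prems apply (auto intro!: runs_Write)
    done
next
  case (Iter n a b)
  have lt: "loc i < h" and val: "s ''v'' (loc i) = \<rho> i" for i using Iter.prems(1) by auto
  let ?F = "\<lambda>i x. ev w (push x (push i \<rho>)) b"
  let ?n = "ev w \<rho> n" and ?a = "ev w \<rho> a"
  let ?fr = "\<lambda>s'. (\<forall>j<h. s' ''v'' j = s ''v'' j) \<and> (\<forall>a. a \<noteq> ''v'' \<longrightarrow> s' a = s a)"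
  \<comment> \<open>\<open>m\<close> rounds remain, so the counter stands at
    \<open>?n - m\<close>.\<close>
  define I where "I m s' \<longleftrightarrow> m \<le> ?n \<and> s' ''v'' h = ?n \<and> s' ''v'' (h + 2) = ?n - m \<and>
    s' ''v'' (h + 1) = rec_nat ?a ?F (?n - m) \<and> ?fr s'" for m s'
  let ?body = "Seq (compile b (push (h + 1) (push (h + 2) loc)) (h + 3))
            (Seq (Write ''v'' (Const (h + 1)) (V (h + 3)))
              (Write ''v'' (Const (h + 2)) (Add (V (h + 2)) (Const 1))))"
  have body: "runs ?body s1 (time N b + (4 + 6)) (I (m - 1))" if I: "I m s1" and m: "m \<noteq> 0" for m s1
    apply (rule runs_Seq, rule runs_mono[OF Iter.IH(3)[where s = s1 and \<rho> = "push (s1 ''v'' (h + 1)) (push (s1 ''v'' (h + 2)) \<rho>)"]])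
    subgoal for i
      using I by (cases i rule: nat.exhaust[case_names Z S]; cases "i - 1")
        (auto simp: I_def lt val trans_less_add1[OF lt])
    using I Iter.prems m apply (auto simp: I_def)[2]
     apply simp
    apply (rule runs_Seq, rule runs_Write)
     apply (rule runs_Write)
    using I m apply (auto simp: I_def)
    apply (subgoal_tac "?n - (m - Suc 0) = Suc (?n - m)")
    apply auto
    done
  have loop: "runs (While (Sub (V h) (V (h + 2))) ?body) s1 ((N + 1) * (6 + (time N b + (4 + 6))))
     (\<lambda>s'. s' ''v'' (h + 1) = ev w \<rho> (Iter n a b) \<and> ?fr s')" if "I ?n s1" for s1
    apply (rule runs_mono[OF runs_While[where I = I and c = "time N b + (4 + 6)", OF _ that]])
    subgoal premises prems for m s2
      using prems body[OF prems(1)] by (intro exI[of _ "m - 1"]) (auto simp: I_def)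
    subgoal
      by (rule mult_mono) (use Iter.prems in auto)
    subgoal premises prems for s2
    proof -
      from prems obtain m where "I m s2" "s2 ''v'' h - s2 ''v'' (h + 2) = 0" by auto
      moreover from this have "m = 0" by (auto simp: I_def)
      ultimately show ?thesis by (auto simp: I_def)
    qed
    done
  show ?case unfolding compile.simps time.simps
    apply (rule runs_Seq, rule runs_mono[OF Iter.IH(1)[of loc h s \<rho>]])
    using Iter.prems apply auto[4]
    apply (rule runs_Seq, rule runs_mono[OF Iter.IH(2)[of loc "Suc h" _ \<rho>, unfolded Suc_eq_plus1]])
    using Iter.prems apply (auto simp: lt val less_SucI[OF lt])[4]
    apply (rule runs_Seq, rule runs_Write)
     apply (rule runs_Seq, rule runs_mono[OF loop])
       apply (auto simp: I_def)[1]
      apply simp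
     apply (rule runs_Write)
      apply auto
    done
qed

lemma poly_bound_add:
  assumes "\<exists>K q. \<forall>N. f N \<le> K * (N + 1) ^ q" "\<exists>K q. \<forall>N. g N \<le> K * (N + 1) ^ q"
  shows "\<exists>K q. \<forall>N::nat. f N + g N \<le> K * (N + 1 :: nat) ^ q"
proof -
  obtain K1 q1 K2 q2 where *: "\<And>N. f N \<le> K1 * (N + 1) ^ q1" "\<And>N. g N \<le> K2 * (N + 1) ^ q2"
    using assms by blast
  have "f N + g N \<le> (K1 + K2) * (N + 1) ^ (q1 + q2)" for N
  proof -
    have "(N + 1) ^ q1 \<le> (N + 1) ^ (q1 + q2)" "(N + 1) ^ q2 \<le> (N + 1) ^ (q1 + q2)"
      by (intro power_increasing; simp)+
    then have "f N \<le> K1 * (N + 1) ^ (q1 + q2)" "g N \<le> K2 * (N + 1) ^ (q1 + q2)"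
      using *[of N] by (meson mult_le_mono2 order_trans)+
    then show ?thesis by (simp add: distrib_right)
  qed
  then show ?thesis by blast
qed

lemma poly_bound_mult:
  assumes "\<exists>K q. \<forall>N. f N \<le> K * (N + 1) ^ q" "\<exists>K q. \<forall>N. g N \<le> K * (N + 1) ^ q"
  shows "\<exists>K q. \<forall>N::nat. f N * g N \<le> K * (N + 1 :: nat) ^ q"
proof -
  obtain K1 q1 K2 q2 where *: "\<And>N. f N \<le> K1 * (N + 1) ^ q1" "\<And>N. g N \<le> K2 * (N + 1) ^ q2"
    using assms by blast
  have "f N * g N \<le> (K1 * K2) * (N + 1) ^ (q1 + q2)" for N
    using mult_le_mono[OF *(1)[of N] *(2)[of N]] by (simp add: power_add mult_ac)
  then show ?thesis by blast
qed

lemma poly_bound_const: "\<exists>K q. \<forall>N::nat. c \<le> K * (N + 1 :: nat) ^ q"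
  by (rule exI[of _ c], rule exI[of _ 0]) simp

lemma poly_bound_Suc: "\<exists>K q. \<forall>N::nat. N + 1 \<le> K * (N + 1 :: nat) ^ q"
  by (rule exI[of _ 1], rule exI[of _ 1]) simp

lemma time_poly: "\<exists>K q. \<forall>N. time N e \<le> K * (N + 1) ^ q"
  by (induction e; unfold time.simps;
      (assumption | rule poly_bound_add poly_bound_mult poly_bound_Suc poly_bound_const)+)

section \<open>Definable functions\<close>

primrec lift :: "nat \<Rightarrow> ex \<Rightarrow> ex" where
  "lift k (Num c) = Num c"
| "lift k (Var i) = Var (if i < k then i else Suc i)"
| "lift k (Inp e) = Inp (lift k e)"
| "lift k (Plus a b) = Plus (lift k a) (lift k b)"
| "lift k (Minus a b) = Minus (lift k a) (lift k b)"
| "lift k (Halve a) = Halve (lift k a)"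
| "lift k (Cond b x y) = Cond (lift k b) (lift k x) (lift k y)"
| "lift k (Bind a b) = Bind (lift k a) (lift (Suc k) b)"
| "lift k (Iter n a b) = Iter (lift k n) (lift k a) (lift (Suc (Suc k)) b)"

text \<open>The environment in which \<open>lift k\<close> is evaluated; the general
  \<open>k\<close> is needed to pass under binders.\<close>

definition insert_at :: "nat \<Rightarrow> nat \<Rightarrow> (nat \<Rightarrow> nat) \<Rightarrow> nat \<Rightarrow> nat" where
  "insert_at k x \<rho> i = (if i < k then \<rho> i else if i = k then x else \<rho> (i - 1))"

lemma push_insert_at: "push y (insert_at k x \<rho>) = insert_at (Suc k) x (push y \<rho>)"
  by (rule ext) (auto simp: push_def insert_at_def split: nat.split)

lemma push_eq_insert_at: "push x \<rho> = insert_at 0 x \<rho>"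
  by (rule ext) (auto simp: push_def insert_at_def split: nat.split)

lemma ev_lift_insert: "ev w (insert_at k x \<rho>) (lift k e) = ev w \<rho> e"
  by (induction e arbitrary: k \<rho>) (simp_all add: push_insert_at, auto simp: insert_at_def)

lemma iter_le_lift_insert: "iter_le N w (insert_at k x \<rho>) (lift k e) = iter_le N w \<rho> e"
  by (induction e arbitrary: k \<rho>) (simp_all add: push_insert_at ev_lift_insert)

lemma ev_lift [simp]: "ev w (push x \<rho>) (lift 0 e) = ev w \<rho> e"
  and iter_le_lift [simp]: "iter_le N w (push x \<rho>) (lift 0 e) = iter_le N w \<rho> e"
  by (simp_all add: push_eq_insert_at ev_lift_insert iter_le_lift_insert)

text \<open>
  Cell \<open>0\<close> of \<open>w\<close> limits all iterations, so that the running time is polynomial in it.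
\<close>

definition definable :: "((nat \<Rightarrow> nat) \<Rightarrow> (nat \<Rightarrow> nat) \<Rightarrow> nat) \<Rightarrow> bool" where
  "definable F \<longleftrightarrow> (\<exists>e. \<forall>w \<rho>. ev w \<rho> e = F w \<rho> \<and> iter_le (w 0) w \<rho> e)"

definition decidable :: "((nat \<Rightarrow> nat) \<Rightarrow> (nat \<Rightarrow> nat) \<Rightarrow> bool) \<Rightarrow> bool" where
  "decidable P \<longleftrightarrow> definable (\<lambda>w \<rho>. of_bool (P w \<rho>))"

lemma definableI: "(\<And>w \<rho>. ev w \<rho> e = F w \<rho> \<and> iter_le (w 0) w \<rho> e) \<Longrightarrow> definable F"
  unfolding definable_def by blast

lemma definableE:
  assumes "definable F"
  obtains e where "\<And>w \<rho>. ev w \<rho> e = F w \<rho>" "\<And>w \<rho>. iter_le (w 0) w \<rho> e"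
  using assms unfolding definable_def by blast

named_theorems definable_intros

lemma definable_var [definable_intros]: "definable (\<lambda>w \<rho>. \<rho> i)"
  by (rule definableI[of "Var i"]) simp

lemma definable_const [definable_intros]: "definable (\<lambda>w \<rho>. c)"
  by (rule definableI[of "Num c"]) simp

lemma definable_inp [definable_intros]: "definable a \<Longrightarrow> definable (\<lambda>w \<rho>. w (a w \<rho>))"
  unfolding definable_def by (metis ev.simps(3) iter_le.simps(3))

lemma definable_plus [definable_intros]:
  "definable a \<Longrightarrow> definable b \<Longrightarrow> definable (\<lambda>w \<rho>. a w \<rho> + b w \<rho>)"
  unfolding definable_def by (metis ev.simps(4) iter_le.simps(4))

lemma definable_minus [definable_intros]:
  "definable a \<Longrightarrow> definable b \<Longrightarrow> definable (\<lambda>w \<rho>. a w \<rho> - b w \<rho>)"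
  unfolding definable_def by (metis ev.simps(5) iter_le.simps(5))

lemma definable_half [definable_intros]: "definable a \<Longrightarrow> definable (\<lambda>w \<rho>. a w \<rho> div 2)"
  unfolding definable_def by (metis ev.simps(6) iter_le.simps(6))

lemma definable_if [definable_intros]:
  assumes "decidable P" "definable a" "definable b"
  shows "definable (\<lambda>w \<rho>. if P w \<rho> then a w \<rho> else b w \<rho>)"
proof -
  from assms obtain e ea eb where "\<And>w \<rho>. ev w \<rho> e = of_bool (P w \<rho>)" "\<And>w \<rho>. iter_le (w 0) w \<rho> e"
    "\<And>w \<rho>. ev w \<rho> ea = a w \<rho>" "\<And>w \<rho>. iter_le (w 0) w \<rho> ea"
    "\<And>w \<rho>. ev w \<rho> eb = b w \<rho>" "\<And>w \<rho>. iter_le (w 0) w \<rho> eb"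
    unfolding decidable_def by (elim definableE) blast
  then show ?thesis by (intro definableI[of "Cond e ea eb"]) simp
qed

text \<open>Capping the number of rounds at \<open>w 0\<close> inside the expression makes
  \<open>iter_le\<close> hold for every array \<open>w\<close>, so definability needs no side
  conditions. In the body, \<open>\<rho> 1\<close> is the round and \<open>\<rho> 0\<close> the
  accumulator.\<close>

lemma definable_iter [definable_intros]:
  assumes "definable n" "definable a" "definable (\<lambda>w \<rho>. f w (\<rho> 1) (\<rho> 0) (\<lambda>i. \<rho> (i + 2)))"
  shows "definable (\<lambda>w \<rho>. rec_nat (a w \<rho>) (\<lambda>i x. f w i x \<rho>) (min (n w \<rho>) (w 0)))"
proof -
  from assms obtain en ea ef where e: "\<And>w \<rho>. ev w \<rho> en = n w \<rho>" "\<And>w \<rho>. iter_le (w 0) w \<rho> en"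
    "\<And>w \<rho>. ev w \<rho> ea = a w \<rho>" "\<And>w \<rho>. iter_le (w 0) w \<rho> ea"
    "\<And>w \<rho>. ev w \<rho> ef = f w (\<rho> 1) (\<rho> 0) (\<lambda>i. \<rho> (i + 2))" "\<And>w \<rho>. iter_le (w 0) w \<rho> ef"
    by (elim definableE) blast
  have "(\<lambda>i. push x (push j \<rho>) (Suc (Suc i))) = \<rho>" for x j \<rho> by auto
  then show ?thesis
    \<comment> \<open>With truncated subtraction, \<open>n - (n - w 0)\<close> is the minimum of
      \<open>n\<close> and \<open>w 0\<close>.\<close>
    by (intro definableI[of "Iter (Minus en (Minus en (Inp (Num 0)))) ea ef"]) (simp add: e min_def)
qed

text \<open>Substitution by a binder: a function is shown to be definable once, at the local
  variables, and can then be called with any definable arguments.\<close>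

lemma definable_app1:
  assumes "definable (\<lambda>w \<rho>. f w (\<rho> 0))" "definable a"
  shows "definable (\<lambda>w \<rho>. f w (a w \<rho>))"
proof -
  from assms obtain e ea where "\<And>w \<rho>. ev w \<rho> e = f w (\<rho> 0)" "\<And>w \<rho>. iter_le (w 0) w \<rho> e"
    "\<And>w \<rho>. ev w \<rho> ea = a w \<rho>" "\<And>w \<rho>. iter_le (w 0) w \<rho> ea"
    by (elim definableE) blast
  then show ?thesis by (intro definableI[of "Bind ea e"]) simp
qed

lemma definable_app2:
  assumes "definable (\<lambda>w \<rho>. f w (\<rho> 0) (\<rho> 1))" "definable a" "definable b"
  shows "definable (\<lambda>w \<rho>. f w (a w \<rho>) (b w \<rho>))"
proof -
  from assms obtain e ea eb where "\<And>w \<rho>. ev w \<rho> e = f w (\<rho> 0) (\<rho> 1)" "\<And>w \<rho>. iter_le (w 0) w \<rho> e"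
    "\<And>w \<rho>. ev w \<rho> ea = a w \<rho>" "\<And>w \<rho>. iter_le (w 0) w \<rho> ea"
    "\<And>w \<rho>. ev w \<rho> eb = b w \<rho>" "\<And>w \<rho>. iter_le (w 0) w \<rho> eb"
    by (elim definableE) blast
  \<comment> \<open>The innermost binding has index \<open>0\<close>, so the last argument is bound
    first and the other one is lifted over it.\<close>
  then show ?thesis by (intro definableI[of "Bind eb (Bind (lift 0 ea) e)"]) simp
qed

lemma definable_app4:
  assumes "definable (\<lambda>w \<rho>. f w (\<rho> 0) (\<rho> 1) (\<rho> 2) (\<rho> 3))"
    "definable a" "definable b" "definable c" "definable d"
  shows "definable (\<lambda>w \<rho>. f w (a w \<rho>) (b w \<rho>) (c w \<rho>) (d w \<rho>))"
proof -
  from assms obtain e ea eb ec ed where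
    "\<And>w \<rho>. ev w \<rho> e = f w (\<rho> 0) (\<rho> 1) (\<rho> 2) (\<rho> 3)" "\<And>w \<rho>. iter_le (w 0) w \<rho> e"
    "\<And>w \<rho>. ev w \<rho> ea = a w \<rho>" "\<And>w \<rho>. iter_le (w 0) w \<rho> ea"
    "\<And>w \<rho>. ev w \<rho> eb = b w \<rho>" "\<And>w \<rho>. iter_le (w 0) w \<rho> eb"
    "\<And>w \<rho>. ev w \<rho> ec = c w \<rho>" "\<And>w \<rho>. iter_le (w 0) w \<rho> ec"
    "\<And>w \<rho>. ev w \<rho> ed = d w \<rho>" "\<And>w \<rho>. iter_le (w 0) w \<rho> ed"
    by (elim definableE) blast
  then show ?thesis
    by (intro definableI[of "Bind ed (Bind (lift 0 ec) (Bind (lift 0 (lift 0 eb))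
      (Bind (lift 0 (lift 0 (lift 0 ea))) e)))"]) simp
qed

lemma decidable_cong: "definable F \<Longrightarrow> (\<And>w \<rho>. F w \<rho> = of_bool (P w \<rho>)) \<Longrightarrow> decidable P"
  unfolding decidable_def by (drule definable_def[THEN iffD1]) (simp add: definable_def)

lemma decidable_le [definable_intros]:
  assumes "definable a" "definable b"
  shows "decidable (\<lambda>w \<rho>. a w \<rho> \<le> b w \<rho>)"
  by (rule decidable_cong[of "\<lambda>w \<rho>. 1 - (a w \<rho> - b w \<rho>)"]) (intro assms definable_intros, simp)

lemma decidable_less [definable_intros]:
  assumes "definable a" "definable b"
  shows "decidable (\<lambda>w \<rho>. a w \<rho> < b w \<rho>)"
  by (rule decidable_cong[of "\<lambda>w \<rho>. 1 - (a w \<rho> + 1 - b w \<rho>)"]) (intro assms definable_intros, auto)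

lemma decidable_and [definable_intros]:
  assumes "decidable P" "decidable R"
  shows "decidable (\<lambda>w \<rho>. P w \<rho> \<and> R w \<rho>)"
  by (rule decidable_cong[of "\<lambda>w \<rho>. if P w \<rho> then of_bool (R w \<rho>) else 0"])
    (intro assms definable_intros assms(2)[unfolded decidable_def], simp)

lemma decidable_or [definable_intros]:
  assumes "decidable P" "decidable R"
  shows "decidable (\<lambda>w \<rho>. P w \<rho> \<or> R w \<rho>)"
  by (rule decidable_cong[of "\<lambda>w \<rho>. if P w \<rho> then 1 else of_bool (R w \<rho>)"])
    (intro assms definable_intros assms(2)[unfolded decidable_def], simp)

lemma decidable_not [definable_intros]:
  assumes "decidable P"
  shows "decidable (\<lambda>w \<rho>. \<not> P w \<rho>)"
  by (rule decidable_cong[of "\<lambda>w \<rho>. if P w \<rho> then 0 else 1"]) (intro assms definable_intros, simp)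

lemma decidable_imp [definable_intros]:
  assumes "decidable P" "decidable R"
  shows "decidable (\<lambda>w \<rho>. P w \<rho> \<longrightarrow> R w \<rho>)"
  by (rule decidable_cong[of "\<lambda>w \<rho>. if P w \<rho> then of_bool (R w \<rho>) else 1"])
    (intro assms definable_intros assms(2)[unfolded decidable_def], simp)

lemma decidable_eq [definable_intros]:
  assumes "definable a" "definable b"
  shows "decidable (\<lambda>w \<rho>. a w \<rho> = b w \<rho>)"
  unfolding eq_iff by (intro assms definable_intros)

lemma definable_of_bool [definable_intros]: "decidable P \<Longrightarrow> definable (\<lambda>w \<rho>. of_bool (P w \<rho>))"
  by (simp add: decidable_def)

lemma rec_nat_ex: "rec_nat 0 (\<lambda>i x. if P i then 1 else x) n = (of_bool (\<exists>i<n. P i) :: nat)"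
  by (induction n) (auto simp: less_Suc_eq)

lemma decidable_ex [definable_intros]:
  assumes "definable n" "decidable (\<lambda>w \<rho>. P w (\<rho> 1) (\<lambda>i. \<rho> (i + 2)))"
  shows "decidable (\<lambda>w \<rho>. \<exists>i<min (n w \<rho>) (w 0). P w i \<rho>)"
  by (rule decidable_cong[OF _ rec_nat_ex]) (intro assms definable_intros)

lemma decidable_all [definable_intros]:
  assumes "definable n" "decidable (\<lambda>w \<rho>. P w (\<rho> 1) (\<lambda>i. \<rho> (i + 2)))"
  shows "decidable (\<lambda>w \<rho>. \<forall>i<min (n w \<rho>) (w 0). P w i \<rho>)"
proof -
  have "decidable (\<lambda>w \<rho>. \<not> (\<exists>i<min (n w \<rho>) (w 0). \<not> P w i \<rho>))"
    by (intro assms definable_intros)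
  then show ?thesis unfolding not_ex de_Morgan_conj not_not imp_conv_disj[symmetric] .
qed


section \<open>Decoding the input\<close>

text \<open>
  In the array \<open>w\<close>, cell \<open>0\<close> is the iteration limit, cell \<open>1\<close> the length of the input, cell \<open>2\<close> the
  number of right slots, and the input itself starts at cell \<open>3\<close>. The minima with \<open>w 0\<close> in the
  definitions below only take effect on invalid inputs.
\<close>

definition bit_at :: "(nat \<Rightarrow> nat) \<Rightarrow> nat \<Rightarrow> nat" where
  "bit_at w i = (if i < w 1 then w (i + 3) else 0)"

text \<open>The number of consecutive markers from \<open>p\<close> on, at every second place, which
  is the bit length of the number encoded there. Doubling is written as a sum because the
  expressions have no multiplication.\<close>

definition bits_at :: "(nat \<Rightarrow> nat) \<Rightarrow> nat \<Rightarrow> nat" where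
  "bits_at w p = rec_nat 0 (\<lambda>i x. if bit_at w (p + (x + x)) = 1 then x + 1 else x) (min (w 1) (w 0))"

definition next_at :: "(nat \<Rightarrow> nat) \<Rightarrow> nat \<Rightarrow> nat" where
  "next_at w p = p + (bits_at w p + bits_at w p) + 1"

text \<open>Horner's scheme, started at the most significant bit, which is stored last.\<close>

definition value_at :: "(nat \<Rightarrow> nat) \<Rightarrow> nat \<Rightarrow> nat" where
  "value_at w p = rec_nat 0
     (\<lambda>i x. x + x + bit_at w (p + ((bits_at w p - 1 - i) + (bits_at w p - 1 - i)) + 1)) (min (bits_at w p) (w 0))"

definition canonical_at :: "(nat \<Rightarrow> nat) \<Rightarrow> nat \<Rightarrow> bool" where
  "canonical_at w p \<longleftrightarrow>
     bits_at w p = 0 \<or> bit_at w (p + ((bits_at w p - 1) + (bits_at w p - 1)) + 1) = 1"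

definition position :: "(nat \<Rightarrow> nat) \<Rightarrow> nat \<Rightarrow> nat" where
  "position w j = rec_nat 0 (\<lambda>i x. next_at w x) (min j (w 0))"

definition number :: "(nat \<Rightarrow> nat) \<Rightarrow> nat \<Rightarrow> nat" where
  "number w j = value_at w (position w j)"

text \<open>An index into the decoded list of numbers. Entry \<open>0\<close> is the number of
  clauses; each clause takes a header and two numbers per literal.\<close>

definition clause_start :: "(nat \<Rightarrow> nat) \<Rightarrow> nat \<Rightarrow> nat" where
  "clause_start w c = rec_nat 1 (\<lambda>i x. x + 1 + (number w x + number w x)) (min c (w 0))"

definition clause_length :: "(nat \<Rightarrow> nat) \<Rightarrow> nat \<Rightarrow> nat" where
  "clause_length w c = number w (clause_start w c)"

definition literal :: "(nat \<Rightarrow> nat) \<Rightarrow> nat \<Rightarrow> nat \<Rightarrow> nat" where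
  "literal w c a = clause_start w c + (a + a) + 1"

definition sign :: "(nat \<Rightarrow> nat) \<Rightarrow> nat \<Rightarrow> nat \<Rightarrow> nat" where
  "sign w c a = number w (literal w c a + 1)"

text \<open>The first two bounds keep all indices below the iteration limit. The chain of encoded
  numbers must then end exactly where the input does, so that no string other than an encoding is
  accepted. Empty clauses are rejected too.\<close>

definition valid_input :: "nat \<Rightarrow> (nat \<Rightarrow> nat) \<Rightarrow> bool" where
  "valid_input d w \<longleftrightarrow> number w 0 < w 1 \<and> clause_start w (number w 0) \<le> w 1 \<and>
     position w (clause_start w (number w 0)) = w 1 \<and>
     (\<forall>j<min (clause_start w (number w 0)) (w 0). canonical_at w (position w j)) \<and>
     (\<forall>c<min (number w 0) (w 0). 1 \<le> clause_length w c \<and> clause_length w c \<le> d \<and>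
        (\<forall>a<min (clause_length w c) (w 0). sign w c a \<le> 1))"

lemma definable_bit_at: "definable (\<lambda>w \<rho>. bit_at w (\<rho> 0))"
  unfolding bit_at_def by (intro definable_intros)
lemmas [definable_intros] = definable_app1[OF definable_bit_at]

lemma definable_bits_at: "definable (\<lambda>w \<rho>. bits_at w (\<rho> 0))"
  unfolding bits_at_def by (intro definable_intros)
lemmas [definable_intros] = definable_app1[OF definable_bits_at]

lemma definable_next_at: "definable (\<lambda>w \<rho>. next_at w (\<rho> 0))"
  unfolding next_at_def by (intro definable_intros)
lemmas [definable_intros] = definable_app1[OF definable_next_at]

lemma definable_value_at: "definable (\<lambda>w \<rho>. value_at w (\<rho> 0))"
  unfolding value_at_def by (intro definable_intros)
lemmas [definable_intros] = definable_app1[OF definable_value_at]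

lemma decidable_canonical_at: "definable a \<Longrightarrow> decidable (\<lambda>w \<rho>. canonical_at w (a w \<rho>))"
  unfolding canonical_at_def by (intro definable_intros)
lemmas [definable_intros] = decidable_canonical_at

lemma definable_position: "definable (\<lambda>w \<rho>. position w (\<rho> 0))"
  unfolding position_def by (intro definable_intros)
lemmas [definable_intros] = definable_app1[OF definable_position]

lemma definable_number: "definable a \<Longrightarrow> definable (\<lambda>w \<rho>. number w (a w \<rho>))"
  unfolding number_def by (intro definable_intros)
lemmas [definable_intros] = definable_number

lemma definable_clause_start: "definable (\<lambda>w \<rho>. clause_start w (\<rho> 0))"
  unfolding clause_start_def by (intro definable_intros)
lemmas [definable_intros] = definable_app1[OF definable_clause_start]

lemma definable_clause_length [definable_intros]:
  "definable a \<Longrightarrow> definable (\<lambda>w \<rho>. clause_length w (a w \<rho>))"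
  unfolding clause_length_def by (intro definable_intros)

lemma definable_literal [definable_intros]:
  "definable a \<Longrightarrow> definable b \<Longrightarrow> definable (\<lambda>w \<rho>. literal w (a w \<rho>) (b w \<rho>))"
  unfolding literal_def by (intro definable_intros)

lemma definable_sign [definable_intros]:
  "definable a \<Longrightarrow> definable b \<Longrightarrow> definable (\<lambda>w \<rho>. sign w (a w \<rho>) (b w \<rho>))"
  unfolding sign_def by (intro definable_intros)

lemma decidable_valid_input [definable_intros]: "decidable (\<lambda>w \<rho>. valid_input d w)"
  unfolding valid_input_def by (intro definable_intros)

section \<open>Computing the adjacency matrix\<close>

text \<open>Only the first factor is a number of rounds and limited by \<open>w 0\<close>; the
  second factor and the product may be larger.\<close>

definition mul :: "(nat \<Rightarrow> nat) \<Rightarrow> nat \<Rightarrow> nat \<Rightarrow> nat" where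
  "mul w a b = rec_nat 0 (\<lambda>i x. x + b) (min a (w 0))"

definition quot :: "(nat \<Rightarrow> nat) \<Rightarrow> nat \<Rightarrow> nat \<Rightarrow> nat" where
  "quot w a b = rec_nat 0 (\<lambda>i x. if mul w (x + 1) b \<le> a then x + 1 else x) (min a (w 0))"

definition rest :: "(nat \<Rightarrow> nat) \<Rightarrow> nat \<Rightarrow> nat \<Rightarrow> nat" where
  "rest w a b = a - mul w (quot w a b) b"

definition pow :: "(nat \<Rightarrow> nat) \<Rightarrow> nat \<Rightarrow> nat \<Rightarrow> nat" where
  "pow w a b = rec_nat 1 (\<lambda>i x. mul w a x) (min b (w 0))"

definition digit :: "(nat \<Rightarrow> nat) \<Rightarrow> nat \<Rightarrow> nat \<Rightarrow> nat \<Rightarrow> nat" where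
  "digit w x b e = rest w (quot w x (pow w b e)) b"

text \<open>Codes of pick lists can be far too large for \<open>quot\<close>, whose rounds are
  limited by \<open>w 0\<close>. Doubling and halving handle them with as many rounds as they have
  bits.\<close>

definition shift_left :: "(nat \<Rightarrow> nat) \<Rightarrow> nat \<Rightarrow> nat" where
  "shift_left w x = rec_nat x (\<lambda>i y. y + y) (min (w 1) (w 0))"

definition shift_right :: "(nat \<Rightarrow> nat) \<Rightarrow> nat \<Rightarrow> nat \<Rightarrow> nat" where
  "shift_right w x t = rec_nat x (\<lambda>i y. y div 2) (min (mul w t (w 1)) (w 0))"

text \<open>Lists of numbers below \<open>2 ^ w 1\<close> are represented by the digits of a number in base \<open>2 ^ w 1\<close>.\<close>

definition entry :: "(nat \<Rightarrow> nat) \<Rightarrow> nat \<Rightarrow> nat \<Rightarrow> nat" where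
  "entry w Z t = shift_right w Z t - shift_left w (shift_right w Z (t + 1))"

text \<open>One left slot for each tuple of \<open>d + 1\<close> right slots.\<close>

definition left_slots :: "nat \<Rightarrow> (nat \<Rightarrow> nat) \<Rightarrow> nat" where
  "left_slots d w = pow w (w 2) (d + 1)"

text \<open>The first factor counts the copies of \<open>d + 1\<close> slot contents, each at most
  \<open>w 1\<close>. The second gives every pick two digits, a literal number below
  \<open>d\<close> and a right slot below \<open>w 2\<close>, in a base that exceeds neither range's
  demands: \<open>w 2 + d\<close>.\<close>

definition item_count :: "nat \<Rightarrow> (nat \<Rightarrow> nat) \<Rightarrow> nat" where
  "item_count d w = mul w (pow w (w 1 + 1) (d + 1)) (pow w (w 2 + d) (w 2 + w 2))"

definition var_name :: "(nat \<Rightarrow> nat) \<Rightarrow> nat \<Rightarrow> nat" where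
  "var_name w q = (if q = 0 then 0 else number w q + 1)"

definition choice :: "nat \<Rightarrow> (nat \<Rightarrow> nat) \<Rightarrow> nat \<Rightarrow> nat \<Rightarrow> nat" where
  "choice d w p t = digit w (quot w p (pow w (w 1 + 1) (d + 1))) (w 2 + d) t"

definition active_at :: "nat \<Rightarrow> (nat \<Rightarrow> nat) \<Rightarrow> nat \<Rightarrow> nat \<Rightarrow> bool" where
  "active_at d w p c \<longleftrightarrow> (\<forall>a<min (clause_length w c) (w 0). sign w c a = 0 \<longrightarrow>
     (\<exists>e<min (d + 1) (w 0). var_name w (digit w p (w 1 + 1) e) = var_name w (literal w c a)))"

definition hit_at :: "(nat \<Rightarrow> nat) \<Rightarrow> nat \<Rightarrow> nat \<Rightarrow> bool" where
  "hit_at w Z c \<longleftrightarrow> (\<exists>a<min (clause_length w c) (w 0). sign w c a = 1 \<and>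
     (\<exists>t<min (w 2) (w 0). var_name w (entry w Z t) = var_name w (literal w c a)))"

definition unhit_at :: "nat \<Rightarrow> (nat \<Rightarrow> nat) \<Rightarrow> nat \<Rightarrow> nat \<Rightarrow> nat" where
  "unhit_at d w p Z = rec_nat (number w 0)
     (\<lambda>i x. if active_at d w p i \<and> \<not> hit_at w Z i then i else x) (min (number w 0) (w 0))"

definition pick_at :: "nat \<Rightarrow> (nat \<Rightarrow> nat) \<Rightarrow> nat \<Rightarrow> nat \<Rightarrow> nat \<Rightarrow> nat" where
  "pick_at d w p a Z =
     (if unhit_at d w p Z < number w 0 \<and> a < clause_length w (unhit_at d w p Z) \<and>
        sign w (unhit_at d w p Z) a = 1
      then literal w (unhit_at d w p Z) a else 0)"

text \<open>A new digit enters at the low end, just as \<open>picks\<close> adds at the head, so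
  digit \<open>t\<close> of the code is list index \<open>t\<close>.\<close>

definition picks_at :: "nat \<Rightarrow> (nat \<Rightarrow> nat) \<Rightarrow> nat \<Rightarrow> nat" where
  "picks_at d w p = rec_nat 0
     (\<lambda>t Z. shift_left w Z + pick_at d w p (choice d w p (t + t)) Z) (min (w 2) (w 0))"

definition compatible_at :: "nat \<Rightarrow> (nat \<Rightarrow> nat) \<Rightarrow> nat \<Rightarrow> nat \<Rightarrow> nat \<Rightarrow> nat \<Rightarrow> bool" where
  "compatible_at d w \<sigma> p \<tau> q \<longleftrightarrow>
     (q = 0 \<or> (\<exists>c<min (number w 0) (w 0). \<exists>a<min (clause_length w c) (w 0). q = literal w c a)) \<and>
     (\<tau> = 0 \<longrightarrow> q = 0) \<and>
     (\<forall>e<min (d + 1) (w 0). \<forall>e'<min (d + 1) (w 0). digit w \<sigma> (w 2) e \<noteq> digit w \<sigma> (w 2) e' \<longrightarrow>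
       var_name w (digit w p (w 1 + 1) e) \<noteq> var_name w (digit w p (w 1 + 1) e')) \<and>
     (\<forall>e<min (d + 1) (w 0). digit w \<sigma> (w 2) e = \<tau> \<longrightarrow>
       var_name w q = var_name w (digit w p (w 1 + 1) e)) \<and>
     (\<forall>t<min (w 2) (w 0). choice d w p (t + t + 1) < w 2 \<and>
       (choice d w p (t + t + 1) = \<tau> \<longrightarrow> var_name w q = var_name w (entry w (picks_at d w p) t))) \<and>
     (\<forall>c<min (number w 0) (w 0). active_at d w p c \<longrightarrow> hit_at w (picks_at d w p) c)"

text \<open>Validity of the input is part of the constraint arcs. A malformed input thus yields a
  graph of the usual shape without such arcs, which is a no-instance.\<close>

definition adjacent_at :: "nat \<Rightarrow> (nat \<Rightarrow> nat) \<Rightarrow> nat \<Rightarrow> nat \<Rightarrow> nat \<Rightarrow> nat \<Rightarrow> bool" where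
  "adjacent_at d w m k u v \<longleftrightarrow>
     (u < m \<and> v < m \<and> quot w u (item_count d w) < left_slots d w \<and>
       left_slots d w \<le> quot w v (item_count d w) \<and> valid_input d w \<and>
       compatible_at d w (quot w u (item_count d w)) (rest w u (item_count d w))
         (quot w v (item_count d w) - left_slots d w) (rest w v (item_count d w))) \<or>
     (m \<le> u \<and> u < m + k \<and> v < m \<and> quot w v (item_count d w) = quot w (u - m) (w 2)) \<or>
     (u < m \<and> m + k \<le> v \<and> v < m + 2 * k \<and>
       quot w u (item_count d w) = left_slots d w + rest w (v - (m + k)) (w 2)) \<or>
     (u < m \<and> v = m + 2 * k + quot w u (item_count d w)) \<or>
     (v < m \<and> u = m + 2 * k + quot w v (item_count d w))"

definition items_at :: "nat \<Rightarrow> (nat \<Rightarrow> nat) \<Rightarrow> nat" where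
  "items_at d w = mul w (left_slots d w + w 2) (item_count d w)"

definition pairs_at :: "nat \<Rightarrow> (nat \<Rightarrow> nat) \<Rightarrow> nat" where
  "pairs_at d w = mul w (left_slots d w) (w 2)"

definition size_at :: "nat \<Rightarrow> (nat \<Rightarrow> nat) \<Rightarrow> nat" where
  "size_at d w = items_at d w + (pairs_at d w + pairs_at d w) + (left_slots d w + w 2)"

lemma definable_mul: "definable (\<lambda>w \<rho>. mul w (\<rho> 0) (\<rho> 1))"
  unfolding mul_def by (intro definable_intros)
lemmas [definable_intros] = definable_app2[OF definable_mul]

lemma definable_double [definable_intros]: "definable a \<Longrightarrow> definable (\<lambda>w \<rho>. 2 * a w \<rho>)"
  unfolding mult_2 by (intro definable_intros)

lemma definable_quot: "definable (\<lambda>w \<rho>. quot w (\<rho> 0) (\<rho> 1))"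
  unfolding quot_def by (intro definable_intros)
lemmas [definable_intros] = definable_app2[OF definable_quot]

lemma definable_rest [definable_intros]:
  "definable a \<Longrightarrow> definable b \<Longrightarrow> definable (\<lambda>w \<rho>. rest w (a w \<rho>) (b w \<rho>))"
  unfolding rest_def by (intro definable_intros)

lemma definable_pow: "definable (\<lambda>w \<rho>. pow w (\<rho> 0) (\<rho> 1))"
  unfolding pow_def by (intro definable_intros)
lemmas [definable_intros] = definable_app2[OF definable_pow]

lemma definable_digit [definable_intros]:
  "definable a \<Longrightarrow> definable b \<Longrightarrow> definable c \<Longrightarrow> definable (\<lambda>w \<rho>. digit w (a w \<rho>) (b w \<rho>) (c w \<rho>))"
  unfolding digit_def by (intro definable_intros)

lemma definable_shift_left: "definable (\<lambda>w \<rho>. shift_left w (\<rho> 0))"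
  unfolding shift_left_def by (intro definable_intros)
lemmas [definable_intros] = definable_app1[OF definable_shift_left]

lemma definable_shift_right: "definable (\<lambda>w \<rho>. shift_right w (\<rho> 0) (\<rho> 1))"
  unfolding shift_right_def by (intro definable_intros)
lemmas [definable_intros] = definable_app2[OF definable_shift_right]

lemma definable_entry [definable_intros]:
  "definable a \<Longrightarrow> definable b \<Longrightarrow> definable (\<lambda>w \<rho>. entry w (a w \<rho>) (b w \<rho>))"
  unfolding entry_def by (intro definable_intros)

lemma definable_sizes [definable_intros]:
  "definable (\<lambda>w \<rho>. left_slots d w)" "definable (\<lambda>w \<rho>. item_count d w)"
  unfolding left_slots_def item_count_def by (intro definable_intros)+

lemma definable_var_name [definable_intros]:
  "definable a \<Longrightarrow> definable (\<lambda>w \<rho>. var_name w (a w \<rho>))"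
  unfolding var_name_def by (intro definable_intros)

lemma definable_choice [definable_intros]:
  "definable a \<Longrightarrow> definable b \<Longrightarrow> definable (\<lambda>w \<rho>. choice d w (a w \<rho>) (b w \<rho>))"
  unfolding choice_def by (intro definable_intros)

lemma decidable_app2:
  "decidable (\<lambda>w \<rho>. P w (\<rho> 0) (\<rho> 1)) \<Longrightarrow> definable a \<Longrightarrow> definable b \<Longrightarrow>
   decidable (\<lambda>w \<rho>. P w (a w \<rho>) (b w \<rho>))"
  unfolding decidable_def by (rule definable_app2)

lemma decidable_active_at: "decidable (\<lambda>w \<rho>. active_at d w (\<rho> 0) (\<rho> 1))"
  unfolding active_at_def by (intro definable_intros)
lemmas [definable_intros] = decidable_app2[OF decidable_active_at]

lemma decidable_hit_at: "decidable (\<lambda>w \<rho>. hit_at w (\<rho> 0) (\<rho> 1))"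
  unfolding hit_at_def by (intro definable_intros)
lemmas [definable_intros] = decidable_app2[OF decidable_hit_at]

lemma definable_unhit_at: "definable (\<lambda>w \<rho>. unhit_at d w (\<rho> 0) (\<rho> 1))"
  unfolding unhit_at_def by (intro definable_intros)
lemmas [definable_intros] = definable_app2[OF definable_unhit_at]

lemma definable_pick_at [definable_intros]:
  "definable a \<Longrightarrow> definable b \<Longrightarrow> definable c \<Longrightarrow> definable (\<lambda>w \<rho>. pick_at d w (a w \<rho>) (b w \<rho>) (c w \<rho>))"
  unfolding pick_at_def by (intro definable_intros)

lemma definable_picks_at: "definable (\<lambda>w \<rho>. picks_at d w (\<rho> 0))"
  unfolding picks_at_def by (intro definable_intros)
lemmas [definable_intros] = definable_app1[OF definable_picks_at]

lemma decidable_compatible_at: "decidable (\<lambda>w \<rho>. compatible_at d w (\<rho> 0) (\<rho> 1) (\<rho> 2) (\<rho> 3))"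
  unfolding compatible_at_def by (intro definable_intros)

lemma decidable_compatible_at_app [definable_intros]:
  "definable a \<Longrightarrow> definable b \<Longrightarrow> definable c \<Longrightarrow> definable e \<Longrightarrow>
   decidable (\<lambda>w \<rho>. compatible_at d w (a w \<rho>) (b w \<rho>) (c w \<rho>) (e w \<rho>))"
  using decidable_compatible_at unfolding decidable_def by (rule definable_app4)

lemma decidable_adjacent_at [definable_intros]:
  "definable a \<Longrightarrow> definable b \<Longrightarrow> definable c \<Longrightarrow> definable e \<Longrightarrow>
   decidable (\<lambda>w \<rho>. adjacent_at d w (a w \<rho>) (b w \<rho>) (c w \<rho>) (e w \<rho>))"
  unfolding adjacent_at_def by (intro definable_intros)

lemma definable_totals [definable_intros]:
  "definable (\<lambda>w \<rho>. items_at d w)" "definable (\<lambda>w \<rho>. pairs_at d w)"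
  unfolding items_at_def pairs_at_def by (intro definable_intros)+

lemma definable_size_at [definable_intros]: "definable (\<lambda>w \<rho>. size_at d w)"
  unfolding size_at_def by (intro definable_intros)

section \<open>Correctness of the decoding\<close>

definition number_of_bits :: "bool list \<Rightarrow> nat" where
  "number_of_bits bs = foldr (\<lambda>b n. of_bool b + 2 * n) bs 0"

lemma number_of_bits_simps [simp]:
  "number_of_bits [] = 0" "number_of_bits (b # bs) = of_bool b + 2 * number_of_bits bs"
  by (simp_all add: number_of_bits_def)

lemma number_of_bits_of_nat [simp]: "number_of_bits (bits_of_nat n) = n"
proof (induction n rule: less_induct)
  case (less n)
  show ?case
  proof (cases "n = 0")
    case False
    then have "number_of_bits (bits_of_nat (n div 2)) = n div 2" by (intro less.IH) auto
    with False show ?thesis by (subst bits_of_nat.simps) (simp add: mod_2_eq_odd[symmetric])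
  qed (simp add: bits_of_nat.simps)
qed

lemma number_of_bits_pos: "bs \<noteq> [] \<Longrightarrow> last bs \<Longrightarrow> 0 < number_of_bits bs"
  by (induction bs) (auto split: if_splits)

lemma bits_of_number: "bs = [] \<or> last bs \<Longrightarrow> bits_of_nat (number_of_bits bs) = bs"
proof (induction bs)
  case (Cons b bs)
  then have "bits_of_nat (number_of_bits bs) = bs" by (auto split: if_splits)
  moreover have "number_of_bits (b # bs) \<noteq> 0" using number_of_bits_pos[of "b # bs"] Cons.prems by simp
  ultimately show ?case by (subst bits_of_nat.simps) (auto simp: of_bool_def)
qed (simp add: bits_of_nat.simps)

lemma last_bits_of_nat: "n \<noteq> 0 \<Longrightarrow> last (bits_of_nat n)"
proof (induction n rule: less_induct)
  case (less n)
  show ?case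
  proof (cases "n div 2 = 0")
    case True
    with less.prems have "n = 1" by auto
    then show ?thesis by (simp add: bits_of_nat.simps)
  next
    case False
    then have "last (bits_of_nat (n div 2))" "bits_of_nat (n div 2) \<noteq> []"
      using less.IH[of "n div 2"] by (auto simp: bits_of_nat.simps[of "n div 2"])
    with less.prems show ?thesis by (subst bits_of_nat.simps) simp
  qed
qed

section \<open>Self-delimiting numbers inside the input\<close>

abbreviation mark_bits :: "bool list \<Rightarrow> bool list" where
  "mark_bits bs \<equiv> concat (map (\<lambda>b. [True, b]) bs)"

lemma length_mark_bits [simp]: "length (mark_bits bs) = 2 * length bs"
  by (induction bs) auto

lemma nth_mark_bits:
  "q < length bs \<Longrightarrow> mark_bits bs ! (2 * q)" "q < length bs \<Longrightarrow> mark_bits bs ! Suc (2 * q) = bs ! q"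
  by (induction bs arbitrary: q) (auto simp: less_Suc_eq_0_disj)

lemma length_encode_nat: "length (encode_nat n) = 2 * length (bits_of_nat n) + 1"
  by (simp add: encode_nat_def)

text \<open>Once \<open>P\<close> fails at the accumulator, the accumulator stays put, so the loop
  finds the first failure.\<close>

lemma rec_nat_search:
  "(\<forall>q<rec_nat 0 (\<lambda>i x. if P x then x + 1 else x) n. P q) \<and>
   rec_nat 0 (\<lambda>i x. if P x then x + 1 else x) n \<le> n \<and>
   (rec_nat 0 (\<lambda>i x. if P x then x + 1 else x) n = n \<or> \<not> P (rec_nat 0 (\<lambda>i x. if P x then x + 1 else x) n))"
  by (induction n) (auto simp: less_Suc_eq)

lemma encode_nats_simps [simp]:
  "encode_nats [] = []" "encode_nats (n # ns) = encode_nat n @ encode_nats ns"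
  "encode_nats (ms @ ns) = encode_nats ms @ encode_nats ns"
  by (simp_all add: encode_nats_def)

lemma encode_nats_split:
  "j < length ns \<Longrightarrow>
   encode_nats ns = encode_nats (take j ns) @ encode_nat (ns ! j) @ encode_nats (drop (Suc j) ns)"
  by (metis encode_nats_simps(2,3) id_take_nth_drop)

lemma length_encode_nats: "length ns \<le> length (encode_nats ns)"
  by (induction ns) (auto simp: encode_nat_def)

locale input =
  fixes w :: "nat \<Rightarrow> nat" and x :: "bool list"
  assumes len_1: "w 1 = length x" and bit: "\<And>i. i < length x \<Longrightarrow> w (i + 3) = of_bool (x ! i)"
    and limit: "length x \<le> w 0"
begin

lemma len: "w 1 = length x" "w (Suc 0) = length x"
  using len_1 by simp_all

lemma bit_at: "bit_at w i = of_bool (i < length x \<and> x ! i)"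
  using bit[of i] by (simp add: bit_at_def len)

lemma bit_at_iff: "bit_at w i = Suc 0 \<longleftrightarrow> i < length x \<and> x ! i"
  by (simp add: bit_at)

lemma bits_at_props:
  "q < bits_at w p \<Longrightarrow> bit_at w (p + 2 * q) = 1" "bit_at w (p + 2 * bits_at w p) = 0"
  "bits_at w p \<le> length x"
proof -
  have *: "bits_at w p = rec_nat 0 (\<lambda>i y. if bit_at w (p + 2 * y) = 1 then y + 1 else y) (length x)"
    using limit by (simp add: bits_at_def len mult_2 min_absorb1)
  note search = rec_nat_search[of "\<lambda>y. bit_at w (p + 2 * y) = 1" "length x", folded *]
  show "q < bits_at w p \<Longrightarrow> bit_at w (p + 2 * q) = 1" "bits_at w p \<le> length x" using search by auto
  \<comment> \<open>In the first case the inspected place lies beyond the input, where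
    \<open>bit_at\<close> returns \<open>0\<close>.\<close>
  from search have "bits_at w p = length x \<or> bit_at w (p + 2 * bits_at w p) \<noteq> 1" by blast
  then show "bit_at w (p + 2 * bits_at w p) = 0" by (auto simp: bit_at)
qed

definition "bits_list p = map (\<lambda>q. bit_at w (p + 2 * q + 1) = 1) [0..<bits_at w p]"

lemma value_at: "value_at w p = number_of_bits (bits_list p)"
proof -
  let ?b = "bits_at w p"
  let ?f = "\<lambda>i x. x + x + bit_at w (p + ((?b - 1 - i) + (?b - 1 - i)) + 1)"
  have "rec_nat 0 ?f i = number_of_bits (drop (?b - i) (bits_list p))" if "i \<le> ?b" for i
    using that
  proof (induction i)
    case (Suc i)
    then have "drop (?b - Suc i) (bits_list p) = bits_list p ! (?b - Suc i) # drop (?b - i) (bits_list p)"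
      by (subst Cons_nth_drop_Suc[symmetric]) (simp_all add: bits_list_def Suc_diff_Suc)
    moreover have "bits_list p ! (?b - Suc i) = (bit_at w (p + 2 * (?b - Suc i) + 1) = 1)"
      using Suc.prems by (simp add: bits_list_def)
    ultimately show ?case using Suc by (simp add: bit_at mult_2)
  qed (simp add: bits_list_def)
  from this[of ?b] show ?thesis using bits_at_props(3)[of p] limit by (simp add: value_at_def min_absorb1)
qed

lemma decode_number:
  assumes "drop p x = encode_nat n @ ys"
  shows "value_at w p = n" "next_at w p = p + length (encode_nat n)" "canonical_at w p"
proof -
  let ?bs = "bits_of_nat n"
  have p: "p \<le> length x" using assms by (cases "p \<le> length x") (auto simp: encode_nat_def)
  have x: "p + i < length x \<and> x ! (p + i) = encode_nat n ! i" if "i < length (encode_nat n)" for i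
  proof -
    have "x ! (p + i) = drop p x ! i" using p by simp
    moreover have "length x - p = length (encode_nat n) + length ys"
      using arg_cong[OF assms, of length] by simp
    then have "p + i < length x" using that by simp
    ultimately show ?thesis using assms that by (simp add: nth_append)
  qed
  have even: "bit_at w (p + 2 * q) = 1" and odd: "bit_at w (p + 2 * q + 1) = of_bool (?bs ! q)"
    if "q < length ?bs" for q
    using x[of "2 * q"] x[of "2 * q + 1"] that
    by (auto simp: bit_at length_encode_nat encode_nat_def nth_append nth_mark_bits)
  have stop: "bit_at w (p + 2 * length ?bs) = 0"
    using x[of "2 * length ?bs"] by (auto simp: bit_at length_encode_nat encode_nat_def nth_append)
  have b: "bits_at w p = length ?bs"
    using bits_at_props(1)[of "length ?bs" p] bits_at_props(2)[of p] even[of "bits_at w p"] stop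
    by (cases "bits_at w p" "length ?bs" rule: linorder_cases) auto
  then have "bits_list p = ?bs" using odd by (auto simp: bits_list_def of_bool_def intro!: nth_equalityI split: if_splits)
  then show "value_at w p = n" by (simp add: value_at)
  show "next_at w p = p + length (encode_nat n)" by (simp add: next_at_def b length_encode_nat)
  show "canonical_at w p"
  proof (cases "?bs = []")
    case False
    then have "last ?bs" by (metis bits_of_nat.simps last_bits_of_nat)
    with False odd[of "length ?bs - 1"] show ?thesis
      by (simp add: canonical_at_def b last_conv_nth mult_2)
  qed (simp add: canonical_at_def b)
qed

lemma drop_marked:
  assumes "\<And>q. q < b \<Longrightarrow> bit_at w (p + 2 * q) = 1" "p + 2 * b \<le> length x"
  shows "drop p x = mark_bits (map (\<lambda>q. bit_at w (p + 2 * q + 1) = 1) [0..<b]) @ drop (p + 2 * b) x"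
  using assms
proof (induction b arbitrary: p)
  case (Suc b)
  have "drop p x = x ! p # x ! (p + 1) # drop (p + 2) x"
    using Suc.prems(2) by (simp add: Cons_nth_drop_Suc)
  moreover have "x ! p" using Suc.prems(1)[of 0] by (simp add: bit_at_iff)
  moreover have "x ! (p + 1) = (bit_at w (p + 1) = 1)" using Suc.prems(2) by (simp add: bit_at_iff)
  moreover have "drop (p + 2) x =
      mark_bits (map (\<lambda>q. bit_at w (p + 2 + 2 * q + 1) = 1) [0..<b]) @ drop (p + 2 + 2 * b) x"
    using Suc.prems Suc.prems(1)[of "Suc q" for q] by (intro Suc.IH) (auto simp: add_ac)
  moreover have "map (\<lambda>q. bit_at w (p + 2 * q + 1) = 1) [0..<Suc b] =
      (bit_at w (p + 1) = 1) # map (\<lambda>q. bit_at w (p + 2 + 2 * q + 1) = 1) [0..<b]"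
    by (simp add: upt_conv_Cons map_Suc_upt[symmetric] del: upt_Suc)
  ultimately show ?case by (simp del: upt_Suc)
qed simp

text \<open>The converse of \<open>decode_number\<close>. Arbitrary strings have to be recognized as
  encodings or not, because only exact encodings belong to the satisfiability problem.\<close>

lemma encode_number:
  assumes "next_at w p \<le> length x" "canonical_at w p"
  shows "drop p x = encode_nat (value_at w p) @ drop (next_at w p) x"
proof -
  let ?b = "bits_at w p"
  have le: "p + 2 * ?b < length x" using assms(1) by (simp add: next_at_def)
  have "drop p x = mark_bits (bits_list p) @ drop (p + 2 * ?b) x"
    unfolding bits_list_def using drop_marked[of ?b p] bits_at_props(1)[of _ p] le by simp
  also have "drop (p + 2 * ?b) x = False # drop (p + 2 * ?b + 1) x"
    using le bits_at_props(2)[of p] by (simp add: Cons_nth_drop_Suc[symmetric] bit_at)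
  finally have *: "drop p x = mark_bits (bits_list p) @ False # drop (next_at w p) x"
    by (simp add: next_at_def mult_2)
  have "bits_list p = [] \<or> last (bits_list p)"
  proof (cases "?b = 0")
    case False
    then have "last (bits_list p) = bits_list p ! (?b - 1)" by (simp add: bits_list_def last_conv_nth)
    also have "\<dots>" using False assms(2) by (simp add: canonical_at_def bits_list_def mult_2)
    finally show ?thesis ..
  qed (simp add: bits_list_def)
  from bits_of_number[OF this] show ?thesis by (simp add: * encode_nat_def value_at)
qed

lemma position_simps: "position w 0 = 0" "j < w 0 \<Longrightarrow> position w (Suc j) = next_at w (position w j)"
  by (simp_all add: position_def)

lemma position_encode_nats:
  assumes "x = encode_nats ns" "j \<le> length ns"
  shows "position w j = length (encode_nats (take j ns))"
  using assms(2)
proof (induction j)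
  case (Suc j)
  then have j: "position w j = length (encode_nats (take j ns))" "j < length ns" by auto
  have "x = encode_nats (take j ns) @ encode_nat (ns ! j) @ encode_nats (drop (Suc j) ns)"
    unfolding assms(1) by (rule encode_nats_split) fact
  then have "drop (position w j) x = encode_nat (ns ! j) @ encode_nats (drop (Suc j) ns)"
    by (simp add: j(1))
  from decode_number(2)[OF this] show ?case
    using j limit length_encode_nats[of ns] assms(1)
    by (simp add: position_simps take_Suc_conv_app_nth)
qed (simp add: position_simps)

lemma number_encode_nats:
  assumes "x = encode_nats ns" "j < length ns"
  shows "number w j = ns ! j" "canonical_at w (position w j)"
proof -
  have "x = encode_nats (take j ns) @ encode_nat (ns ! j) @ encode_nats (drop (Suc j) ns)"
    unfolding assms(1) by (rule encode_nats_split) fact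
  then have "drop (position w j) x = encode_nat (ns ! j) @ encode_nats (drop (Suc j) ns)"
    using position_encode_nats[of ns j] assms by simp
  from decode_number[OF this] show "number w j = ns ! j" "canonical_at w (position w j)"
    by (simp_all add: number_def)
qed

text \<open>Positions are monotone, so if the chain ends at the end of the input, every number on it
  lies inside and can be peeled off.\<close>

lemma encode_numbers:
  assumes J: "J \<le> w 0" "position w J = length x" and can: "\<And>j. j < J \<Longrightarrow> canonical_at w (position w j)"
  shows "x = encode_nats (map (number w) [0..<J])"
proof -
  have mono: "position w i \<le> position w j" if "i \<le> j" "j \<le> J" for i j
    using that
  proof (induction rule: dec_induct)
    case (step j)
    then show ?case using J(1) by (simp add: position_simps next_at_def)
  qed simp
  have "take (position w j) x = encode_nats (map (number w) [0..<j])" if "j \<le> J" for j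
    using that
  proof (induction j)
    case (Suc j)
    let ?p = "position w j"
    have next_eq: "position w (Suc j) = next_at w ?p" using Suc.prems J(1) by (simp add: position_simps)
    have le: "next_at w ?p \<le> length x" using mono[of "Suc j" J] Suc.prems J next_eq by simp
    from encode_number[OF le] can[of j] Suc.prems
    have d: "drop ?p x = encode_nat (number w j) @ drop (next_at w ?p) x" by (simp add: number_def)
    have "length (drop ?p x) = length (encode_nat (number w j)) + length (drop (next_at w ?p) x)"
      by (subst d) simp
    then have l: "next_at w ?p - ?p = length (encode_nat (number w j))" "?p \<le> next_at w ?p"
      using le by (auto simp: next_at_def)
    then have "take (next_at w ?p) x = take ?p x @ take (next_at w ?p - ?p) (drop ?p x)"
      by (metis le_add_diff_inverse take_add)
    also have "take (next_at w ?p - ?p) (drop ?p x) = encode_nat (number w j)"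
      unfolding l d by simp
    finally show ?case using Suc by (simp add: next_eq)
  qed (simp add: position_simps)
  from this[of J] show ?thesis using J(2) by simp
qed

lemma clause_start_simps:
  "clause_start w 0 = 1"
  "c < w 0 \<Longrightarrow> clause_start w (Suc c) = clause_start w c + 1 + 2 * clause_length w c"
  by (simp_all add: clause_start_def clause_length_def mult_2)

lemma clause_start_mono: "c \<le> c' \<Longrightarrow> clause_start w c \<le> clause_start w c'"
proof (induction rule: dec_induct)
  case (step c')
  have "clause_start w c' \<le> clause_start w (Suc c')"
  proof (cases "c' < w 0")
    case False
    then have "min (Suc c') (w 0) = min c' (w 0)" by simp
    then show ?thesis by (simp only: clause_start_def)
  qed (simp add: clause_start_simps)
  with step.IH show ?case by simp
qed simp

end

section \<open>From lists of numbers to formulas\<close>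

abbreviation encode_literal :: "literal \<Rightarrow> nat list" where
  "encode_literal \<equiv> \<lambda>(v, b). [v, of_bool b]"

abbreviation encode_clause :: "clause \<Rightarrow> nat list" where
  "encode_clause C \<equiv> length C # concat (map encode_literal C)"

lemma nth_encode_literals:
  "a < length C \<Longrightarrow> concat (map encode_literal C) ! (2 * a) = fst (C ! a)"
  "a < length C \<Longrightarrow> concat (map encode_literal C) ! Suc (2 * a) = of_bool (snd (C ! a))"
  by (induction C arbitrary: a) (auto simp: less_Suc_eq_0_disj)

lemma length_encode_literals [simp]: "length (concat (map encode_literal C)) = 2 * length C"
  by (induction C) auto

lemma concat_map_split:
  "c < length xs \<Longrightarrow>
   concat (map f xs) = concat (map f (take c xs)) @ f (xs ! c) @ concat (map f (drop (Suc c) xs))"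
  by (induction xs arbitrary: c) (auto simp: less_Suc_eq_0_disj)

lemma length_le_concat_map: "(\<And>y. f y \<noteq> []) \<Longrightarrow> length xs \<le> length (concat (map f xs))"
  by (induction xs) (auto simp: Suc_le_eq trans_le_add2 add_strict_increasing)

locale cnf_input = input +
  fixes F :: cnf
  assumes x_eq: "x = encode_cnf F"
begin

definition "numbers = length F # concat (map encode_clause F)"
definition "start c = 1 + length (concat (map encode_clause (take c F)))"

lemma x_numbers: "x = encode_nats numbers"
  unfolding x_eq encode_cnf_def numbers_def ..

lemma nth_numbers:
  assumes "c < length F" "i < 1 + 2 * length (F ! c)"
  shows "start c + i < length numbers" "numbers ! (start c + i) = encode_clause (F ! c) ! i"
proof -
  define e where "e = encode_clause (F ! c)"
  have e: "i < length e" using assms(2) by (simp add: e_def)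
  have "numbers = length F # concat (map encode_clause (take c F)) @ e @
      concat (map encode_clause (drop (Suc c) F))"
    unfolding numbers_def e_def using concat_map_split[OF assms(1), of encode_clause] by simp
  then show "start c + i < length numbers" "numbers ! (start c + i) = encode_clause (F ! c) ! i"
    using e unfolding e_def[symmetric] by (auto simp: start_def nth_append)
qed

lemma length_numbers: "length numbers \<le> w 1" "length numbers \<le> w 0"
  using length_encode_nats[of numbers] x_numbers len limit by auto

lemma length_F: "length F < length numbers"
  unfolding numbers_def using length_le_concat_map[of encode_clause F] by (simp add: less_Suc_eq_le)

lemma number_0: "number w 0 = length F"
  using number_encode_nats(1)[OF x_numbers, of 0] by (simp add: numbers_def)

lemma clause_start: "c \<le> length F \<Longrightarrow> clause_start w c = start c"
proof (induction c)
  case (Suc c)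
  then have c: "clause_start w c = start c" "c < length F" by auto
  have "clause_length w c = length (F ! c)"
    using nth_numbers[OF c(2), of 0] number_encode_nats(1)[OF x_numbers] c
    by (simp add: clause_length_def)
  then show ?case using c length_F length_numbers
    by (simp add: clause_start_simps start_def take_Suc_conv_app_nth)
qed (simp add: clause_start_simps start_def)

lemma clause_length: "c < length F \<Longrightarrow> clause_length w c = length (F ! c)"
  using nth_numbers[of c 0] number_encode_nats(1)[OF x_numbers]
  by (simp add: clause_length_def clause_start)

lemma literal:
  assumes "c < length F" "a < length (F ! c)"
  shows "literal w c a < length numbers" "number w (literal w c a) = fst (F ! c ! a)"
    "sign w c a = of_bool (snd (F ! c ! a))"
proof -
  show "literal w c a < length numbers"
    using nth_numbers(1)[OF assms(1), of "2 * a + 1"] assms by (simp add: literal_def clause_start)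
  then show "number w (literal w c a) = fst (F ! c ! a)"
    using nth_numbers[OF assms(1), of "2 * a + 1"] number_encode_nats(1)[OF x_numbers] assms
    by (simp add: literal_def clause_start nth_encode_literals mult_2[symmetric])
  show "sign w c a = of_bool (snd (F ! c ! a))"
    using nth_numbers[OF assms(1), of "2 * a + 2"] number_encode_nats(1)[OF x_numbers] assms
    by (simp add: sign_def literal_def clause_start nth_encode_literals mult_2[symmetric])
qed

lemma valid_input:
  assumes "\<And>C. C \<in> set F \<Longrightarrow> C \<noteq> [] \<and> length C \<le> d"
  shows "valid_input d w"
proof -
  have J: "clause_start w (number w 0) = length numbers"
    by (simp add: number_0 clause_start) (simp add: start_def numbers_def)
  show ?thesis unfolding valid_input_def J
  proof (intro conjI allI impI)
    show "number w 0 < w 1" using length_F length_numbers by (simp add: number_0)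
    show "position w (length numbers) = w 1"
      using position_encode_nats[OF x_numbers, of "length numbers"] x_numbers len by simp
    show "canonical_at w (position w j)" if "j < min (length numbers) (w 0)" for j
      using number_encode_nats(2)[OF x_numbers] that by simp
    fix c assume "c < min (number w 0) (w 0)"
    then have c: "c < length F" by (simp add: number_0)
    then show "1 \<le> clause_length w c" "clause_length w c \<le> d"
      using assms[of "F ! c"] by (auto simp: clause_length Suc_le_eq)
    show "sign w c a \<le> 1" if "a < min (clause_length w c) (w 0)" for a
      using c that by (simp add: literal clause_length)
  qed (use length_numbers in auto)
qed

end

text \<open>For the converse, a formula is read off the decoded numbers; encoding it returns the
  same list, whose string is the whole input.\<close>

lemma (in input) valid_input_iff:
  "valid_input d w \<longleftrightarrow> (\<exists>F. x = encode_cnf F \<and> (\<forall>C\<in>set F. C \<noteq> [] \<and> length C \<le> d))"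
proof
  assume "\<exists>F. x = encode_cnf F \<and> (\<forall>C\<in>set F. C \<noteq> [] \<and> length C \<le> d)"
  then obtain F where F: "x = encode_cnf F" "\<And>C. C \<in> set F \<Longrightarrow> C \<noteq> [] \<and> length C \<le> d" by blast
  interpret cnf_input w x F by unfold_locales fact
  from F(2) show "valid_input d w" by (rule valid_input)
next
  assume valid: "valid_input d w"
  let ?n = "number w 0"
  let ?J = "clause_start w ?n"
  from valid len limit have J: "?n < w 0" "?J \<le> w 0" "position w ?J = length x"
    and can: "\<And>j. j < ?J \<Longrightarrow> canonical_at w (position w j)"
    and cl: "\<And>c. c < ?n \<Longrightarrow> 1 \<le> clause_length w c \<and> clause_length w c \<le> d \<and>
        (\<forall>a<min (clause_length w c) (w 0). sign w c a \<le> 1)"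
    unfolding valid_input_def by auto
  define G where "G c = map (\<lambda>a. (number w (literal w c a), sign w c a = 1)) [0..<clause_length w c]" for c
  define F where "F = map G [0..<?n]"
  \<comment> \<open>This makes the truncation in the test of the signs harmless.\<close>
  have small: "clause_length w c \<le> w 0" if "c < ?n" for c
  proof -
    have "clause_start w (Suc c) \<le> ?J" using that by (intro clause_start_mono) simp
    then show ?thesis using that J by (simp add: clause_start_simps)
  qed
  have lits: "concat (map encode_literal (map (\<lambda>a. (number w (literal w c a), sign w c a = 1)) [0..<m])) =
      map (number w) [clause_start w c + 1..<clause_start w c + 1 + 2 * m]"
    if "c < ?n" "m \<le> clause_length w c" for c m
    using that(2)
  proof (induction m)
    case (Suc m)
    have "sign w c m \<le> 1" using cl[OF that(1)] small[OF that(1)] Suc.prems by simp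
    then have "of_bool (sign w c m = 1) = sign w c m" by auto
    then show ?case using Suc by (simp add: literal_def sign_def mult_2)
  qed simp
  have "concat (map encode_clause (map G [0..<c])) = map (number w) [1..<clause_start w c]" if "c \<le> ?n" for c
    using that
  proof (induction c)
    case (Suc c)
    then have c: "c < ?n" "clause_start w (Suc c) = clause_start w c + 1 + 2 * clause_length w c"
      using J by (simp_all add: clause_start_simps)
    have "1 \<le> clause_start w c" using clause_start_mono[of 0 c] by (simp add: clause_start_simps)
    then have "[1..<clause_start w (Suc c)] = [1..<clause_start w c] @
        clause_start w c # [clause_start w c + 1..<clause_start w c + 1 + 2 * clause_length w c]"
      unfolding c(2) using upt_add_eq_append[of 1 "clause_start w c" "1 + 2 * clause_length w c"]
        upt_conv_Cons[of "clause_start w c" "clause_start w c + 1 + 2 * clause_length w c"]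
      by (simp only: add.assoc) simp
    moreover have "encode_clause (G c) = clause_length w c #
        map (number w) [clause_start w c + 1..<clause_start w c + 1 + 2 * clause_length w c]"
      unfolding G_def lits[OF c(1) order_refl] by simp
    ultimately show ?case using Suc c(1) by (simp add: clause_length_def)
  qed (simp add: clause_start_simps)
  from this[OF order_refl] have "length F # concat (map encode_clause F) = ?n # map (number w) [1..<?J]"
    by (simp add: F_def)
  also have "\<dots> = map (number w) [0..<?J]"
    using clause_start_mono[of 0 ?n] by (simp add: clause_start_simps upt_conv_Cons)
  finally have "x = encode_cnf F"
    using encode_numbers[OF J(2,3) can] by (simp add: encode_cnf_def)
  moreover have "C \<noteq> [] \<and> length C \<le> d" if C: "C \<in> set F" for C
  proof -
    from C obtain c where "c < ?n" "C = G c" by (auto simp: F_def)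
    then show ?thesis using cl[of c] by (auto simp: G_def)
  qed
  ultimately show "\<exists>F. x = encode_cnf F \<and> (\<forall>C\<in>set F. C \<noteq> [] \<and> length C \<le> d)" by blast
qed

section \<open>Correctness of the arithmetic\<close>

lemma mul_eq: "a \<le> w 0 \<Longrightarrow> mul w a b = a * b"
proof -
  have "rec_nat 0 (\<lambda>i x. x + b) n = n * b" for n by (induction n) auto
  then show "a \<le> w 0 \<Longrightarrow> mul w a b = a * b" by (simp add: mul_def)
qed

text \<open>The loop advances while the next multiple of \<open>b\<close> still fits, so after
  \<open>n\<close> rounds it holds \<open>min n (a div b)\<close>.\<close>

lemma quot_eq:
  assumes "a \<le> w 0" "0 < b"
  shows "quot w a b = a div b"
proof -
  have "rec_nat 0 (\<lambda>i x. if mul w (x + 1) b \<le> a then x + 1 else x) n = min n (a div b)" if "n \<le> a" for n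
    using that
  proof (induction n)
    case (Suc n)
    have "mul w (min n (a div b) + 1) b = (min n (a div b) + 1) * b"
      using Suc.prems assms by (intro mul_eq) auto
    moreover have "(n + 1) * b \<le> a \<longleftrightarrow> n < a div b"
      using assms(2) by (metis Suc_eq_plus1 Suc_le_eq less_eq_div_iff_mult_less_eq)
    moreover have "\<not> (a div b + 1) * b \<le> a"
      using assms(2) by (metis Suc_eq_plus1 Suc_n_not_le_n less_eq_div_iff_mult_less_eq)
    ultimately show ?case using Suc by (auto simp: min_def)
  qed simp
  from this[of a] show ?thesis using assms by (simp add: quot_def)
qed

lemma rest_eq: "a \<le> w 0 \<Longrightarrow> 0 < b \<Longrightarrow> rest w a b = a mod b"
  using order_trans[OF div_le_dividend[of a b]]
  by (simp add: rest_def quot_eq mul_eq minus_div_mult_eq_mod)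

lemma pow_eq:
  assumes "a \<le> w 0" "b \<le> w 0"
  shows "pow w a b = a ^ b"
proof -
  have "rec_nat 1 (\<lambda>i x. mul w a x) n = a ^ n" for n
    using assms(1) by (induction n) (auto simp: mul_eq)
  then show ?thesis using assms(2) by (simp add: pow_def)
qed

lemma digit_eq:
  assumes "x \<le> w 0" "b \<le> w 0" "e \<le> w 0" "0 < b"
  shows "digit w x b e = x div b ^ e mod b"
  using assms order_trans[OF div_le_dividend[of x "b ^ e"]] by (simp add: digit_def pow_eq quot_eq rest_eq)

lemma shift_left_eq:
  assumes "w 1 \<le> w 0"
  shows "shift_left w x = x * 2 ^ w 1"
proof -
  have "rec_nat x (\<lambda>i y. y + y) n = x * 2 ^ n" for n by (induction n) auto
  then show ?thesis using assms by (simp add: shift_left_def)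
qed

lemma shift_right_eq:
  assumes "t \<le> w 0" "t * w 1 \<le> w 0"
  shows "shift_right w x t = x div 2 ^ (t * w 1)"
proof -
  have "rec_nat x (\<lambda>i y. y div 2) n = x div 2 ^ n" for n
    by (induction n) (auto simp: div_mult2_eq[symmetric] mult.commute)
  then show ?thesis using assms by (simp add: shift_right_def mul_eq)
qed

lemma entry_eq:
  assumes "w 1 \<le> w 0" "t + 1 \<le> w 0" "(t + 1) * w 1 \<le> w 0"
  shows "entry w Z t = Z div 2 ^ (t * w 1) mod 2 ^ w 1"
proof -
  have "Z div 2 ^ ((t + 1) * w 1) = Z div 2 ^ (t * w 1) div 2 ^ w 1"
    by (simp add: power_add div_mult2_eq[symmetric] mult.commute)
  moreover have "t * w 1 \<le> w 0" using assms(3) by simp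
  ultimately show ?thesis using assms
    by (simp add: entry_def shift_left_eq shift_right_eq minus_div_mult_eq_mod)
qed

section \<open>Codes of lists and digits in a fixed base\<close>

primrec list_code :: "nat \<Rightarrow> nat list \<Rightarrow> nat" where
  "list_code b [] = 0"
| "list_code b (z # l) = list_code b l * 2 ^ b + z"

lemma list_code_entry:
  assumes "\<And>z. z \<in> set l \<Longrightarrow> z < 2 ^ b"
  shows "list_code b l div 2 ^ (t * b) mod 2 ^ b = (if t < length l then l ! t else 0)"
  using assms
proof (induction l arbitrary: t)
  case (Cons z l)
  show ?case
  proof (cases t)
    case (Suc s)
    have "list_code b (z # l) div 2 ^ (t * b) = list_code b (z # l) div 2 ^ b div 2 ^ (s * b)"
      by (simp add: Suc power_add div_mult2_eq)
    also have "list_code b (z # l) div 2 ^ b = list_code b l" using Cons.prems[of z] by simp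
    finally show ?thesis using Cons.IH[of s] Cons.prems Suc by simp
  qed (use Cons.prems[of z] in simp)
qed simp

lemma digits_surj:
  assumes "0 < b" "\<And>e. e < n \<Longrightarrow> f e < b"
  shows "\<exists>p<b ^ n. \<forall>e<n. p div b ^ e mod b = (f e :: nat)"
  using assms(2)
proof (induction n arbitrary: f)
  case (Suc n)
  from Suc.IH[of "\<lambda>e. f (Suc e)"] Suc.prems
  obtain p where p: "p < b ^ n" "\<And>e. e < n \<Longrightarrow> p div b ^ e mod b = f (Suc e)" by auto
  let ?p = "f 0 + b * p"
  have "?p < b ^ Suc n"
  proof -
    have "?p < b * (p + 1)" using Suc.prems[of 0] by simp
    also have "\<dots> \<le> b * b ^ n" using p(1) by (intro mult_le_mono2) simp
    finally show ?thesis by simp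
  qed
  moreover have "?p div b ^ e mod b = f e" if "e < Suc n" for e
  proof (cases e)
    case 0
    then show ?thesis using Suc.prems[of 0] by simp
  next
    case (Suc e')
    have "?p div b ^ e = ?p div b div b ^ e'" by (simp add: Suc div_mult2_eq)
    also have "?p div b = p" using Suc.prems[of 0] assms(1) by simp
    finally show ?thesis using p(2) that Suc by simp
  qed
  ultimately show ?case by blast
qed simp

lemma low_digit:
  assumes "e < n" "0 < b"
  shows "(p + b ^ n * q) div b ^ e mod b = p div b ^ e mod (b :: nat)"
proof -
  have "b ^ n = b ^ e * (b * b ^ (n - e - 1))"
    using assms by (simp add: power_add[symmetric] power_Suc[symmetric] del: power_Suc)
  then have "(p + b ^ n * q) div b ^ e = p div b ^ e + b * (b ^ (n - e - 1) * q)"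
    using assms(2) by (simp add: mult.assoc)
  then show ?thesis by simp
qed

lemma rec_nat_cong:
  "(\<And>i x. i < n \<Longrightarrow> f i x = g i x) \<Longrightarrow> rec_nat a f n = rec_nat a g n"
  by (induction n) auto

lemma fillable_cong:
  assumes "\<And>\<sigma> p \<tau> q. \<sigma> < A \<Longrightarrow> p < Q \<Longrightarrow> \<tau> < B \<Longrightarrow> q < Q \<Longrightarrow> C \<sigma> p \<tau> q = C' \<sigma> p \<tau> q"
  shows "fillable A B Q C = fillable A B Q C'"
  unfolding fillable_def using assms by (intro ex_cong1) auto

section \<open>Correctness of the adjacency matrix\<close>

definition tuples :: "nat \<Rightarrow> nat \<Rightarrow> nat" where
  "tuples d k = Suc k ^ (d + 1)"

definition items :: "nat \<Rightarrow> nat \<Rightarrow> nat \<Rightarrow> nat" where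
  "items d k L = (L + 1) ^ (d + 1) * (Suc k + d) ^ (2 * Suc k)"

definition graph_size :: "nat \<Rightarrow> nat \<Rightarrow> nat \<Rightarrow> nat" where
  "graph_size d k L = slot_size (tuples d k) (Suc k) (items d k L)"

lemma tuples_pos [simp]: "0 < tuples d k"
  by (simp add: tuples_def)

lemma items_pos [simp]: "0 < items d k L"
  by (simp add: items_def)

text \<open>The limit has to admit all vertex numbers, and shifts by up to \<open>Suc k\<close>
  digits of \<open>length x\<close> bits each.\<close>

locale sized_input = input +
  fixes d k :: nat
  assumes w2: "w 2 = Suc k" and d: "1 \<le> d"
    and size_le: "graph_size d k (length x) \<le> w 0" and length_le: "Suc k * length x \<le> w 0"
begin

abbreviation "L \<equiv> length x"
abbreviation "A \<equiv> tuples d k"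
abbreviation "Q \<equiv> items d k L"
abbreviation "W \<equiv> Suc k + d"
abbreviation "X \<equiv> (L + 1) ^ (d + 1)"

lemma limits: "A \<le> w 0" "Q \<le> w 0" "(A + Suc k) * Q \<le> w 0" "A * Suc k \<le> w 0" "A + Suc k \<le> w 0"
  "L + 1 \<le> w 0" "d + 1 \<le> w 0" "W \<le> w 0" "2 * Suc k \<le> w 0" "X \<le> w 0" "L < Q"
proof -
  have all: "(A + Suc k) * Q \<le> w 0" "A * Suc k \<le> w 0" "A + Suc k \<le> w 0"
    using size_le by (simp_all add: graph_size_def slot_size_def)
  then show "(A + Suc k) * Q \<le> w 0" "A * Suc k \<le> w 0" "A + Suc k \<le> w 0" "A \<le> w 0" by simp_all
  have "Q \<le> (A + Suc k) * Q" by simp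
  with all(1) show Q: "Q \<le> w 0" by (rule order_trans[rotated])
  have "(L + 1) ^ 1 \<le> X" by (intro power_increasing) auto
  moreover have "X * 1 \<le> Q" unfolding items_def by (intro mult_le_mono2 one_le_power) simp
  ultimately have X: "L + 1 \<le> X" "X \<le> Q" by (simp_all only: power_one_right mult_1_right)
  have W: "W ^ 1 \<le> W ^ (2 * Suc k)" using d by (intro power_increasing) auto
  have "1 * W ^ (2 * Suc k) \<le> Q" unfolding items_def by (intro mult_right_mono one_le_power) simp_all
  then have WQ: "W ^ (2 * Suc k) \<le> Q" by (simp only: mult_1)
  \<comment> \<open>As \<open>W \<ge> 2\<close>, there are fewer digits than items, so digit indices
    respect the limit.\<close>
  have "2 * Suc k < 2 ^ (2 * Suc k)" by (rule less_exp)
  also have "(2 :: nat) ^ (2 * Suc k) \<le> W ^ (2 * Suc k)" using d by (intro power_mono) auto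
  finally show "2 * Suc k \<le> w 0" using WQ Q by linarith
  show "X \<le> w 0" "L + 1 \<le> w 0" "L < Q" using X Q by linarith+
  show "W \<le> w 0" "d + 1 \<le> w 0" using W WQ Q by simp_all
qed

lemma left_slots: "left_slots d w = A"
  unfolding left_slots_def using limits by (simp add: pow_eq w2 tuples_def del: power_Suc)

lemma pow_X: "pow w (w 1 + 1) (d + 1) = X"
  using limits by (simp add: pow_eq len del: power_Suc)

lemma item_count: "item_count d w = Q"
proof -
  have "w 2 + w 2 = 2 * Suc k" "w 2 + d = W" by (simp_all add: w2)
  then show ?thesis unfolding item_count_def pow_X items_def using limits by (simp only: pow_eq mul_eq)
qed

lemma totals: "items_at d w = (A + Suc k) * Q" "pairs_at d w = A * Suc k"
  "size_at d w = graph_size d k L"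
  using limits
  by (simp_all add: items_at_def pairs_at_def size_at_def left_slots item_count w2 mul_eq
      graph_size_def slot_size_def)

lemma adjacent_at:
  assumes "u < graph_size d k L" "v < graph_size d k L"
  shows "adjacent_at d w ((A + Suc k) * Q) (A * Suc k) u v \<longleftrightarrow>
    slot_adj A (Suc k) Q (\<lambda>\<sigma> p \<tau> q. valid_input d w \<and> compatible_at d w \<sigma> p \<tau> q) u v"
proof -
  have le: "u \<le> w 0" "v \<le> w 0" "u - i \<le> w 0" "v - i \<le> w 0" for i using assms size_le by simp_all
  show ?thesis
    unfolding adjacent_at_def slot_adj_def Let_def left_slots item_count w2
      quot_eq[of _ w Q, OF le(1) items_pos] quot_eq[of _ w Q, OF le(2) items_pos]
      rest_eq[of _ w Q, OF le(1) items_pos] rest_eq[of _ w Q, OF le(2) items_pos]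
      quot_eq[of _ w "Suc k", OF le(3) zero_less_Suc] rest_eq[of _ w "Suc k", OF le(4) zero_less_Suc]
    by blast
qed

definition "sd \<sigma> e = \<sigma> div Suc k ^ e mod Suc k"
definition "yd p e = p div (L + 1) ^ e mod (L + 1)"
definition "ch p t = p div X div W ^ t mod W"
definition "ad p t = ch p (2 * t)"
definition "pd p t = ch p (2 * t + 1)"

lemma sd: "\<sigma> < A \<Longrightarrow> e < d + 1 \<Longrightarrow> digit w \<sigma> (w 2) e = sd \<sigma> e"
  using limits by (simp add: digit_eq w2 sd_def)

lemma yd: "p < Q \<Longrightarrow> e < d + 1 \<Longrightarrow> digit w p (w 1 + 1) e = yd p e"
  using limits by (simp add: digit_eq len yd_def)

lemma ch: "p < Q \<Longrightarrow> t < 2 * Suc k \<Longrightarrow> choice d w p t = ch p t"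
proof -
  assume *: "p < Q" "t < 2 * Suc k"
  have "p \<le> w 0" using *(1) limits by simp
  moreover from this have "p div X \<le> w 0" using div_le_dividend[of p X] by (rule order_trans[rotated])
  moreover have "t \<le> w 0" using *(2) limits by simp
  ultimately show ?thesis unfolding choice_def pow_X w2 ch_def
    using limits(8) quot_eq[of p w X] digit_eq[of "p div X" w W t] by (simp del: power_Suc)
qed

text \<open>Digits at even places carry literal choices and those at odd places right slots; both
  are below the base \<open>W\<close>.\<close>

lemma item_surj:
  assumes fy: "\<And>e. e < d + 1 \<Longrightarrow> fy e \<le> L" and fa: "\<And>t. t < Suc k \<Longrightarrow> fa t < d"
    and fp: "\<And>t. t < Suc k \<Longrightarrow> fp t < Suc k"
  shows "\<exists>p<Q. (\<forall>e<d + 1. yd p e = fy e) \<and> (\<forall>t<Suc k. ad p t = fa t \<and> pd p t = fp t)"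
proof -
  obtain py where py: "py < X" "\<And>e. e < d + 1 \<Longrightarrow> py div (L + 1) ^ e mod (L + 1) = fy e"
    using digits_surj[of "L + 1" "d + 1" fy] fy by (auto simp: less_Suc_eq_le)
  define f where "f t = (if even t then fa (t div 2) else fp (t div 2))" for t
  have "f t < W" if "t < 2 * Suc k" for t
  proof -
    have "t div 2 < Suc k" using that by simp
    from fa[OF this] fp[OF this] show ?thesis by (simp add: f_def)
  qed
  then obtain pr where pr: "pr < W ^ (2 * Suc k)" "\<And>t. t < 2 * Suc k \<Longrightarrow> pr div W ^ t mod W = f t"
    using digits_surj[of W "2 * Suc k" f] by auto
  let ?p = "py + X * pr"
  have "?p < Q"
  proof -
    have "?p < X * (pr + 1)" using py(1) by simp
    also have "\<dots> \<le> X * W ^ (2 * Suc k)" using pr(1) by (intro mult_le_mono2) simp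
    finally show ?thesis by (simp add: items_def)
  qed
  moreover have "yd ?p e = fy e" if "e < d + 1" for e

    using low_digit[OF that, of "L + 1" py pr] py(2)[OF that] unfolding yd_def by (simp only: add_gr_0 zero_less_one simp_thms)
  moreover have "?p div X = pr" using py(1) by simp
  then have "ad ?p t = fa t" "pd ?p t = fp t" if "t < Suc k" for t
    using pr(2)[of "2 * t"] pr(2)[of "2 * t + 1"] that by (simp_all add: ad_def pd_def ch_def f_def)
  ultimately show ?thesis by blast
qed

lemma sd_surj:
  assumes "\<And>e. e < d + 1 \<Longrightarrow> f e < Suc k"
  shows "\<exists>\<sigma><A. \<forall>e<d + 1. sd \<sigma> e = f e"
  using digits_surj[of "Suc k" "d + 1" f] assms unfolding sd_def tuples_def by auto

end

locale sized_cnf_input = sized_input + cnf_input +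
  assumes clauses: "\<And>C. C \<in> set F \<Longrightarrow> length C \<le> d"
begin

text \<open>Index \<open>0\<close> holds the number of clauses and is never a literal, so it can
  serve as the dummy. Names of variables are shifted by one to keep the name \<open>0\<close> for
  it.\<close>

lemma var_name_literal:
  "c < length F \<Longrightarrow> a < length (F ! c) \<Longrightarrow> var_name w (literal w c a) = Suc (fst (F ! c ! a))"
  using literal(2) by (simp add: var_name_def) (simp add: literal_def)

sublocale csp F d k L A "Suc d" Q "literal w" "var_name w" sd yd ad pd
proof
  show "literal w c a \<le> L" if "c < length F" "a < length (F ! c)" for c a
    using literal(1)[OF that] length_numbers len by simp
qed (use clauses d limits(11) sd_surj item_surj var_name_literal in \<open>simp_all add: var_name_def sd_def\<close>)

lemma counts: "number w 0 = nc" "nc \<le> w 0" "c < nc \<Longrightarrow> clause_length w c = cl c" "c < nc \<Longrightarrow> cl c \<le> w 0"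
proof -
  show "number w 0 = nc" by (rule number_0)
  show "nc \<le> w 0" using length_F length_numbers by simp
  show "c < nc \<Longrightarrow> clause_length w c = cl c" by (rule clause_length)
  show "cl c \<le> w 0" if "c < nc" using clauses[of "F ! c"] that limits(7) by simp
qed

lemma active_at:
  assumes "p < Q" "c < nc"
  shows "active_at d w p c \<longleftrightarrow> active (yd p) c"
proof -
  have "(\<exists>e<min (d + 1) (w 0). var_name w (digit w p (w 1 + 1) e) = v) \<longleftrightarrow>
      (\<exists>e<Suc d. var_name w (yd p e) = v)" for v
    using yd[OF assms(1)] limits(7) by (intro ex_cong1) (auto simp del: One_nat_def)
  then show ?thesis
    unfolding active_at_def active_def using counts(3,4)[OF assms(2)] assms(2)
    by (simp add: literal(3) min_absorb1)
qed

lemma hit_at: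
  assumes "c < nc" "length l \<le> Suc k" "\<And>z. z \<in> set l \<Longrightarrow> z \<le> L"
  shows "hit_at w (list_code L l) c \<longleftrightarrow> hit l c"
proof -
  have "z < 2 ^ L" if "z \<in> set l" for z using assms(3)[OF that] less_exp[of L] by (rule le_less_trans)
  note code = list_code_entry[OF this]
  have e: "entry w (list_code L l) t = (if t < length l then l ! t else 0)" if "t < Suc k" for t
  proof -
    have "(t + 1) * L \<le> Suc k * L" using that by (intro mult_right_mono) auto
    then have "(t + 1) * w 1 \<le> w 0" using length_le unfolding len by (rule order_trans)
    moreover have "t + 1 \<le> w 0" using limits(9) that by simp
    moreover have "w 1 \<le> w 0" using limits(6) unfolding len by simp
    ultimately have "entry w (list_code L l) t = list_code L l div 2 ^ (t * L) mod 2 ^ L"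
      using entry_eq[of w t "list_code L l"] unfolding len by blast
    also have "\<dots> = (if t < length l then l ! t else 0)" by (rule code)
    finally show ?thesis .
  qed
  have "(\<exists>t<Suc k. var_name w (entry w (list_code L l) t) = var_name w (literal w c a)) \<longleftrightarrow>
      (\<exists>z\<in>set l. var_name w z = var_name w (literal w c a))" if "a < cl c" for a
  proof
    assume "\<exists>t<Suc k. var_name w (entry w (list_code L l) t) = var_name w (literal w c a)"
    then obtain t where t: "t < Suc k" "var_name w (entry w (list_code L l) t) = var_name w (literal w c a)"
      by blast
    \<comment> \<open>A missing digit reads as the dummy, whose name \<open>0\<close> differs from
      that of every literal.\<close>
    then have "t < length l" using e[OF t(1)] vn_pos[OF assms(1) that] vn_0 by (cases "t < length l") auto
    then show "\<exists>z\<in>set l. var_name w z = var_name w (literal w c a)" using t e[OF t(1)] by auto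
  next
    assume "\<exists>z\<in>set l. var_name w z = var_name w (literal w c a)"
    then obtain t where "t < length l" "var_name w (l ! t) = var_name w (literal w c a)"
      by (auto simp: in_set_conv_nth)
    then show "\<exists>t<Suc k. var_name w (entry w (list_code L l) t) = var_name w (literal w c a)"
      using e[of t] assms(2) by (intro exI[of _ t]) auto
  qed
  moreover have "sign w c a = 1 \<longleftrightarrow> snd (F ! c ! a)" if "a < cl c" for a
    using literal(3)[OF assms(1) that] by simp
  moreover have "min (clause_length w c) (w 0) = cl c" "min (w 2) (w 0) = Suc k"
    using limits(9) counts(3,4)[OF assms(1)] by (simp_all add: w2)
  ultimately show ?thesis unfolding hit_at_def hit_def by (intro ex_cong1) auto
qed

lemma unhit_at:
  assumes "p < Q" "length l \<le> Suc k" "\<And>z. z \<in> set l \<Longrightarrow> z \<le> L"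
  shows "unhit_at d w p (list_code L l) = unhit (yd p) l"
  unfolding unhit_at_def unhit_def using counts(1,2)
  by (simp add: min_absorb1) (intro rec_nat_cong, simp add: active_at hit_at assms)

lemma pick_at:
  assumes "p < Q" "length l \<le> Suc k" "\<And>z. z \<in> set l \<Longrightarrow> z \<le> L"
  shows "pick_at d w p a (list_code L l) = pick (yd p) a l"
proof -
  have "sign w c a = 1 \<longleftrightarrow> snd (F ! c ! a)" if "c < nc" "a < cl c" for c
    using literal(3)[OF that] by simp
  moreover have "unhit_at d w p (list_code L l) = unhit (yd p) l" by (rule unhit_at) (use assms in auto)
  ultimately show ?thesis
    unfolding pick_at_def pick_def Let_def by (auto simp: counts)
qed

text \<open>A pick is an index into the input and thus at most \<open>L < 2 ^ L\<close>, so it fits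
  into one digit of the code.\<close>

lemma picks_le:
  assumes "z \<in> set (picks y \<alpha> t)"
  shows "z \<le> L"
proof -
  have "pick y a l \<le> L" for a l using pos_le by (auto simp: pick_def Let_def)
  then show ?thesis using assms by (induction t) (auto simp: picks_simps)
qed

lemma picks_at:
  assumes "p < Q"
  shows "picks_at d w p = list_code L (picks (yd p) (ad p) (Suc k))"
proof -
  let ?f = "\<lambda>t Z. shift_left w Z + pick_at d w p (choice d w p (t + t)) Z"
  have "rec_nat 0 ?f n = list_code L (picks (yd p) (ad p) n)" if "n \<le> Suc k" for n
    using that
  proof (induction n)
    case (Suc n)
    have "choice d w p (n + n) = ad p n"
      unfolding ad_def mult_2[symmetric] by (rule ch) (use assms Suc.prems in simp_all)
    moreover have "pick_at d w p a (list_code L (picks (yd p) (ad p) n)) = pick (yd p) a (picks (yd p) (ad p) n)"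
      for a by (rule pick_at) (use assms Suc.prems picks_le in auto)
    moreover have "shift_left w Z = Z * 2 ^ L" for Z
      using shift_left_eq[of w Z] limits by (simp add: len)
    ultimately show ?case using Suc by (simp add: picks_simps)
  qed (simp add: picks_simps)
  from this[of "Suc k"] show ?thesis using limits by (simp only: picks_at_def w2) (simp add: min_absorb1)
qed

lemma compatible_at:
  assumes "\<sigma> < A" "p < Q"
  shows "compatible_at d w \<sigma> p \<tau> q \<longleftrightarrow> compatible \<sigma> p \<tau> q"
proof -
  let ?l = "picks (yd p) (ad p) (Suc k)"
  have min: "min (number w 0) (w 0) = nc" "min (Suc d) (w 0) = Suc d" "min (Suc k) (w 0) = Suc k"
    using counts(1,2) limits by (simp_all add: w2 min_absorb1)
  have cl: "min (clause_length w c) (w 0) = cl c" if "c < nc" for c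
    using counts(3,4)[OF that] by simp
  have entry: "entry w (list_code L ?l) t = ?l ! t" if "t < Suc k" for t
  proof -
    have "z < 2 ^ L" if "z \<in> set ?l" for z using picks_le[OF that] less_exp[of L] by (rule le_less_trans)
    note code = list_code_entry[OF this]
    have "(t + 1) * L \<le> Suc k * L" using that by (intro mult_right_mono) auto
    then have "(t + 1) * w 1 \<le> w 0" using length_le unfolding len by (rule order_trans)
    moreover have "t + 1 \<le> w 0" using limits(9) that by simp
    moreover have "w 1 \<le> w 0" using limits(6) unfolding len by simp
    ultimately have "entry w (list_code L ?l) t = list_code L ?l div 2 ^ (t * L) mod 2 ^ L"
      using entry_eq[of w t "list_code L ?l"] unfolding len by blast
    also have "\<dots> = ?l ! t" using code[where t = t] that by simp
    finally show ?thesis .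
  qed
  have pd: "choice d w p (t + t + 1) = pd p t" if "t < Suc k" for t
    unfolding pd_def mult_2[symmetric] by (rule ch) (use assms that in simp_all)
  have hit: "hit_at w (list_code L ?l) c = hit ?l c" if "c < nc" for c
    by (rule hit_at) (use that picks_le in auto)
  have sd': "digit w \<sigma> (w 2) e = sd \<sigma> e" and yd': "digit w p (w 1 + 1) e = yd p e" if "e < Suc d" for e
    using sd[OF assms(1)] yd[OF assms(2)] that by simp_all
  note active = active_at[OF assms(2)]
  show ?thesis
    unfolding compatible_at_def compatible_def occurrence_def Suc_eq_plus1[of d, symmetric]
    unfolding min picks_at[OF assms(2)] w2
    by (simp only: cl entry pd hit active sd'[unfolded w2] yd' cong: conj_cong imp_cong)
qed

end

context sized_input
begin

text \<open>There is at least one pair of slots, so a filling forces the input to be valid; then the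
  constraints are those of the decoded formula.\<close>

lemma fillable_iff:
  "fillable A (Suc k) Q (\<lambda>\<sigma> p \<tau> q. valid_input d w \<and> compatible_at d w \<sigma> p \<tau> q) \<longleftrightarrow>
   (x, k) \<in> WSAT_Gamma1 d"
proof
  assume fill: "fillable A (Suc k) Q (\<lambda>\<sigma> p \<tau> q. valid_input d w \<and> compatible_at d w \<sigma> p \<tau> q)"
  then have "valid_input d w" unfolding fillable_def using tuples_pos by blast
  then obtain F where F: "x = encode_cnf F" "\<forall>C\<in>set F. C \<noteq> [] \<and> length C \<le> d"
    using valid_input_iff by blast
  interpret sized_cnf_input w x d k F by unfold_locales (use F in auto)
  have "fillable A (Suc k) Q compatible"
    using fill \<open>valid_input d w\<close>
    by (subst fillable_cong[where C' = "\<lambda>\<sigma> p \<tau> q. valid_input d w \<and> compatible_at d w \<sigma> p \<tau> q"])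
      (simp_all add: compatible_at)
  from satisfiable_if_fillable[OF this] F show "(x, k) \<in> WSAT_Gamma1 d"
    unfolding WSAT_Gamma1_def by blast
next
  assume "(x, k) \<in> WSAT_Gamma1 d"
  then obtain F X where F: "x = encode_cnf F" "\<And>C. C \<in> set F \<Longrightarrow> length C \<le> d" and
    X: "X \<subseteq> cnf_vars F" "card X = k" "cnf_satisfied X F"
    unfolding WSAT_Gamma1_def by blast
  \<comment> \<open>An empty clause cannot be satisfied, so rejecting it loses no
    yes-instance.\<close>
  have ne: "C \<noteq> []" if "C \<in> set F" for C using X(3) that by (auto simp: cnf_satisfied_def)
  interpret sized_cnf_input w x d k F by unfold_locales (use F in auto)
  have "valid_input d w" using valid_input_iff F ne by blast
  then show "fillable A (Suc k) Q (\<lambda>\<sigma> p \<tau> q. valid_input d w \<and> compatible_at d w \<sigma> p \<tau> q)"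
    using fillable_if_satisfiable[OF X]
    by (subst fillable_cong[where C' = compatible]) (simp_all add: compatible_at)
qed

end

lemma runs_Write_Seq:
  assumes "runs q (s(a := (s a)(aval i s := aval e s))) (n - (1 + acost i + acost e)) Q"
    "1 + acost i + acost e \<le> n"
  shows "runs (Seq (Write a i e) q) s n Q"
  using runs_Seq[OF runs_Write[of "\<lambda>s. runs q s (n - (1 + acost i + acost e)) Q", OF assms(1) order_refl]]
    assms(2) by simp

section \<open>Writing the output\<close>

abbreviation scalar :: "string \<Rightarrow> aexp" where
  "scalar a \<equiv> Read a (Const 0)"

text \<open>The output overwrites \<open>bits\<close> from cell \<open>0\<close> on, which is safe
  because the input lives in \<open>w\<close> by then. The length so far is kept in
  \<open>o\<close>.\<close>

definition written :: "store \<Rightarrow> bool list \<Rightarrow> bool" where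
  "written s out \<longleftrightarrow> s ''o'' 0 = length out \<and> (\<forall>i<length out. s ''bits'' i = of_bool (out ! i))"

lemma writtenD: "written s out \<Longrightarrow> s ''o'' 0 = length out"
  by (simp add: written_def)

lemma written_append:
  assumes "written s out" "s' ''o'' 0 = length out + length bs"
    "\<And>i. i < length out \<Longrightarrow> s' ''bits'' i = s ''bits'' i"
    "\<And>i. i < length bs \<Longrightarrow> s' ''bits'' (length out + i) = of_bool (bs ! i)"
  shows "written s' (out @ bs)"
proof -
  have "s' ''bits'' i = of_bool ((out @ bs) ! i)" if "i < length out + length bs" for i
    using that assms(1,3) assms(4)[of "i - length out"]
    by (cases "i < length out") (auto simp: written_def nth_append)
  then show ?thesis using assms(2) by (simp add: written_def)
qed

text \<open>Writes a marker and the lowest bit of \<open>x\<close>, obtained by subtracting twice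
  the half.\<close>

definition emit_step :: com where
  "emit_step = Seq (Write ''bits'' (scalar ''o'') (Const 1))
     (Seq (Write ''bits'' (Add (scalar ''o'') (Const 1)) (Sub (scalar ''x'') (Add (Half (scalar ''x'')) (Half (scalar ''x'')))))
     (Seq (Write ''o'' (Const 0) (Add (scalar ''o'') (Const 2)))
          (Write ''x'' (Const 0) (Half (scalar ''x'')))))"

definition emit_number :: com where
  "emit_number = Seq (While (scalar ''x'') emit_step)
     (Seq (Write ''bits'' (scalar ''o'') (Const 0)) (Write ''o'' (Const 0) (Add (scalar ''o'') (Const 1))))"

abbreviation output_names :: "string set" where
  "output_names \<equiv> {''bits'', ''o'', ''x''}"

lemma runs_emit_step:
  assumes "written s out" "s ''x'' 0 = m"
  shows "runs emit_step s 30
    (\<lambda>s'. written s' (out @ [True, odd m]) \<and> s' ''x'' 0 = m div 2 \<and> (\<forall>a. a \<notin> output_names \<longrightarrow> s' a = s a))"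
proof -
  have "m - (m div 2 + m div 2) = of_bool (odd m)" by (auto simp: of_bool_def) presburger+
  then show ?thesis unfolding emit_step_def using assms
    by (intro runs_Write_Seq runs_Write)
      (auto intro!: written_append[OF assms(1)] simp: writtenD[OF assms(1)] less_Suc_eq)
qed

text \<open>The value itself is the variant. It overestimates the bit length, but every number
  written is at most the limit \<open>w 0\<close>, so the cost stays polynomial in it.\<close>

lemma runs_emit_number:
  assumes "written s out" "s ''x'' 0 = n"
  shows "runs emit_number s ((n + 1) * 33 + 10)
    (\<lambda>s'. written s' (out @ encode_nat n) \<and> (\<forall>a. a \<notin> output_names \<longrightarrow> s' a = s a))"
proof -
  define I where "I m s' \<longleftrightarrow> s' ''x'' 0 = m \<and> (\<exists>bs. bits_of_nat n = bs @ bits_of_nat m \<and>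
    written s' (out @ mark_bits bs)) \<and> (\<forall>a. a \<notin> output_names \<longrightarrow> s' a = s a)" for m s'
  have "I n s" using assms by (auto simp: I_def intro: exI[of _ "[]"])
  have step: "\<exists>m'<m. runs emit_step s1 30 (I m')" if "I m s1" "aval (scalar ''x'') s1 \<noteq> 0" for m s1
  proof -
    from that obtain bs where bs: "bits_of_nat n = bs @ bits_of_nat m" "written s1 (out @ mark_bits bs)"
      "s1 ''x'' 0 = m" "m \<noteq> 0" "\<forall>a. a \<notin> output_names \<longrightarrow> s1 a = s a" by (auto simp: I_def)
    then have "bits_of_nat n = (bs @ [odd m]) @ bits_of_nat (m div 2)" by (simp add: bits_of_nat.simps[of m])
    then show ?thesis
      by (intro exI[of _ "m div 2"] conjI runs_mono[OF runs_emit_step[OF bs(2,3)]])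
        (use bs in \<open>auto simp: I_def intro!: exI[of _ "bs @ [odd m]"]\<close>)
  qed
  have fin: "runs (Seq (Write ''bits'' (scalar ''o'') (Const 0)) (Write ''o'' (Const 0) (Add (scalar ''o'') (Const 1)))) s1 10
      (\<lambda>s'. written s' (out @ encode_nat n) \<and> (\<forall>a. a \<notin> output_names \<longrightarrow> s' a = s a))"
    if "I 0 s1" for s1
  proof -
    from that have wr: "written s1 (out @ mark_bits (bits_of_nat n))"
      and fr: "\<forall>a. a \<notin> output_names \<longrightarrow> s1 a = s a"
      by (auto simp: I_def bits_of_nat.simps[of 0])
    let ?o = "out @ mark_bits (bits_of_nat n)"
    have wr': "written s' (?o @ [False])"
      if "s' ''o'' 0 = Suc (length ?o)" "s' ''bits'' = (s1 ''bits'')(length ?o := 0)" for s'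
      by (rule written_append[OF wr]) (use that in auto)
    have "encode_nat n = mark_bits (bits_of_nat n) @ [False]" by (simp add: encode_nat_def)
    then show ?thesis
      using wr' fr writtenD[OF wr]
      by (intro runs_Write_Seq runs_Write) simp_all
  qed
  have loop: "runs (While (scalar ''x'') emit_step) s ((n + 1) * (1 + acost (scalar ''x'') + 30))
      (\<lambda>s'. (\<exists>m. I m s') \<and> aval (scalar ''x'') s' = 0)"
    by (rule runs_While[where I = I]) (fact step \<open>I n s\<close>)+
  show ?thesis unfolding emit_number_def
  proof (rule runs_Seq, rule runs_mono[OF loop])
    fix s1 assume "(\<exists>m. I m s1) \<and> aval (scalar ''x'') s1 = 0"
    then obtain m where m: "I m s1" "s1 ''x'' 0 = 0" by auto
    then have "m = 0" by (simp only: I_def)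
    with m have "I 0 s1" by simp
    then show "runs (Seq (Write ''bits'' (scalar ''o'') (Const 0)) (Write ''o'' (Const 0) (Add (scalar ''o'') (Const 1)))) s1 10
      (\<lambda>s'. written s' (out @ encode_nat n) \<and> (\<forall>a. a \<notin> output_names \<longrightarrow> s' a = s a))" by (rule fin)
  qed simp
qed

text \<open>All variables are mapped to cell \<open>0\<close> of \<open>v\<close>, which holds the
  running index \<open>j\<close>; the expression \<open>e\<close> may thus depend on it through
  variable \<open>0\<close>.\<close>

definition emit_block :: "ex \<Rightarrow> ex \<Rightarrow> com" where
  "emit_block c e = Seq (compile c (\<lambda>_. 0) 1) (Seq (Write ''cnt'' (Const 0) (V 1)) (Seq (Write ''j'' (Const 0) (Const 0))
     (While (Sub (scalar ''cnt'') (scalar ''j''))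
       (Seq (Write ''v'' (Const 0) (scalar ''j'')) (Seq (compile e (\<lambda>_. 0) 1) (Seq (Write ''x'' (Const 0) (V 1))
         (Seq emit_number (Write ''j'' (Const 0) (Add (scalar ''j'') (Const 1))))))))))"

definition block_time :: "nat \<Rightarrow> ex \<Rightarrow> ex \<Rightarrow> nat" where
  "block_time N c e = time N c + (4 + (3 + (N + 1) * (6 + (4 + (time N e + (4 + (((N + 1) * 33 + 10) + 6)))))))"

abbreviation scratch_names :: "string set" where
  "scratch_names \<equiv> {''bits'', ''o'', ''x'', ''v'', ''cnt'', ''j''}"

lemma runs_emit_block:
  assumes wr: "written s out" and w: "s ''w'' = w"
    and c: "\<And>\<rho>. ev w \<rho> c = cf" "\<And>\<rho>. iter_le (w 0) w \<rho> c"
    and e: "\<And>\<rho>. ev w \<rho> e = ef (\<rho> 0)" "\<And>\<rho>. iter_le (w 0) w \<rho> e"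
    and le: "cf \<le> w 0" "\<And>j. j < cf \<Longrightarrow> ef j \<le> w 0"
  shows "runs (emit_block c e) s (block_time (w 0) c e)
    (\<lambda>s'. written s' (out @ encode_nats (map ef [0..<cf])) \<and> (\<forall>a. a \<notin> scratch_names \<longrightarrow> s' a = s a))"
proof -
  let ?fr = "\<lambda>s'. \<forall>a. a \<notin> scratch_names \<longrightarrow> s' a = s a"
  let ?body = "Seq (Write ''v'' (Const 0) (scalar ''j'')) (Seq (compile e (\<lambda>_. 0) 1) (Seq (Write ''x'' (Const 0) (V 1))
         (Seq emit_number (Write ''j'' (Const 0) (Add (scalar ''j'') (Const 1))))))"
  let ?tb = "4 + (time (w 0) e + (4 + (((w 0 + 1) * 33 + 10) + 6)))"
  define I where "I m s' \<longleftrightarrow> m \<le> cf \<and> s' ''cnt'' 0 = cf \<and> s' ''j'' 0 = cf - m \<and>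
    written s' (out @ encode_nats (map ef [0..<cf - m])) \<and> ?fr s'" for m s'
  have body: "runs ?body s1 ?tb (I (m - 1))" if I: "I m s1" and m: "m \<noteq> 0" for m s1
  proof -
    let ?j = "cf - m" and ?o = "out @ encode_nats (map ef [0..<cf - m])"
    from I have mc: "m \<le> cf" and cnt: "s1 ''cnt'' 0 = cf" and sj: "s1 ''j'' 0 = ?j"
      and wr1: "written s1 ?o" and fr1: "\<And>a. a \<notin> scratch_names \<Longrightarrow> s1 a = s a"
      unfolding I_def by blast+
    let ?s2 = "s1(''v'' := (s1 ''v'')(aval (Const 0) s1 := aval (scalar ''j'') s1))"
    have j: "?j < cf" and Sj: "cf - (m - 1) = Suc ?j" using mc m by simp_all
    have c1: "runs (compile e (\<lambda>_. 0) 1) ?s2 (time (w 0) e)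
      (\<lambda>s'. s' ''v'' 1 = ev w (\<lambda>_. ?j) e \<and> (\<forall>j<1. s' ''v'' j = ?s2 ''v'' j) \<and>
        (\<forall>a. a \<noteq> ''v'' \<longrightarrow> s' a = ?s2 a))"
      by (rule runs_compile) (use sj fr1[of "''w''"] w e(2) in simp_all)
    have c2: "runs (Seq (Write ''x'' (Const 0) (V 1)) (Seq emit_number (Write ''j'' (Const 0) (Add (scalar ''j'') (Const 1)))))
         s3 (4 + (((w 0 + 1) * 33 + 10) + 6)) (I (m - 1))"
      if v: "s3 ''v'' 1 = ev w (\<lambda>_. ?j) e" and fr3: "\<And>a. a \<noteq> ''v'' \<Longrightarrow> s3 a = ?s2 a" for s3
    proof -
      let ?s4 = "s3(''x'' := (s3 ''x'')(aval (Const 0) s3 := aval (V 1) s3))"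
      have x: "?s4 ''x'' 0 = ef ?j" using v e(1) by simp
      have fr4: "?s4 a = s1 a" if "a \<noteq> ''x''" "a \<noteq> ''v''" for a using that fr3[of a] by simp
      have "written ?s4 ?o" using wr1 fr4[of "''o''"] fr4[of "''bits''"] by (simp add: written_def)
      note run = runs_emit_number[OF this x]
      have "(ef ?j + 1) * 33 + 10 \<le> (w 0 + 1) * 33 + 10" using le(2)[OF j] by simp
      note run = runs_mono[OF run this]
      have last: "I (m - 1) (s5(''j'' := (s5 ''j'')(aval (Const 0) s5 := aval (Add (scalar ''j'') (Const 1)) s5)))"
        (is "I _ ?s6")
        if s5: "written s5 (?o @ encode_nat (ef ?j))" and fr5: "\<And>a. a \<notin> output_names \<Longrightarrow> s5 a = ?s4 a" for s5
      proof -
        have "?s6 a = s a" if "a \<notin> scratch_names" for a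
          using that fr5[of a] fr4[of a] fr1[of a] by simp
        moreover have "?s6 ''j'' 0 = Suc ?j" "?s6 ''cnt'' 0 = cf"
          using fr5[of "''j''"] fr4[of "''j''"] sj fr5[of "''cnt''"] fr4[of "''cnt''"] cnt by simp_all
        moreover have "written ?s6 (out @ encode_nats (map ef [0..<Suc ?j]))"
          using s5 by (simp add: written_def)
        moreover have "m - 1 \<le> cf" using mc by simp
        ultimately show ?thesis unfolding I_def Sj by blast
      qed
      have "runs (Seq emit_number (Write ''j'' (Const 0) (Add (scalar ''j'') (Const 1)))) ?s4
          (((w 0 + 1) * 33 + 10) + 6) (I (m - 1))"
        by (rule runs_Seq, rule run, rule runs_Write, rule last) (blast, blast, simp)
      then show ?thesis by (intro runs_Write_Seq) simp_all
    qed
    show ?thesis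
      by (rule runs_Seq, rule runs_Write, rule runs_Seq, rule runs_mono[OF c1 order_refl], rule c2) (blast, blast, simp)
  qed
  have exit_iff: "aval (Sub (scalar ''cnt'') (scalar ''j'')) s' = 0 \<longleftrightarrow> m = 0" if "I m s'" for m s'
  proof -
    have "m \<le> cf" "s' ''cnt'' 0 = cf" "s' ''j'' 0 = cf - m" using that unfolding I_def by blast+
    then show ?thesis by simp
  qed
  have loop: "runs (While (Sub (scalar ''cnt'') (scalar ''j'')) ?body) s1 ((w 0 + 1) * (6 + ?tb))
      (\<lambda>s'. written s' (out @ encode_nats (map ef [0..<cf])) \<and> ?fr s')" if "I cf s1" for s1
  proof -
    have step: "\<exists>n'<n. runs ?body s2 ?tb (I n')" if "I n s2" "aval (Sub (scalar ''cnt'') (scalar ''j'')) s2 \<noteq> 0" for n s2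
      using that body[OF that(1)] exit_iff[OF that(1)] by (intro exI[of _ "n - 1"]) simp
    have "runs (While (Sub (scalar ''cnt'') (scalar ''j'')) ?body) s1
        ((cf + 1) * (1 + acost (Sub (scalar ''cnt'') (scalar ''j'')) + ?tb))
        (\<lambda>s'. (\<exists>n. I n s') \<and> aval (Sub (scalar ''cnt'') (scalar ''j'')) s' = 0)"
      by (rule runs_While[where I = I]) (fact step that)+
    then show ?thesis
    proof (rule runs_mono)
      show "(cf + 1) * (1 + acost (Sub (scalar ''cnt'') (scalar ''j'')) + ?tb) \<le> (w 0 + 1) * (6 + ?tb)"
        using le(1) by (intro mult_le_mono) auto
      fix s2 assume "(\<exists>n. I n s2) \<and> aval (Sub (scalar ''cnt'') (scalar ''j'')) s2 = 0"
      then have "I 0 s2" using exit_iff by blast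
      then show "written s2 (out @ encode_nats (map ef [0..<cf])) \<and> ?fr s2" unfolding I_def by simp
    qed
  qed
  have start: "runs (compile c (\<lambda>_. 0) 1) s (time (w 0) c)
      (\<lambda>s'. s' ''v'' 1 = ev w (\<lambda>_. s ''v'' 0) c \<and> (\<forall>j<1. s' ''v'' j = s ''v'' j) \<and>
        (\<forall>a. a \<noteq> ''v'' \<longrightarrow> s' a = s a))"
    by (rule runs_compile) (use w c(2) in simp_all)
  show ?thesis unfolding emit_block_def block_time_def
  proof (rule runs_Seq, rule runs_mono[OF start order_refl])
    fix s1 assume s1: "s1 ''v'' 1 = ev w (\<lambda>_. s ''v'' 0) c \<and> (\<forall>j<1. s1 ''v'' j = s ''v'' j) \<and>
      (\<forall>a. a \<noteq> ''v'' \<longrightarrow> s1 a = s a)"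
    let ?s2 = "s1(''cnt'' := (s1 ''cnt'')(aval (Const 0) s1 := aval (V 1) s1))"
    let ?s3 = "?s2(''j'' := (?s2 ''j'')(aval (Const 0) ?s2 := aval (Const 0) ?s2))"
    have "?s3 a = s a" if "a \<notin> scratch_names" for a using that s1 by simp
    moreover have "?s3 ''cnt'' 0 = cf" "?s3 ''j'' 0 = 0" using s1 c(1) by simp_all
    moreover have "written ?s3 out" using wr s1 by (simp add: written_def)
    ultimately have "I cf ?s3" unfolding I_def by simp
    note lp = loop[OF this]
    show "runs (Seq (Write ''cnt'' (Const 0) (V 1)) (Seq (Write ''j'' (Const 0) (Const 0))
      (While (Sub (scalar ''cnt'') (scalar ''j'')) ?body))) s1 (4 + (3 + (w 0 + 1) * (6 + ?tb)))
      (\<lambda>s'. written s' (out @ encode_nats (map ef [0..<cf])) \<and> ?fr s')"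
      by (rule runs_Write_Seq, rule runs_Write_Seq, rule runs_mono[OF lp]) simp_all
  qed
qed

section \<open>Reading the input\<close>

definition trues :: "bool list \<Rightarrow> nat" where
  "trues x = length (filter id x)"

lemma trues_simps [simp]: "trues [] = 0" "trues (b # x) = of_bool b + trues x"
  "trues (x @ y) = trues x + trues y"
  by (auto simp: trues_def)

lemma trues_take: "trues (take i x) \<le> trues x"
  by (metis append_take_drop_id le_add1 trues_simps(3))

text \<open>
  A preceding program may have announced an output of exponential length that consists almost
  entirely of the initial zeros of its memory. Encodings of satisfiable formulas are not of this
  kind, so the input can be rejected as soon as its prefix is not dense.
\<close>

definition dense :: "nat \<Rightarrow> bool list \<Rightarrow> bool" where
  "dense r x \<longleftrightarrow> (\<forall>i\<le>length x. 0 < i \<longrightarrow> i < r * (trues (take i x) + 1))"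

text \<open>A form of \<open>dense\<close> with separate rate and offset, which composes under
  concatenation.\<close>

definition slack :: "nat \<Rightarrow> nat \<Rightarrow> bool list \<Rightarrow> bool" where
  "slack r m x \<longleftrightarrow> (\<forall>i\<le>length x. i \<le> r * trues (take i x) + m)"

lemma slack_mono: "slack r m x \<Longrightarrow> r \<le> r' \<Longrightarrow> m \<le> m' \<Longrightarrow> slack r' m' x"
  unfolding slack_def by (meson add_mono mult_le_mono1 order_trans)

lemma slackD: "slack r m x \<Longrightarrow> length x \<le> r * trues x + m"
  unfolding slack_def by force

lemma slack_append:
  assumes "slack r m x" "length x \<le> r * trues x + c" "slack r m' y" "m \<le> c + m'"
  shows "slack r (c + m') (x @ y)"
  unfolding slack_def
proof (intro allI impI)
  fix i assume i: "i \<le> length (x @ y)"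
  show "i \<le> r * trues (take i (x @ y)) + (c + m')"
  proof (cases "i \<le> length x")
    case True
    then have "i \<le> r * trues (take i x) + m" using assms(1) by (simp add: slack_def)
    then show ?thesis using True assms(4) by simp
  next
    case False
    then have "i - length x \<le> r * trues (take (i - length x) y) + m'"
      using assms(3) i by (simp add: slack_def)
    then show ?thesis using False assms(2) by (simp add: distrib_left)
  qed
qed

text \<open>Every second bit is a marker, and only the terminator is not paid for.\<close>

lemma slack_encode_nat: "slack 2 1 (encode_nat n)"
proof -
  have "slack 2 1 (mark_bits bs @ [False])" for bs
  proof (induction bs)
    case (Cons b bs)
    have "slack 2 0 [True, b]" by (auto simp: slack_def le_Suc_eq numeral_2_eq_2)
    then show ?case using slack_append[of 2 0 "[True, b]" 0 1] Cons by simp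
  qed (auto simp: slack_def le_Suc_eq)
  then show ?thesis by (simp add: encode_nat_def)
qed

lemma slack_encode_nats: "slack 2 (length ns) (encode_nats ns)"
proof (induction ns)
  case (Cons n ns)
  then show ?case
    using slack_append[OF slack_encode_nat slackD[OF slack_encode_nat] Cons] by simp
qed (simp add: slack_def)

lemma trues_encode_nat: "0 < n \<Longrightarrow> 0 < trues (encode_nat n)"
  by (subst encode_nat_def, subst bits_of_nat.simps) simp

text \<open>A clause consists of at most \<open>2 * d + 1\<close> numbers, each with one unpaid
  terminator. Its header is positive and contains a one, which pays for them all; hence the rate
  \<open>2 + (2 * d + 1)\<close>.\<close>

lemma slack_encode_clauses:
  assumes "\<And>C. C \<in> set F \<Longrightarrow> C \<noteq> [] \<and> length C \<le> d"
  shows "slack (2 * d + 3) (2 * d + 1) (encode_nats (concat (map encode_clause F)))"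
  using assms
proof (induction F)
  case (Cons C F)
  let ?e = "encode_nats (encode_clause C)"
  have C: "C \<noteq> []" "length C \<le> d" using Cons.prems by auto
  have sl: "slack 2 (2 * d + 1) ?e"
    by (rule slack_mono[OF slack_encode_nats]) (use C in simp_all)
  have "0 < trues ?e" using trues_encode_nat[of "length C"] C by simp
  then have "2 * trues ?e + (2 * d + 1) \<le> (2 * d + 3) * trues ?e + 0"
    by (cases "trues ?e") (simp_all add: algebra_simps)
  with slackD[OF sl] have len: "length ?e \<le> (2 * d + 3) * trues ?e + 0" by linarith
  have "slack (2 * d + 3) (2 * d + 1) ?e" by (rule slack_mono[OF sl]) simp_all
  from slack_append[OF this len Cons.IH] Cons.prems show ?case by simp
qed (simp add: slack_def)

lemma dense_encode_cnf:
  assumes "\<And>C. C \<in> set F \<Longrightarrow> C \<noteq> [] \<and> length C \<le> d"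
  shows "dense (2 * d + 3) (encode_cnf F)"
proof -
  let ?h = "encode_nat (length F)"
  have "slack (2 * d + 3) (1 + (2 * d + 1)) (?h @ encode_nats (concat (map encode_clause F)))"
  proof (rule slack_append)
    show "slack (2 * d + 3) 1 ?h" by (rule slack_mono[OF slack_encode_nat]) simp_all
    then show "length ?h \<le> (2 * d + 3) * trues ?h + 1" by (rule slackD)
  qed (use slack_encode_clauses[OF assms] in simp_all)
  \<comment> \<open>The offset is one less than the rate, which yields the strict inequality of
    \<open>dense\<close>.\<close>
  then have "slack (2 * d + 3) (2 * d + 2) (encode_cnf F)" by (simp add: encode_cnf_def)
  then show ?thesis unfolding slack_def dense_def
    by (auto simp: distrib_left intro: le_less_trans)
qed

section \<open>Scanning for density\<close>

definition dense_part :: "nat \<Rightarrow> bool list \<Rightarrow> bool list" where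
  "dense_part r x = (if dense r x then x else [])"

lemma length_dense_part: "length (dense_part r x) \<le> r * (trues x + 1)"
  by (cases "x = []") (auto simp: dense_part_def dense_def)

text \<open>A yes-instance has no empty clause and is dense, so a string that is not dense is a
  no-instance; so is the empty string, which encodes no formula.\<close>

lemma WSAT_dense_part: "(dense_part (2 * d + 3) x, k) \<in> WSAT_Gamma1 d \<longleftrightarrow> (x, k) \<in> WSAT_Gamma1 d"
proof (cases "dense (2 * d + 3) x")
  case False
  have "\<not> (x, k) \<in> WSAT_Gamma1 d"
  proof
    assume "(x, k) \<in> WSAT_Gamma1 d"
    then obtain F X where F: "x = encode_cnf F" "\<forall>C\<in>set F. length C \<le> d" "cnf_satisfied X F"
      unfolding WSAT_Gamma1_def by blast
    then have "C \<noteq> [] \<and> length C \<le> d" if "C \<in> set F" for C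
      using that by (auto simp: cnf_satisfied_def)
    then show False using dense_encode_cnf[of F d] F(1) False by simp
  qed
  moreover have "encode_cnf F \<noteq> []" for F by (simp add: encode_cnf_def encode_nat_def)
  then have "([], k) \<notin> WSAT_Gamma1 d" unfolding WSAT_Gamma1_def by (smt (verit) mem_Collect_eq prod.inject)
  ultimately show ?thesis using False by (simp add: dense_part_def)
qed (simp add: dense_part_def)

text \<open>The bound \<open>lim\<close> grows by \<open>r\<close> with every one that is read.
  Setting \<open>len\<close> to \<open>0\<close> ends the loop and at the same time replaces the
  input by the empty string.\<close>

definition scan_step :: "nat \<Rightarrow> com" where
  "scan_step r =
     Seq (Write ''w'' (Add (scalar ''pos'') (Const 3)) (Read ''bits'' (scalar ''pos'')))
    (Seq (If (Read ''bits'' (scalar ''pos'')) (Write ''lim'' (Const 0) (Add (scalar ''lim'') (Const r))) Skip)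
    (Seq (Write ''pos'' (Const 0) (Add (scalar ''pos'') (Const 1)))
         (If (Sub (scalar ''lim'') (scalar ''pos'')) Skip (Write ''len'' (Const 0) (Const 0)))))"

definition scan :: "nat \<Rightarrow> com" where
  "scan r = Seq (Write ''pos'' (Const 0) (Const 0)) (Seq (Write ''lim'' (Const 0) (Const r))
     (While (Sub (scalar ''len'') (scalar ''pos'')) (scan_step r)))"

definition scan_state :: "nat \<Rightarrow> bool list \<Rightarrow> nat \<Rightarrow> nat \<Rightarrow> store \<Rightarrow> bool" where
  "scan_state r x k p s \<longleftrightarrow> s ''par'' 0 = k \<and> s ''len'' 0 = length x \<and>
     s ''pos'' 0 = p \<and> s ''lim'' 0 = r * (trues (take p x) + 1) \<and> p \<le> length x \<and>
     (\<forall>i<length x. s ''bits'' i = of_bool (x ! i)) \<and> (\<forall>i<p. s ''w'' (i + 3) = of_bool (x ! i)) \<and>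
     (\<forall>i\<le>p. 0 < i \<longrightarrow> i < r * (trues (take i x) + 1))"

lemma runs_scan_step:
  assumes st: "scan_state r x k p s" and p: "p < length x"
  shows "runs (scan_step r) s 42 (\<lambda>s'. scan_state r x k (Suc p) s' \<or>
    s' ''par'' 0 = k \<and> s' ''len'' 0 = 0 \<and> \<not> dense r x)"
proof -
  let ?b = "x ! p"
  from st have s: "s ''par'' 0 = k" "s ''len'' 0 = length x" "s ''pos'' 0 = p"
    "s ''lim'' 0 = r * (trues (take p x) + 1)" "\<And>i. i < length x \<Longrightarrow> s ''bits'' i = of_bool (x ! i)"
    "\<And>i. i < p \<Longrightarrow> s ''w'' (i + 3) = of_bool (x ! i)"
    "\<And>i. i \<le> p \<Longrightarrow> 0 < i \<Longrightarrow> i < r * (trues (take i x) + 1)"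
    unfolding scan_state_def by blast+
  let ?l = "r * (trues (take (Suc p) x) + 1)"
  have l: "?l = r * (trues (take p x) + 1) + (if ?b then r else 0)"
    using p by (simp add: take_Suc_conv_app_nth distrib_left)
  let ?s1 = "s(''w'' := (s ''w'')(p + 3 := of_bool ?b))"
  let ?s2 = "?s1(''lim'' := (s ''lim'')(0 := ?l))"
  let ?s3 = "?s2(''pos'' := (s ''pos'')(0 := Suc p))"
  have if1: "runs (If (Read ''bits'' (scalar ''pos'')) (Write ''lim'' (Const 0) (Add (scalar ''lim'') (Const r))) Skip)
      ?s1 10 (\<lambda>s'. s' = ?s2)"
  proof (rule runs_If[where n = 6])
    assume "aval (Read ''bits'' (scalar ''pos'')) ?s1 \<noteq> 0"
    then have ?b using s(3) s(5)[OF p] by simp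
    then show "runs (Write ''lim'' (Const 0) (Add (scalar ''lim'') (Const r))) ?s1 6 (\<lambda>s'. s' = ?s2)"
      using s(4) l \<open>?b\<close> by (intro runs_Write) (simp_all add: add_ac)
  next
    assume "aval (Read ''bits'' (scalar ''pos'')) ?s1 = 0"
    then have "\<not> ?b" using s(3) s(5)[OF p] by simp
    then have "?s2 = ?s1" using s(4) l by (auto simp: fun_eq_iff)
    then show "runs Skip ?s1 6 (\<lambda>s'. s' = ?s2)" by (intro runs_Skip) simp_all
  qed simp
  have if2: "runs (If (Sub (scalar ''lim'') (scalar ''pos'')) Skip (Write ''len'' (Const 0) (Const 0))) ?s3 9
    (\<lambda>s'. scan_state r x k (Suc p) s' \<or> s' ''par'' 0 = k \<and> s' ''len'' 0 = 0 \<and> \<not> dense r x)"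
  proof (rule runs_If[where n = 3])
    assume "aval (Sub (scalar ''lim'') (scalar ''pos'')) ?s3 \<noteq> 0"
    then have less: "Suc p < ?l" by simp
    have "scan_state r x k (Suc p) ?s3"
      unfolding scan_state_def using s less p by (simp add: less_Suc_eq le_Suc_eq)
    then show "runs Skip ?s3 3 (\<lambda>s'. scan_state r x k (Suc p) s' \<or> s' ''par'' 0 = k \<and> s' ''len'' 0 = 0 \<and> \<not> dense r x)"
      by (intro runs_Skip) simp_all
  next
    assume "aval (Sub (scalar ''lim'') (scalar ''pos'')) ?s3 = 0"
    then have "\<not> Suc p < ?l" by simp
    then have "\<not> dense r x" using p unfolding dense_def by (meson Suc_leI zero_less_Suc)
    then show "runs (Write ''len'' (Const 0) (Const 0)) ?s3 3
       (\<lambda>s'. scan_state r x k (Suc p) s' \<or> s' ''par'' 0 = k \<and> s' ''len'' 0 = 0 \<and> \<not> dense r x)"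
      using s(1) by (intro runs_Write) simp_all
  qed simp
  have w2: "runs (Seq (Write ''pos'' (Const 0) (Add (scalar ''pos'') (Const 1)))
         (If (Sub (scalar ''lim'') (scalar ''pos'')) Skip (Write ''len'' (Const 0) (Const 0)))) ?s2 15
    (\<lambda>s'. scan_state r x k (Suc p) s' \<or> s' ''par'' 0 = k \<and> s' ''len'' 0 = 0 \<and> \<not> dense r x)"
    by (rule runs_Write_Seq) (use if2 s(3) in simp_all)
  have w1: "runs (Seq (If (Read ''bits'' (scalar ''pos'')) (Write ''lim'' (Const 0) (Add (scalar ''lim'') (Const r))) Skip)
    (Seq (Write ''pos'' (Const 0) (Add (scalar ''pos'') (Const 1)))
         (If (Sub (scalar ''lim'') (scalar ''pos'')) Skip (Write ''len'' (Const 0) (Const 0))))) ?s1 (10 + 15)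
    (\<lambda>s'. scan_state r x k (Suc p) s' \<or> s' ''par'' 0 = k \<and> s' ''len'' 0 = 0 \<and> \<not> dense r x)"
    by (rule runs_Seq, rule runs_mono[OF if1 order_refl]) (use w2 in simp)
  have eq: "s(''w'' := (s ''w'')(aval (Add (scalar ''pos'') (Const 3)) s := aval (Read ''bits'' (scalar ''pos'')) s)) = ?s1"
    using s(3) s(5)[OF p] by simp
  show ?thesis unfolding scan_step_def
    by (rule runs_Write_Seq, unfold eq, rule runs_mono[OF w1]) simp_all
qed

text \<open>The position stays below \<open>r\<close> times the number of ones seen so far plus one,
  so the time depends on the ones and not on the announced length.\<close>

lemma runs_scan:
  assumes inst: "holds_instance s x k" and r: "0 < r"
  shows "runs (scan r) s (6 + (r * (trues x + 1) + 1) * 48) (\<lambda>s'. s' ''par'' 0 = k \<and>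
    s' ''len'' 0 = length (dense_part r x) \<and>
    (\<forall>i<length (dense_part r x). s' ''w'' (i + 3) = of_bool (dense_part r x ! i)))"
proof -
  define I where "I m s' \<longleftrightarrow> (\<exists>p. m + p = r * (trues x + 1) \<and> scan_state r x k p s') \<or>
    s' ''par'' 0 = k \<and> s' ''len'' 0 = 0 \<and> \<not> dense r x" for m s'
  let ?b = "Sub (scalar ''len'') (scalar ''pos'')"
  have step: "\<exists>m'<m. runs (scan_step r) s1 42 (I m')" if I: "I m s1" and b: "aval ?b s1 \<noteq> 0" for m s1
  proof -
    from b have "s1 ''len'' 0 \<noteq> 0" by simp
    with I obtain p where p: "m + p = r * (trues x + 1)" "scan_state r x k p s1" by (auto simp: I_def)
    from p(2) b have less: "p < length x" unfolding scan_state_def by auto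
    have "p < r * (trues (take p x) + 1)"
    proof (cases "p = 0")
      case False
      then show ?thesis using p(2) unfolding scan_state_def by blast
    qed (use r in simp)
    also have "\<dots> \<le> r * (trues x + 1)" using trues_take[of p x] by simp
    finally have "0 < m" using p(1) by simp
    moreover have "I (m - 1) s'" if "scan_state r x k (Suc p) s' \<or>
      s' ''par'' 0 = k \<and> s' ''len'' 0 = 0 \<and> \<not> dense r x" for s'
      unfolding I_def
    proof (rule disjE[OF that])
      assume "scan_state r x k (Suc p) s'"
      moreover have "m - 1 + Suc p = r * (trues x + 1)" using p(1) \<open>0 < m\<close> by simp
      ultimately show "(\<exists>p. m - 1 + p = r * (trues x + 1) \<and> scan_state r x k p s') \<or>
        s' ''par'' 0 = k \<and> s' ''len'' 0 = 0 \<and> \<not> dense r x" by blast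
    qed blast
    ultimately show ?thesis
      by (intro exI[of _ "m - 1"] conjI runs_mono[OF runs_scan_step[OF p(2) less] order_refl]) simp_all
  qed
  let ?s1 = "s(''pos'' := (s ''pos'')(0 := 0), ''lim'' := (s ''lim'')(0 := r))"
  have "scan_state r x k 0 ?s1" using inst by (simp add: scan_state_def holds_instance_def)
  then have "I (r * (trues x + 1)) ?s1" unfolding I_def by (intro disjI1 exI[of _ 0]) simp
  have loop: "runs (While ?b (scan_step r)) ?s1 ((r * (trues x + 1) + 1) * (1 + acost ?b + 42))
      (\<lambda>s'. (\<exists>m. I m s') \<and> aval ?b s' = 0)"
    by (rule runs_While[where I = I]) (fact step \<open>I (r * (trues x + 1)) ?s1\<close>)+
  have loop': "runs (While ?b (scan_step r)) ?s1 ((r * (trues x + 1) + 1) * 48) (\<lambda>s'. s' ''par'' 0 = k \<and>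
    s' ''len'' 0 = length (dense_part r x) \<and>
    (\<forall>i<length (dense_part r x). s' ''w'' (i + 3) = of_bool (dense_part r x ! i)))"
  proof (rule runs_mono[OF loop])
    fix s' assume "(\<exists>m. I m s') \<and> aval ?b s' = 0"
    then obtain m where I: "I m s'" and b: "aval ?b s' = 0" by blast
    from I have "(\<exists>p. scan_state r x k p s') \<or> s' ''par'' 0 = k \<and> s' ''len'' 0 = 0 \<and> \<not> dense r x"
      unfolding I_def by fast
    then consider p where "scan_state r x k p s'" | "s' ''par'' 0 = k" "s' ''len'' 0 = 0" "\<not> dense r x"
      by fast
    then show "s' ''par'' 0 = k \<and> s' ''len'' 0 = length (dense_part r x) \<and>
      (\<forall>i<length (dense_part r x). s' ''w'' (i + 3) = of_bool (dense_part r x ! i))"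
    proof cases
      case 1
      then have "p = length x" using b unfolding scan_state_def by simp
      with 1 show ?thesis unfolding scan_state_def dense_part_def dense_def by auto
    qed (simp add: dense_part_def)
  qed simp
  show ?thesis unfolding scan_def
    by (intro runs_Write_Seq) (use loop' in simp_all)
qed

section \<open>The reduction\<close>

text \<open>Chosen to dominate the square of the number of vertices, i.e. the size of the adjacency
  matrix. It is a function of \<open>k\<close> times a power of \<open>L + 1\<close> whose degree
  depends on \<open>d\<close> only, as an fpt running time requires.\<close>

definition limit_value :: "nat \<Rightarrow> nat \<Rightarrow> nat \<Rightarrow> nat" where
  "limit_value d k L = (Suc k + d + 1) ^ (4 * Suc k + 2 * d + 8) * (L + 1) ^ (2 * d + 2)"

lemma graph_size_le:
  assumes "1 \<le> d"
  shows "graph_size d k L * graph_size d k L \<le> limit_value d k L"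
proof -
  let ?T = "Suc k + d + 1" and ?B = "Suc k"
  let ?P = "?T ^ (2 * ?B + d + 2) * (L + 1) ^ (d + 1)"
  have A: "tuples d k \<le> ?T ^ (d + 1)" unfolding tuples_def by (intro power_mono) auto
  have B: "?B \<le> ?T" by simp
  have B': "?B \<le> ?T ^ (d + 1)"
    using order_trans[OF B power_increasing[of 1 "d + 1" ?T, simplified power_one_right]] by simp
  have Q: "items d k L \<le> (L + 1) ^ (d + 1) * ?T ^ (2 * ?B)"
    unfolding items_def by (intro mult_le_mono2 power_mono) auto
  have "tuples d k + ?B \<le> 2 * ?T ^ (d + 1)" using A B' by simp
  also have "\<dots> \<le> ?T * ?T ^ (d + 1)" by (intro mult_right_mono) auto
  finally have AB: "tuples d k + ?B \<le> ?T ^ (d + 2)" by simp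
  have le: "?T ^ (d + 2) \<le> ?P"
  proof -
    have "?T ^ (d + 2) * 1 \<le> ?T ^ (2 * ?B + d + 2) * (L + 1) ^ (d + 1)"
      by (intro mult_le_mono power_increasing one_le_power) auto
    then show ?thesis by (simp only: mult_1_right)
  qed
  have "(tuples d k + ?B) * items d k L \<le> ?T ^ (d + 2) * ((L + 1) ^ (d + 1) * ?T ^ (2 * ?B))"
    using AB Q by (rule mult_le_mono)
  also have "\<dots> = ?P" by (simp only: power_add mult_ac)
  finally have 1: "(tuples d k + ?B) * items d k L \<le> ?P" .
  have "tuples d k * ?B \<le> ?T ^ (d + 1) * ?T" using A B by (rule mult_le_mono)
  moreover have "?T ^ (d + 2) = ?T ^ (d + 1) * ?T" by (simp only: power_add power_one_right power2_eq_square mult.assoc)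
  ultimately have 2: "tuples d k * ?B \<le> ?T ^ (d + 2)" by (simp only:)
  have "graph_size d k L \<le> 4 * ?P"
    unfolding graph_size_def slot_size_def using 1 2 AB le by linarith
  also have "\<dots> \<le> ?T ^ 2 * ?P"
  proof (rule mult_right_mono)
    \<comment> \<open>The four summands of the graph size are at most \<open>?P\<close> each, and
      the resulting factor \<open>4\<close> is absorbed by \<open>?T ^ 2\<close>.\<close>
    have "2 ^ 2 \<le> ?T ^ 2" by (intro power_mono) auto
    then show "4 \<le> ?T ^ 2" by simp
  qed simp
  finally have "graph_size d k L \<le> ?T ^ 2 * ?P" .
  from mult_le_mono[OF this this] have "graph_size d k L * graph_size d k L \<le> ?T ^ 2 * ?P * (?T ^ 2 * ?P)" .
  also have "\<dots> = limit_value d k L"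
  proof -
    have "4 * ?B + 2 * d + 8 = 2 + (2 * ?B + d + 2) + (2 + (2 * ?B + d + 2))" "2 * d + 2 = (d + 1) + (d + 1)"
      by simp_all
    then show ?thesis unfolding limit_value_def by (simp only: power_add mult_ac)
  qed
  finally show ?thesis .
qed

lemma limit_value_factors:
  "(Suc k + d + 1) ^ (4 * Suc k + 2 * d + 8) \<le> limit_value d k L" "(L + 1) ^ (2 * d + 2) \<le> limit_value d k L"
  "Suc k + d + 1 \<le> limit_value d k L" "4 * Suc k + 2 * d + 8 \<le> limit_value d k L" "L + 1 \<le> limit_value d k L"
  "2 * d + 2 \<le> limit_value d k L" "Suc k * L \<le> limit_value d k L"
proof -
  let ?T = "Suc k + d + 1" and ?p = "4 * Suc k + 2 * d + 8"
  have "?T ^ ?p * 1 \<le> limit_value d k L" unfolding limit_value_def by (intro mult_le_mono2 one_le_power) simp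
  then show 1: "?T ^ ?p \<le> limit_value d k L" by (simp only: mult_1_right)
  have "1 * (L + 1) ^ (2 * d + 2) \<le> limit_value d k L"
    unfolding limit_value_def by (intro mult_right_mono one_le_power) simp_all
  then show 2: "(L + 1) ^ (2 * d + 2) \<le> limit_value d k L" by (simp only: mult_1)
  have T: "?T \<le> ?T ^ ?p" using power_increasing[of 1 ?p ?T] by (simp only: power_one_right)
  then show "?T \<le> limit_value d k L" using 1 by (rule order_trans)
  have "?p < 2 ^ ?p" by (rule less_exp)
  also have "(2 :: nat) ^ ?p \<le> ?T ^ ?p" by (intro power_mono) auto
  finally show p: "?p \<le> limit_value d k L" using 1 by linarith
  then show "2 * d + 2 \<le> limit_value d k L" by linarith
  have L: "L + 1 \<le> (L + 1) ^ (2 * d + 2)"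
    using power_increasing[of 1 "2 * d + 2" "L + 1"] by (simp only: power_one_right)
  then show "L + 1 \<le> limit_value d k L" using 2 by (rule order_trans)
  have "Suc k * L \<le> ?T ^ ?p * (L + 1) ^ (2 * d + 2)"
    by (rule mult_le_mono) (use T L in linarith)+
  then show "Suc k * L \<le> limit_value d k L" unfolding limit_value_def .
qed

text \<open>The limit itself is computed before cell \<open>0\<close> of \<open>w\<close> is filled,
  so its arithmetic cannot be capped by that cell as \<open>mul\<close> and \<open>pow\<close>
  are.\<close>

definition Times :: "ex \<Rightarrow> ex \<Rightarrow> ex" where
  "Times a b = Iter a (Num 0) (Plus (Var 0) (lift 0 (lift 0 b)))"

definition Power :: "ex \<Rightarrow> ex \<Rightarrow> ex" where
  "Power a b = Iter b (Num 1) (Iter (lift 0 (lift 0 a)) (Num 0) (Plus (Var 0) (Var 2)))"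

lemma ev_Times [simp]: "ev w \<rho> (Times a b) = ev w \<rho> a * ev w \<rho> b"
proof -
  have "rec_nat 0 (\<lambda>i x. x + c) n = n * c" for c n :: nat by (induction n) auto
  then show ?thesis by (simp add: Times_def)
qed

lemma iter_le_Times [simp]:
  "iter_le N w \<rho> (Times a b) \<longleftrightarrow> iter_le N w \<rho> a \<and> iter_le N w \<rho> b \<and> ev w \<rho> a \<le> N"
  by (auto simp: Times_def)

lemma ev_Power [simp]: "ev w \<rho> (Power a b) = ev w \<rho> a ^ ev w \<rho> b"
proof -
  have times: "rec_nat 0 (\<lambda>i x. x + c) n = n * c" for c n :: nat by (induction n) auto
  have "rec_nat (Suc 0) (\<lambda>i x. c * x) n = c ^ n" for c n :: nat by (induction n) auto
  then show ?thesis by (simp add: Power_def times)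
qed

lemma iter_le_Power [simp]:
  "iter_le N w \<rho> a \<Longrightarrow> iter_le N w \<rho> b \<Longrightarrow> ev w \<rho> a \<le> N \<Longrightarrow> ev w \<rho> b \<le> N \<Longrightarrow> iter_le N w \<rho> (Power a b)"
  by (simp add: Power_def)

definition limit_base :: "nat \<Rightarrow> ex" where
  "limit_base d = Power (Plus (Inp (Num 2)) (Num (d + 1)))
    (Plus (Times (Num 4) (Inp (Num 2))) (Num (2 * d + 8)))"

definition limit_ex :: "nat \<Rightarrow> ex" where
  "limit_ex d = Times (limit_base d) (Power (Plus (Inp (Num 1)) (Num 1)) (Num (2 * d + 2)))"

lemma limit_ex:
  assumes "w 1 = L" "w 2 = Suc k"
  shows "ev w \<rho> (limit_ex d) = limit_value d k L" "iter_le (limit_value d k L) w \<rho> (limit_ex d)"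
proof -
  note le = limit_value_factors[where d = d and k = k and L = L]
  show "ev w \<rho> (limit_ex d) = limit_value d k L"
    using assms by (simp add: limit_ex_def limit_base_def limit_value_def del: power_Suc)
  have "4 \<le> limit_value d k L" using le(4) by simp
  with le assms show "iter_le (limit_value d k L) w \<rho> (limit_ex d)"
    unfolding limit_ex_def limit_base_def by (simp del: power_Suc)
qed

section \<open>Output in blocks of numbers\<close>

fun emit_blocks :: "(ex \<times> ex) list \<Rightarrow> com" where
  "emit_blocks [] = Skip"
| "emit_blocks ((c, e) # bs) = Seq (emit_block c e) (emit_blocks bs)"

fun blocks_time :: "nat \<Rightarrow> (ex \<times> ex) list \<Rightarrow> nat" where
  "blocks_time N [] = 1"
| "blocks_time N ((c, e) # bs) = block_time N c e + blocks_time N bs"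

type_synonym block = "((nat \<Rightarrow> nat) \<Rightarrow> nat) \<times> ((nat \<Rightarrow> nat) \<Rightarrow> nat \<Rightarrow> nat)"

definition block_numbers :: "(nat \<Rightarrow> nat) \<Rightarrow> block \<Rightarrow> nat list" where
  "block_numbers w = (\<lambda>(cf, ef). map (ef w) [0..<cf w])"

definition computes_block :: "ex \<times> ex \<Rightarrow> block \<Rightarrow> bool" where
  "computes_block = (\<lambda>(c, e) (cf, ef). \<forall>w \<rho>. ev w \<rho> c = cf w \<and> iter_le (w 0) w \<rho> c \<and>
     ev w \<rho> e = ef w (\<rho> 0) \<and> iter_le (w 0) w \<rho> e)"

lemma runs_emit_blocks:
  assumes "list_all2 computes_block bs fs" "written s out" "s ''w'' = w"
    "\<And>cf ef. (cf, ef) \<in> set fs \<Longrightarrow> cf w \<le> w 0 \<and> (\<forall>j<cf w. ef w j \<le> w 0)"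
  shows "runs (emit_blocks bs) s (blocks_time (w 0) bs)
    (\<lambda>s'. written s' (out @ encode_nats (concat (map (block_numbers w) fs))) \<and>
      (\<forall>a. a \<notin> scratch_names \<longrightarrow> s' a = s a))"
  using assms
proof (induction bs fs arbitrary: s out rule: list_all2_induct)
  case Nil
  then show ?case by (auto intro: runs_Skip)
next
  case (Cons b bs f fs)
  obtain c e cf ef where bf: "b = (c, e)" "f = (cf, ef)" by (cases b, cases f) auto
  have b: "ev w \<rho> c = cf w" "iter_le (w 0) w \<rho> c" "ev w \<rho> e = ef w (\<rho> 0)" "iter_le (w 0) w \<rho> e" for \<rho>
    using Cons.hyps(1) by (auto simp: bf computes_block_def)
  have le: "cf w \<le> w 0" "\<And>j. j < cf w \<Longrightarrow> ef w j \<le> w 0" using Cons.prems(3)[of cf ef] bf by auto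
  note head = runs_emit_block[OF Cons.prems(1,2) b le]
  show ?case unfolding bf emit_blocks.simps blocks_time.simps
  proof (rule runs_Seq, rule runs_mono[OF head order_refl])
    fix s1 assume s1: "written s1 (out @ encode_nats (map (ef w) [0..<cf w])) \<and>
      (\<forall>a. a \<notin> scratch_names \<longrightarrow> s1 a = s a)"
    have "s1 ''w'' = w" using s1 Cons.prems(2) by simp
    from Cons.IH[OF conjunct1[OF s1] this] Cons.prems(3)
    have "runs (emit_blocks bs) s1 (blocks_time (w 0) bs)
      (\<lambda>s'. written s' ((out @ encode_nats (map (ef w) [0..<cf w])) @
        encode_nats (concat (map (block_numbers w) fs))) \<and> (\<forall>a. a \<notin> scratch_names \<longrightarrow> s' a = s1 a))"
      by auto
    then show "runs (emit_blocks bs) s1 (blocks_time (w 0) bs)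
      (\<lambda>s'. written s' (out @ encode_nats (concat (map (block_numbers w) ((cf, ef) # fs)))) \<and>
        (\<forall>a. a \<notin> scratch_names \<longrightarrow> s' a = s a))"
    proof (rule runs_mono[OF _ order_refl])
      fix s' assume "written s' ((out @ encode_nats (map (ef w) [0..<cf w])) @
        encode_nats (concat (map (block_numbers w) fs))) \<and> (\<forall>a. a \<notin> scratch_names \<longrightarrow> s' a = s1 a)"
      then show "written s' (out @ encode_nats (concat (map (block_numbers w) ((cf, ef) # fs)))) \<and>
        (\<forall>a. a \<notin> scratch_names \<longrightarrow> s' a = s a)"
        using s1 by (simp add: block_numbers_def)
    qed
  qed
qed

lemma blocks_exist:
  assumes "\<And>cf ef. (cf, ef) \<in> set fs \<Longrightarrow> definable (\<lambda>w \<rho>. cf w) \<and> definable (\<lambda>w \<rho>. ef w (\<rho> 0))"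
  shows "\<exists>bs. list_all2 computes_block bs fs"
  using assms
proof (induction fs)
  case (Cons f fs)
  obtain cf ef where f: "f = (cf, ef)" by (cases f)
  have "definable (\<lambda>w \<rho>. cf w)" "definable (\<lambda>w \<rho>. ef w (\<rho> 0))" using Cons.prems f by auto
  then obtain c e where "\<And>w \<rho>. ev w \<rho> c = cf w \<and> iter_le (w 0) w \<rho> c"
    "\<And>w \<rho>. ev w \<rho> e = ef w (\<rho> 0) \<and> iter_le (w 0) w \<rho> e"
    unfolding definable_def by blast
  then have "computes_block (c, e) f" unfolding f computes_block_def by simp
  moreover obtain bs where "list_all2 computes_block bs fs" using Cons by auto
  ultimately show ?case by (intro exI[of _ "(c, e) # bs"]) simp
qed simp

text \<open>The parts of \<open>encode_ldtm\<close> in order, each as a count and a function of the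
  index. The matrix is flattened: entry \<open>j\<close> belongs to row \<open>j div n\<close> and
  column \<open>j mod n\<close>.\<close>

definition ldtm_blocks :: "nat \<Rightarrow> block list" where
  "ldtm_blocks d =
     [(\<lambda>w. 1, \<lambda>w j. size_at d w),
      (\<lambda>w. mul w (size_at d w) (size_at d w),
       \<lambda>w j. of_bool (adjacent_at d w (items_at d w) (pairs_at d w) (quot w j (size_at d w)) (rest w j (size_at d w)))),
      (\<lambda>w. 1, \<lambda>w j. items_at d w + pairs_at d w),
      (\<lambda>w. items_at d w + pairs_at d w, \<lambda>w j. j),
      (\<lambda>w. items_at d w + pairs_at d w, \<lambda>w j. if j < items_at d w then j else j + pairs_at d w),
      (\<lambda>w. 1, \<lambda>w j. 2 * (left_slots d w + w 2) + pairs_at d w)]"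

lemma ldtm_blocks_exist: "\<exists>bs. list_all2 computes_block bs (ldtm_blocks d)"
proof (rule blocks_exist)
  fix cf ef assume "(cf, ef) \<in> set (ldtm_blocks d)"
  then show "definable (\<lambda>w \<rho>. cf w) \<and> definable (\<lambda>w \<rho>. ef w (\<rho> 0))"
    unfolding ldtm_blocks_def by (auto intro!: definable_intros)
qed

text \<open>The new parameter: the length bound \<open>2 * (A + B) + A * B\<close> plus the
  \<open>A + B\<close> buffers, where \<open>A\<close> and \<open>B\<close> count the left and right
  slots.\<close>

lemma definable_parameter: "definable (\<lambda>w \<rho>. 3 * (left_slots d w + w 2) + pairs_at d w)"
proof -
  have "definable (\<lambda>w \<rho>. (left_slots d w + w 2) + 2 * (left_slots d w + w 2) + pairs_at d w)"
    by (intro definable_intros)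
  then show ?thesis by (simp add: algebra_simps)
qed

lemma concat_matrix:
  assumes "0 < n"
  shows "map (\<lambda>j. f (j div n) (j mod n)) [0..<m * n] = concat (map (\<lambda>u. map (f u) [0..<n]) [0..<m])"
proof (induction m)
  case (Suc m)
  have "map (\<lambda>j. f (j div n) (j mod n)) [m * n..<m * n + n] = map (f m) [0..<n]"
    using assms by (auto intro!: nth_equalityI)
  then show ?case using Suc upt_add_eq_append[of 0 "m * n" n] by (simp add: add.commute)
qed simp

section \<open>The emitted instance\<close>

context sized_input
begin

abbreviation "C \<equiv> \<lambda>\<sigma> p \<tau> q. valid_input d w \<and> compatible_at d w \<sigma> p \<tau> q"

sublocale slots A "Suc k" Q C
  by unfold_locales simp_all

lemma n_eq: "n = graph_size d k L"
  by (simp add: n_def m_def k_def graph_size_def slot_size_def)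

lemma ldtm_numbers:
  assumes "graph_size d k L * graph_size d k L \<le> w 0"
  shows "encode_nats (concat (map (block_numbers w) (ldtm_blocks d))) =
    encode_ldtm D S T (2 * (A + Suc k) + A * Suc k)"
proof -
  have n0: "0 < n" by (simp add: n_def)
  have "map (\<lambda>j. of_bool (adjacent_at d w (items_at d w) (pairs_at d w) (quot w j n) (rest w j n)) :: nat)
      [0..<n * n] = map (\<lambda>j. of_bool ((j div n, j mod n) \<in> parcs D)) [0..<n * n]"
  proof (rule map_cong[OF refl])
    fix j assume "j \<in> set [0..<n * n]"
    then have j: "j \<le> w 0" "j div n < n" "j mod n < n"
      using assms n0 by (auto simp: n_eq[symmetric] less_mult_imp_div_less)
    have "(j div n, j mod n) \<in> parcs D \<longleftrightarrow> slot_adj A (Suc k) Q C (j div n) (j mod n)"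
      using j unfolding slot_digraph_def by (simp add: n_eq graph_size_def)
    then show "of_bool (adjacent_at d w (items_at d w) (pairs_at d w) (quot w j n) (rest w j n)) =
        (of_bool ((j div n, j mod n) \<in> parcs D) :: nat)"
      using adjacent_at[of "j div n" "j mod n"] j n0 by (simp add: totals quot_eq rest_eq n_eq)
  qed
  also have "\<dots> = concat (map (\<lambda>u. map (\<lambda>v. of_bool ((u, v) \<in> parcs D)) [0..<n]) [0..<n])"
    using n0 by (rule concat_matrix[of n "\<lambda>u v. of_bool ((u, v) \<in> parcs D)" n])
  finally have matrix: "map (\<lambda>j. of_bool (adjacent_at d w (items_at d w) (pairs_at d w) (quot w j n) (rest w j n)) :: nat)
      [0..<n * n] = concat (map (\<lambda>u. map (\<lambda>v. of_bool ((u, v) \<in> parcs D)) [0..<n]) [0..<n])" .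
  have "n \<le> w 0" using size_le by (simp add: n_eq)
  then have "mul w n n = n * n" by (rule mul_eq)
  moreover define M P where "M = items_at d w" and "P = pairs_at d w"
  have S_eq: "S = [0..<M + P]" and T_eq: "T = map (\<lambda>i. if i < M then i else i + P) [0..<M + P]"
    unfolding M_def P_def totals slot_start_def slot_target_def by simp_all
  have "size_at d w = n" "2 * (A + Suc k) + A * Suc k = 2 * (left_slots d w + w 2) + P"
    by (simp_all only: P_def totals n_eq left_slots w2)
  ultimately have "concat (map (block_numbers w) (ldtm_blocks d)) =
      [n] @ concat (map (\<lambda>u. map (\<lambda>v. of_bool ((u, v) \<in> parcs D)) [0..<n]) [0..<n]) @ [length S] @ S @ T @
      [2 * (A + Suc k) + A * Suc k]"
    using matrix unfolding ldtm_blocks_def S_eq T_eq M_def[symmetric] P_def[symmetric]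
    by (simp add: block_numbers_def M_def[symmetric] P_def[symmetric])
  then show ?thesis unfolding encode_ldtm_def Let_def by simp
qed

lemma ldtm_bounds:
  assumes "graph_size d k L * graph_size d k L \<le> w 0" "(cf, ef) \<in> set (ldtm_blocks d)"
  shows "cf w \<le> w 0 \<and> (\<forall>j<cf w. ef w j \<le> w 0)"
proof -
  have size: "size_at d w \<le> w 0" "mul w (size_at d w) (size_at d w) \<le> w 0" "1 \<le> w 0"
    using assms(1) size_le limits(6) by (simp_all add: totals mul_eq)
  have "items_at d w + (pairs_at d w + pairs_at d w) + (left_slots d w + w 2) \<le> w 0"
    using size(1) by (simp add: size_at_def)
  \<comment> \<open>Every slot has an item, so the second copy of the slots in the length bound is
    covered by the items in the graph size.\<close>
  moreover have "left_slots d w + w 2 \<le> items_at d w"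
    unfolding totals left_slots w2 using mult_le_mono2[of 1 Q "A + Suc k"] by (simp add: Suc_leI)
  ultimately show ?thesis using assms(2) size unfolding ldtm_blocks_def by (auto simp: of_bool_def)
qed

text \<open>Membership only asserts that some instance has this encoding; injectivity identifies it
  with the constructed one.\<close>

lemma ldtm_instance_iff:
  "(encode_ldtm D S T (2 * (A + Suc k) + A * Suc k), 3 * (A + Suc k) + A * Suc k) \<in> LDTM \<longleftrightarrow>
   (x, k) \<in> WSAT_Gamma1 d"
proof -
  let ?l = "2 * (A + Suc k) + A * Suc k"
  have "ldtm_yes D S T ?l \<longleftrightarrow> fillable A (Suc k) Q C"
    using fillable_if_yes yes_if_fillable by blast
  moreover have "(encode_ldtm D S T ?l, 3 * (A + Suc k) + A * Suc k) \<in> LDTM \<longleftrightarrow> ldtm_yes D S T ?l"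
  proof
    assume "(encode_ldtm D S T ?l, 3 * (A + Suc k) + A * Suc k) \<in> LDTM"
    then obtain D' S' T' l' n' where *: "encode_ldtm D S T ?l = encode_ldtm D' S' T' l'"
      "pverts D' = {0..<n'}" "ldtm_instance D' S' T'" "ldtm_yes D' S' T' l'"
      unfolding LDTM_def by blast
    have "D = D' \<and> S = S' \<and> T = T' \<and> ?l = l'"
      by (rule encode_ldtm_inject[OF pair_digraph_D verts_D _ *(2) _ _ *(1)])
        (use *(3) instance_D in \<open>simp_all add: ldtm_instance_def\<close>)
    with *(4) show "ldtm_yes D S T ?l" by simp
  next
    assume "ldtm_yes D S T ?l"
    moreover have "3 * (A + Suc k) + A * Suc k = ?l + free_count D S T"
      unfolding free_count_D by simp
    ultimately show "(encode_ldtm D S T ?l, 3 * (A + Suc k) + A * Suc k) \<in> LDTM"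
      unfolding LDTM_def using instance_D verts_D by blast
  qed
  ultimately show ?thesis using fillable_iff by simp
qed

end

definition reduction :: "nat \<Rightarrow> (ex \<times> ex) list \<Rightarrow> ex \<Rightarrow> com" where
  "reduction d bs e =
     Seq (scan (2 * d + 3))
    (Seq (Write ''w'' (Const 1) (scalar ''len''))
    (Seq (Write ''w'' (Const 2) (Add (scalar ''par'') (Const 1)))
    (Seq (compile (limit_ex d) (\<lambda>_. 0) 1)
    (Seq (Write ''w'' (Const 0) (V 1))
    (Seq (Write ''o'' (Const 0) (Const 0))
    (Seq (emit_blocks bs)
    (Seq (Write ''len'' (Const 0) (scalar ''o''))
    (Seq (compile e (\<lambda>_. 0) 1)
         (Write ''par'' (Const 0) (V 1))))))))))"

definition reduction_time :: "nat \<Rightarrow> (ex \<times> ex) list \<Rightarrow> ex \<Rightarrow> nat \<Rightarrow> nat" where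
  "reduction_time d bs e N = 4 + (6 + (time N (limit_ex d) + (4 + (3 + (blocks_time N bs + (4 + (time N e + 4)))))))"

text \<open>The start is any store that holds the instance, since another program has run before and
  may have left garbage in the other arrays.\<close>

lemma runs_reduction:
  assumes inst: "holds_instance s x k" and d: "1 \<le> d"
    and bs: "list_all2 computes_block bs (ldtm_blocks d)"
    and e: "\<And>w \<rho>. ev w \<rho> e = 3 * (left_slots d w + w 2) + pairs_at d w"
      "\<And>w \<rho>. iter_le (w 0) w \<rho> e"
    and r: "r = 2 * d + 3" and N: "N = limit_value d k (length (dense_part r x))"
  shows "runs (reduction d bs e) s (6 + (r * (trues x + 1) + 1) * 48 + reduction_time d bs e N)
    (\<lambda>s'. \<exists>x'. holds_instance s' x' (3 * (tuples d k + Suc k) + tuples d k * Suc k) \<and>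
      ((x', 3 * (tuples d k + Suc k) + tuples d k * Suc k) \<in> LDTM \<longleftrightarrow> (x, k) \<in> WSAT_Gamma1 d))"
proof -
  let ?x = "dense_part r x" and ?k = "3 * (tuples d k + Suc k) + tuples d k * Suc k"
  let ?Q = "\<lambda>s'. \<exists>x'. holds_instance s' x' ?k \<and> ((x', ?k) \<in> LDTM \<longleftrightarrow> (x, k) \<in> WSAT_Gamma1 d)"
  have scan: "runs (scan (2 * d + 3)) s (6 + (r * (trues x + 1) + 1) * 48) (\<lambda>s'. s' ''par'' 0 = k \<and>
    s' ''len'' 0 = length ?x \<and> (\<forall>i<length ?x. s' ''w'' (i + 3) = of_bool (?x ! i)))"
    unfolding r by (rule runs_scan[OF inst]) simp
  show ?thesis unfolding reduction_def reduction_time_def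
  proof (rule runs_Seq, rule runs_mono[OF scan order_refl], rule runs_Seq, rule runs_Write, rule runs_Seq, rule runs_Write, rule runs_Seq)
    fix s1 assume s1: "s1 ''par'' 0 = k \<and> s1 ''len'' 0 = length ?x \<and>
      (\<forall>i<length ?x. s1 ''w'' (i + 3) = of_bool (?x ! i))"
    let ?s2 = "s1(''w'' := (s1 ''w'')(aval (Const 1) s1 := aval (scalar ''len'') s1))"
    let ?s3 = "?s2(''w'' := (?s2 ''w'')(aval (Const 2) ?s2 := aval (Add (scalar ''par'') (Const 1)) ?s2))"
    have w3: "?s3 ''w'' 1 = length ?x" "?s3 ''w'' 2 = Suc k" "?s3 ''w'' (i + 3) = s1 ''w'' (i + 3)" for i
      using s1 by simp_all
    have c: "runs (compile (limit_ex d) (\<lambda>_. 0) 1) ?s3 (time N (limit_ex d))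
      (\<lambda>s'. s' ''v'' 1 = N \<and> (\<forall>a. a \<noteq> ''v'' \<longrightarrow> s' a = ?s3 a))"
    proof -
      define u where "u = ?s3 ''w''"
      note lim = limit_ex[where d = d, OF w3(1,2), folded u_def N]
      show ?thesis
        by (rule runs_mono[OF runs_compile[where w = u and \<rho> = "\<lambda>_. ?s3 ''v'' 0", OF _ _ lim(2)]])
          (simp_all add: lim(1) u_def[symmetric], simp add: u_def)
    qed
    show "runs (compile (limit_ex d) (\<lambda>_. 0) 1) ?s3 (time N (limit_ex d)) (\<lambda>s'. runs (Seq (Write ''w'' (Const 0) (V 1))
      (Seq (Write ''o'' (Const 0) (Const 0)) (Seq (emit_blocks bs)
      (Seq (Write ''len'' (Const 0) (scalar ''o'')) (Seq (compile e (\<lambda>_. 0) 1) (Write ''par'' (Const 0) (V 1))))))) s'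
      (4 + (3 + (blocks_time N bs + (4 + (time N e + 4))))) ?Q)"
    proof (rule runs_mono[OF c order_refl], rule runs_Seq, rule runs_Write, rule runs_Seq, rule runs_Write, rule runs_Seq)
      fix s4 assume s4: "s4 ''v'' 1 = N \<and> (\<forall>a. a \<noteq> ''v'' \<longrightarrow> s4 a = ?s3 a)"
      let ?s5 = "s4(''w'' := (s4 ''w'')(aval (Const 0) s4 := aval (V 1) s4))"
      let ?s6 = "?s5(''o'' := (?s5 ''o'')(aval (Const 0) ?s5 := aval (Const 0) ?s5))"
      define w where "w = ?s6 ''w''"
      have w: "w 0 = N" "w 1 = length ?x" "w 2 = Suc k" "\<And>i. i < length ?x \<Longrightarrow> w (i + 3) = of_bool (?x ! i)"
        using s4 s1 by (simp_all add: w_def)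
      have size: "graph_size d k (length ?x) * graph_size d k (length ?x) \<le> w 0"
        unfolding w(1) N by (rule graph_size_le[OF d])
      interpret sized_input w ?x d k
      proof
        note le = limit_value_factors[where d = d and k = k and L = "length ?x", folded N]
        show "length ?x \<le> w 0" using le(5) w(1) by simp
        show "Suc k * length ?x \<le> w 0" using le(7) w(1) by simp
        show "graph_size d k (length ?x) \<le> w 0"
          using size by (meson le_square order_trans)
      qed (use w d in auto)
      have out: "runs (emit_blocks bs) ?s6 (blocks_time N bs)
        (\<lambda>s'. written s' (encode_ldtm D S T (2 * (A + Suc k) + A * Suc k)) \<and>
          (\<forall>a. a \<notin> scratch_names \<longrightarrow> s' a = ?s6 a))"
      proof -
        have "written ?s6 []" by (simp add: written_def)
        moreover have "?s6 ''w'' = w" by (rule w_def[symmetric])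
        ultimately have "runs (emit_blocks bs) ?s6 (blocks_time (w 0) bs)
          (\<lambda>s'. written s' ([] @ encode_nats (concat (map (block_numbers w) (ldtm_blocks d)))) \<and>
            (\<forall>a. a \<notin> scratch_names \<longrightarrow> s' a = ?s6 a))"
          by (rule runs_emit_blocks[OF bs]) (rule ldtm_bounds[OF size])
        then show ?thesis unfolding ldtm_numbers[OF size] w(1) append_Nil .
      qed
      let ?out = "encode_ldtm D S T (2 * (A + Suc k) + A * Suc k)"
      show "runs (emit_blocks bs) ?s6 (blocks_time N bs) (\<lambda>s'. runs (Seq (Write ''len'' (Const 0) (scalar ''o''))
        (Seq (compile e (\<lambda>_. 0) 1) (Write ''par'' (Const 0) (V 1)))) s' (4 + (time N e + 4)) ?Q)"
      proof (rule runs_mono[OF out order_refl], rule runs_Seq, rule runs_Write, rule runs_Seq)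
        fix s7 assume s7: "written s7 ?out \<and> (\<forall>a. a \<notin> scratch_names \<longrightarrow> s7 a = ?s6 a)"
        let ?s8 = "s7(''len'' := (s7 ''len'')(aval (Const 0) s7 := aval (scalar ''o'') s7))"
        have "?s8 ''w'' = w" using s7 by (simp add: w_def)
        then have c: "runs (compile e (\<lambda>_. 0) 1) ?s8 (time N e)
          (\<lambda>s'. s' ''v'' 1 = ?k \<and> (\<forall>a. a \<noteq> ''v'' \<longrightarrow> s' a = ?s8 a))"
          by (intro runs_mono[OF runs_compile[where w = w and \<rho> = "\<lambda>_. ?s8 ''v'' 0"]])
            (use e[of w] w(1) in \<open>auto simp: left_slots totals w2\<close>)
        show "runs (compile e (\<lambda>_. 0) 1) ?s8 (time N e) (\<lambda>s'. runs (Write ''par'' (Const 0) (V 1)) s' 4 ?Q)"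
        proof (rule runs_mono[OF c order_refl], rule runs_Write)
          fix s9 assume s9: "s9 ''v'' 1 = ?k \<and> (\<forall>a. a \<noteq> ''v'' \<longrightarrow> s9 a = ?s8 a)"
          have "holds_instance (s9(''par'' := (s9 ''par'')(aval (Const 0) s9 := aval (V 1) s9))) ?out ?k"
            using s9 s7 by (simp add: holds_instance_def written_def)
          moreover have "(?out, ?k) \<in> LDTM \<longleftrightarrow> (x, k) \<in> WSAT_Gamma1 d"
            using ldtm_instance_iff WSAT_dense_part[of d x k] unfolding r by simp
          ultimately show "?Q (s9(''par'' := (s9 ''par'')(aval (Const 0) s9 := aval (V 1) s9)))" by blast
        qed simp
      qed simp
    qed simp_all
  qed simp_all
qed

section \<open>Closure properties of computable functions\<close>

primrec rename_aexp :: "(string \<Rightarrow> string) \<Rightarrow> aexp \<Rightarrow> aexp" where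
  "rename_aexp f (Const c) = Const c"
| "rename_aexp f (Read a e) = Read (f a) (rename_aexp f e)"
| "rename_aexp f (Add a b) = Add (rename_aexp f a) (rename_aexp f b)"
| "rename_aexp f (Sub a b) = Sub (rename_aexp f a) (rename_aexp f b)"
| "rename_aexp f (Half a) = Half (rename_aexp f a)"

primrec rename :: "(string \<Rightarrow> string) \<Rightarrow> com \<Rightarrow> com" where
  "rename f Skip = Skip"
| "rename f (Write a i e) = Write (f a) (rename_aexp f i) (rename_aexp f e)"
| "rename f (Seq p q) = Seq (rename f p) (rename f q)"
| "rename f (If b p q) = If (rename_aexp f b) (rename f p) (rename f q)"
| "rename f (While b p) = While (rename_aexp f b) (rename f p)"

lemma aval_rename: "\<forall>a. s1 (f a) = s a \<Longrightarrow> aval (rename_aexp f e) s1 = aval e s"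
  by (induction e) auto

lemma acost_rename [simp]: "acost (rename_aexp f e) = acost e"
  by (induction e) auto

lemma exec_rename:
  assumes "exec p s t s'" "inj f" "\<forall>a. s1 (f a) = s a"
  shows "\<exists>s1'. exec (rename f p) s1 t s1' \<and> (\<forall>a. s1' (f a) = s' a) \<and> (\<forall>b. b \<notin> range f \<longrightarrow> s1' b = s1 b)"
  using assms(1,3)
proof (induction arbitrary: s1 rule: exec.induct)
  case (Skip s)
  then show ?case using exec.Skip by auto
next
  case (Write a i e s)
  let ?s = "s1(f a := (s1 (f a))(aval (rename_aexp f i) s1 := aval (rename_aexp f e) s1))"
  have "exec (rename f (Write a i e)) s1 (1 + acost i + acost e) ?s"
    using exec.Write[of "f a" "rename_aexp f i" "rename_aexp f e" s1] by simp
  moreover have "?s (f b) = (s(a := (s a)(aval i s := aval e s))) b" for b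
    using Write.prems assms(2) by (simp add: aval_rename[of s1 f s, OF Write.prems] inj_eq)
  ultimately show ?case
    by (intro exI[of _ ?s] conjI allI impI) (assumption, assumption, auto)
next
  case (Seq c1 s t1 s' c2 t2 s'')
  from Seq.IH(1)[OF Seq.prems] obtain r where
    r: "exec (rename f c1) s1 t1 r" "\<forall>a. r (f a) = s' a" "\<forall>b. b \<notin> range f \<longrightarrow> r b = s1 b" by blast
  from Seq.IH(2)[OF r(2)] obtain r' where
    "exec (rename f c2) r t2 r'" "\<forall>a. r' (f a) = s'' a" "\<forall>b. b \<notin> range f \<longrightarrow> r' b = r b" by blast
  then show ?case using r exec.Seq[OF r(1)] by (intro exI[of _ r']) auto
next
  case (If_true b s c1 t s' c2)
  have "aval (rename_aexp f b) s1 \<noteq> 0" using If_true.hyps(1) by (simp add: aval_rename[of s1 f s, OF If_true.prems])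
  moreover from If_true.IH[OF If_true.prems] obtain r where
    r: "exec (rename f c1) s1 t r" "\<forall>a. r (f a) = s' a" "\<forall>b. b \<notin> range f \<longrightarrow> r b = s1 b" by blast
  ultimately show ?case using exec.If_true[of "rename_aexp f b" s1 "rename f c1" t r "rename f c2"]
    by (intro exI[of _ r]) simp
next
  case (If_false b s c2 t s' c1)
  have "aval (rename_aexp f b) s1 = 0" using If_false.hyps(1) by (simp add: aval_rename[of s1 f s, OF If_false.prems])
  moreover from If_false.IH[OF If_false.prems] obtain r where
    r: "exec (rename f c2) s1 t r" "\<forall>a. r (f a) = s' a" "\<forall>b. b \<notin> range f \<longrightarrow> r b = s1 b" by blast
  ultimately show ?case using exec.If_false[of "rename_aexp f b" s1 "rename f c2" t r "rename f c1"]
    by (intro exI[of _ r]) simp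
next
  case (While_false b s c)
  have "aval (rename_aexp f b) s1 = 0" using While_false.hyps(1) by (simp add: aval_rename[of s1 f s, OF While_false.prems])
  then show ?case using While_false.prems exec.While_false[of "rename_aexp f b" s1 "rename f c"]
    by (intro exI[of _ s1]) simp
next
  case (While_true b s c t1 s' t2 s'')
  have b: "aval (rename_aexp f b) s1 \<noteq> 0"
    using While_true.hyps(1) by (simp add: aval_rename[of s1 f s, OF While_true.prems])
  from While_true.IH(1)[OF While_true.prems] obtain r where
    r: "exec (rename f c) s1 t1 r" "\<forall>a. r (f a) = s' a" "\<forall>b. b \<notin> range f \<longrightarrow> r b = s1 b" by blast
  from While_true.IH(2)[OF r(2)] obtain r' where
    r': "exec (rename f (While b c)) r t2 r'" "\<forall>a. r' (f a) = s'' a" "\<forall>b. b \<notin> range f \<longrightarrow> r' b = r b"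
    by blast
  then show ?case
    using r(3) exec.While_true[OF b r(1) r'(1)[unfolded rename.simps]] by (intro exI[of _ r']) auto
qed

section \<open>Subroutine calls\<close>

definition terminates :: "com \<Rightarrow> store \<Rightarrow> (store \<Rightarrow> bool) \<Rightarrow> bool" where
  "terminates p s Q \<longleftrightarrow> (\<exists>t s'. exec p s t s' \<and> Q s')"

lemma terminates_Seq: "terminates p s (\<lambda>s'. terminates q s' Q) \<Longrightarrow> terminates (Seq p q) s Q"
  unfolding terminates_def using exec.Seq by meson

lemma terminates_Write: "Q (s(a := (s a)(aval i s := aval e s))) \<Longrightarrow> terminates (Write a i e) s Q"
  unfolding terminates_def using exec.Write by blast

lemma terminates_if_runs: "runs p s b Q \<Longrightarrow> (\<And>s'. Q s' \<Longrightarrow> Q' s') \<Longrightarrow> terminates p s Q'"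
  unfolding runs_def terminates_def by blast

text \<open>Prefixing all names with a fresh character gives the program a private memory. If that
  is all zero, writing the argument to its \<open>par\<close> produces a copy of the initial
  store.\<close>

lemma computable_renamed:
  assumes "computable f"
  shows "\<exists>p. \<forall>s e. (\<forall>a. s (z # a) = (\<lambda>_. 0)) \<longrightarrow>
    terminates (Seq (Write (z # ''par'') (Const 0) e) p) s
      (\<lambda>s'. s' (z # ''par'') 0 = f (aval e s) \<and> (\<forall>b. (\<forall>a. b \<noteq> z # a) \<longrightarrow> s' b = s b))"
proof -
  from assms obtain p where p: "\<And>n. \<exists>t s'. exec p (init_store [] n) t s' \<and> s' ''par'' 0 = f n"
    unfolding computable_def by blast
  have "terminates (Seq (Write (z # ''par'') (Const 0) e) (rename ((#) z) p)) s
      (\<lambda>s'. s' (z # ''par'') 0 = f (aval e s) \<and> (\<forall>b. (\<forall>a. b \<noteq> z # a) \<longrightarrow> s' b = s b))"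
    if "\<And>a. s (z # a) = (\<lambda>_. 0)" for s e
  proof (rule terminates_Seq, rule terminates_Write)
    let ?s = "s(z # ''par'' := (s (z # ''par''))(aval (Const 0) s := aval e s))"
    from p[of "aval e s"] obtain t s' where
      e: "exec p (init_store [] (aval e s)) t s'" "s' ''par'' 0 = f (aval e s)" by blast
    have "\<forall>a. ?s (z # a) = init_store [] (aval e s) a"
      using that by (auto simp: init_store_def fun_eq_iff)
    from exec_rename[where f = "(#) z" and ?s1.0 = ?s, OF e(1) _ this] obtain s1 where
      "exec (rename ((#) z) p) ?s t s1" "\<forall>a. s1 (z # a) = s' a" "\<forall>b. b \<notin> range ((#) z) \<longrightarrow> s1 b = ?s b"
      by auto
    then show "terminates (rename ((#) z) p) ?s
      (\<lambda>s'. s' (z # ''par'') 0 = f (aval e s) \<and> (\<forall>b. (\<forall>a. b \<noteq> z # a) \<longrightarrow> s' b = s b))"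
      unfolding terminates_def using e(2) by (intro exI[of _ t] exI[of _ s1]) auto
  qed
  then show ?thesis by blast
qed

lemma terminates_mono: "terminates p s Q \<Longrightarrow> (\<And>s'. Q s' \<Longrightarrow> Q' s') \<Longrightarrow> terminates p s Q'"
  unfolding terminates_def by blast

lemma computableI: "(\<And>n. terminates p (init_store [] n) (\<lambda>s'. s' ''par'' 0 = f n)) \<Longrightarrow> computable f"
  unfolding computable_def terminates_def by blast

lemma computable_id: "computable (\<lambda>k. k)"
  by (rule computableI[of Skip])
    (auto simp: terminates_def init_store_def intro!: exI exec.Skip)

text \<open>The prefixes \<open>A\<close> and \<open>B\<close> separate the two private memories
  from each other and from the remaining names.\<close>

lemma computable_comp:
  assumes "computable f" "computable g"
  shows "computable (\<lambda>k. f (g k))"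
proof -
  from computable_renamed[OF assms(2), where z = "CHR ''A''"] obtain p where
    p: "\<And>s e. (\<And>a. s (CHR ''A'' # a) = (\<lambda>_. 0)) \<Longrightarrow> terminates (Seq (Write ''Apar'' (Const 0) e) p) s
      (\<lambda>s'. s' ''Apar'' 0 = g (aval e s) \<and> (\<forall>b. (\<forall>a. b \<noteq> CHR ''A'' # a) \<longrightarrow> s' b = s b))" by blast
  from computable_renamed[OF assms(1), where z = "CHR ''B''"] obtain q where
    q: "\<And>s e. (\<And>a. s (CHR ''B'' # a) = (\<lambda>_. 0)) \<Longrightarrow> terminates (Seq (Write ''Bpar'' (Const 0) e) q) s
      (\<lambda>s'. s' ''Bpar'' 0 = f (aval e s) \<and> (\<forall>b. (\<forall>a. b \<noteq> CHR ''B'' # a) \<longrightarrow> s' b = s b))" by blast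
  show ?thesis
  proof (rule computableI)
    fix n
    let ?s = "init_store [] n"
    show "terminates (Seq (Seq (Write ''Apar'' (Const 0) (scalar ''par'')) p)
      (Seq (Seq (Write ''Bpar'' (Const 0) (scalar ''Apar'')) q) (Write ''par'' (Const 0) (scalar ''Bpar''))))
      ?s (\<lambda>s'. s' ''par'' 0 = f (g n))"
    proof (rule terminates_Seq, rule terminates_mono[OF p])
      show "?s (CHR ''A'' # a) = (\<lambda>_. 0)" for a by (simp add: init_store_def fun_eq_iff)
      fix s1 assume s1: "s1 ''Apar'' 0 = g (aval (scalar ''par'') ?s) \<and>
        (\<forall>b. (\<forall>a. b \<noteq> CHR ''A'' # a) \<longrightarrow> s1 b = ?s b)"
      show "terminates (Seq (Seq (Write ''Bpar'' (Const 0) (scalar ''Apar'')) q)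
        (Write ''par'' (Const 0) (scalar ''Bpar''))) s1 (\<lambda>s'. s' ''par'' 0 = f (g n))"
      proof (rule terminates_Seq, rule terminates_mono[OF q])
        show "s1 (CHR ''B'' # a) = (\<lambda>_. 0)" for a using s1 by (simp add: init_store_def fun_eq_iff)
      qed (use s1 in \<open>auto intro!: terminates_Write simp: init_store_def\<close>)
    qed
  qed
qed

text \<open>Reduces closure properties to writing an expression. The iteration limit only has to
  exist, as computability asks for termination and not for a time bound.\<close>

lemma computable_ex:
  assumes "computable f" "computable g" and N: "\<And>w \<rho>. \<exists>N. iter_le N w \<rho> e"
  shows "computable (\<lambda>k. ev ((\<lambda>_. 0)(0 := f k, 1 := g k)) (\<lambda>_. 0) e)"
proof -
  from computable_renamed[OF assms(1), where z = "CHR ''A''"] obtain p where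
    p: "\<And>s e. (\<And>a. s (CHR ''A'' # a) = (\<lambda>_. 0)) \<Longrightarrow> terminates (Seq (Write ''Apar'' (Const 0) e) p) s
      (\<lambda>s'. s' ''Apar'' 0 = f (aval e s) \<and> (\<forall>b. (\<forall>a. b \<noteq> CHR ''A'' # a) \<longrightarrow> s' b = s b))" by blast
  from computable_renamed[OF assms(2), where z = "CHR ''B''"] obtain q where
    q: "\<And>s e. (\<And>a. s (CHR ''B'' # a) = (\<lambda>_. 0)) \<Longrightarrow> terminates (Seq (Write ''Bpar'' (Const 0) e) q) s
      (\<lambda>s'. s' ''Bpar'' 0 = g (aval e s) \<and> (\<forall>b. (\<forall>a. b \<noteq> CHR ''B'' # a) \<longrightarrow> s' b = s b))" by blast
  show ?thesis
  proof (rule computableI)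
    fix n
    let ?s = "init_store [] n" and ?w = "(\<lambda>_. 0)(0 := f n, 1 := g n)"
    let ?Q = "\<lambda>s'. s' ''par'' 0 = ev ?w (\<lambda>_. 0) e"
    obtain M where M: "iter_le M ?w (\<lambda>_. 0) e" using N by blast
    show "terminates (Seq (Seq (Write ''Apar'' (Const 0) (scalar ''par'')) p)
      (Seq (Seq (Write ''Bpar'' (Const 0) (scalar ''par'')) q)
      (Seq (Write ''w'' (Const 0) (scalar ''Apar'')) (Seq (Write ''w'' (Const 1) (scalar ''Bpar''))
      (Seq (compile e (\<lambda>_. 0) 1) (Write ''par'' (Const 0) (V 1))))))) ?s ?Q"
    proof (rule terminates_Seq, rule terminates_mono[OF p])
      show "?s (CHR ''A'' # a) = (\<lambda>_. 0)" for a by (simp add: init_store_def fun_eq_iff)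
      fix s1 assume s1: "s1 ''Apar'' 0 = f (aval (scalar ''par'') ?s) \<and>
        (\<forall>b. (\<forall>a. b \<noteq> CHR ''A'' # a) \<longrightarrow> s1 b = ?s b)"
      then have par1: "s1 ''par'' 0 = n" by (simp add: init_store_def)
      show "terminates (Seq (Seq (Write ''Bpar'' (Const 0) (scalar ''par'')) q)
        (Seq (Write ''w'' (Const 0) (scalar ''Apar'')) (Seq (Write ''w'' (Const 1) (scalar ''Bpar''))
        (Seq (compile e (\<lambda>_. 0) 1) (Write ''par'' (Const 0) (V 1)))))) s1 ?Q"
      proof (rule terminates_Seq, rule terminates_mono[OF q])
        show "s1 (CHR ''B'' # a) = (\<lambda>_. 0)" for a using s1 by (simp add: init_store_def fun_eq_iff)
        fix s2 assume s2: "s2 ''Bpar'' 0 = g (aval (scalar ''par'') s1) \<and>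
          (\<forall>b. (\<forall>a. b \<noteq> CHR ''B'' # a) \<longrightarrow> s2 b = s1 b)"
        have v: "s2 ''Apar'' 0 = f n" "s2 ''Bpar'' 0 = g n" "s2 ''w'' = (\<lambda>_. 0)" "s2 ''v'' 0 = 0"
          using s1 s2 par1 by (simp_all add: init_store_def fun_eq_iff)
        show "terminates (Seq (Write ''w'' (Const 0) (scalar ''Apar'')) (Seq (Write ''w'' (Const 1) (scalar ''Bpar''))
          (Seq (compile e (\<lambda>_. 0) 1) (Write ''par'' (Const 0) (V 1))))) s2 ?Q"
        proof (rule terminates_Seq, rule terminates_Write, rule terminates_Seq, rule terminates_Write,
            rule terminates_Seq, rule terminates_if_runs[OF runs_compile[OF _ _ M]])
        qed (use v in \<open>auto intro!: terminates_Write simp: fun_eq_iff\<close>)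
      qed
    qed
  qed
qed

lemma computable_add:
  assumes "computable f" "computable g"
  shows "computable (\<lambda>k. f k + g k)"
  using computable_ex[OF assms, of "Plus (Inp (Num 0)) (Inp (Num 1))"] by simp

lemma computable_mult:
  assumes "computable f" "computable g"
  shows "computable (\<lambda>k. f k * g k)"
  using computable_ex[OF assms, of "Times (Inp (Num 0)) (Inp (Num 1))"] by (auto simp: fun_upd_def)

lemma computable_const: "computable (\<lambda>k. c)"
  using computable_ex[OF computable_id computable_id, of "Num c"] by simp

lemma computable_power_const: "computable f \<Longrightarrow> computable (\<lambda>k. f k ^ n)"
  by (induction n) (auto intro: computable_const computable_mult)

lemma computable_power:
  assumes "computable f" "computable g"
  shows "computable (\<lambda>k. f k ^ g k)"
proof -
  have "\<exists>N. iter_le N w \<rho> (Power (Inp (Num 0)) (Inp (Num 1)))" for w \<rho>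
    by (rule exI[of _ "w 0 + w 1"]) simp
  from computable_ex[OF assms this] show ?thesis by simp
qed

lemma computable_limit_value: "computable (\<lambda>k. limit_value d k 0)"
proof -
  have "limit_value d k 0 = (k + (d + 2)) ^ (4 * k + (2 * d + 12))" for k
    by (simp add: limit_value_def)
  then show ?thesis
    by (simp only:) (intro computable_power computable_add computable_mult computable_const computable_id)
qed

section \<open>Composition of the reductions\<close>

text \<open>A step changes at most one cell. So while the length announced by a program can be
  exponential in its running time, the number of ones it produces cannot.\<close>

lemma nonzero_cells:
  assumes "exec p s t s'" "finite {i. s a i \<noteq> 0}"
  shows "finite {i. s' a i \<noteq> 0} \<and> card {i. s' a i \<noteq> 0} \<le> card {i. s a i \<noteq> 0} + t"
  using assms
proof (induction rule: exec.induct)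
  case (Write b i e s)
  let ?s = "s(b := (s b)(aval i s := aval e s))"
  have sub: "{j. ?s a j \<noteq> 0} \<subseteq> insert (aval i s) {j. s a j \<noteq> 0}" by auto
  with Write have "finite {j. ?s a j \<noteq> 0}" by (meson finite_insert finite_subset)
  moreover have "card {j. ?s a j \<noteq> 0} \<le> card (insert (aval i s) {j. s a j \<noteq> 0})"
    using sub Write by (intro card_mono) auto
  then have "card {j. ?s a j \<noteq> 0} \<le> card {j. s a j \<noteq> 0} + 1"
    using card_insert_le_m1 card_insert_if[OF Write] by (metis Suc_eq_plus1 le_SucI)
  ultimately show ?case by simp
qed auto

lemma trues_le_nonzero:
  assumes "holds_instance s x k" "finite {i. s ''bits'' i \<noteq> 0}"
  shows "trues x \<le> card {i. s ''bits'' i \<noteq> 0}"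
proof -
  have "trues x = card {i. i < length x \<and> x ! i}" by (simp add: trues_def length_filter_conv_card)
  also have "\<dots> \<le> card {i. s ''bits'' i \<noteq> 0}"
    using assms by (intro card_mono) (auto simp: holds_instance_def)
  finally show ?thesis .
qed

lemma limit_value_mono:
  assumes "k \<le> k'" "L \<le> L'"
  shows "limit_value d k L \<le> limit_value d k' L'"
proof -
  have "(Suc k + d + 1) ^ (4 * Suc k + 2 * d + 8) \<le> (Suc k' + d + 1) ^ (4 * Suc k + 2 * d + 8)"
    using assms by (intro power_mono) auto
  also have "\<dots> \<le> (Suc k' + d + 1) ^ (4 * Suc k' + 2 * d + 8)"
    using assms by (intro power_increasing) auto
  finally show ?thesis unfolding limit_value_def
    using assms by (intro mult_le_mono power_mono) auto
qed

lemma limit_value_split: "limit_value d k L = limit_value d k 0 * (L + 1) ^ (2 * d + 2)"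
  by (simp add: limit_value_def)

lemma parameter_le:
  assumes "1 \<le> d"
  shows "3 * (tuples d k + Suc k) + tuples d k * Suc k \<le> limit_value d k 0"
proof -
  let ?n = "graph_size d k 0" and ?Q = "items d k 0"
  \<comment> \<open>At least two items per slot are needed, as twice the number of slots has to fit
    into the item vertices.\<close>
  have "2 ^ 1 \<le> (Suc k + d) ^ 1" using assms by simp
  also have "\<dots> \<le> (Suc k + d) ^ (2 * Suc k)" by (intro power_increasing) auto
  finally have "2 \<le> ?Q" by (simp add: items_def)
  then have "(tuples d k + Suc k) * 2 \<le> (tuples d k + Suc k) * ?Q" by (rule mult_le_mono2)
  then have "3 * (tuples d k + Suc k) + tuples d k * Suc k \<le> ?n"
    unfolding graph_size_def slot_size_def by (simp add: algebra_simps)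
  also have "\<dots> \<le> ?n * ?n" by (rule le_square)
  also have "\<dots> \<le> limit_value d k 0" by (rule graph_size_le[OF assms])
  finally show ?thesis .
qed

lemma poly_bound_reduction_time: "\<exists>K q. \<forall>N. reduction_time d bs e N \<le> K * (N + 1) ^ q"
proof -
  have "\<exists>K q. \<forall>N. blocks_time N bs \<le> K * (N + 1) ^ q" for bs
    by (induction bs rule: emit_blocks.induct; unfold blocks_time.simps block_time_def;
        (assumption | rule poly_bound_add poly_bound_mult poly_bound_Suc poly_bound_const time_poly)+)
  then show ?thesis unfolding reduction_time_def
    by (intro poly_bound_add poly_bound_const time_poly)
qed

text \<open>The programs are composed directly. The second one works on the dense part of the
  intermediate instance, whose length is linear in the ones, and these number at most
  \<open>length x + t1\<close>.\<close>

lemma fpt_reducible_LDTM: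
  assumes d: "1 \<le> d" and A: "A \<le>\<^sub>f\<^sub>p\<^sub>t WSAT_Gamma1 d"
  shows "A \<le>\<^sub>f\<^sub>p\<^sub>t LDTM"
proof -
  from A obtain p f g c where comp: "computable f" "computable g" and
    p: "\<And>x k. \<exists>x' k' t s'. exec p (init_store x k) t s' \<and> holds_instance s' x' k' \<and>
      t \<le> f k * (length x + 1) ^ c \<and> k' \<le> g k \<and> ((x, k) \<in> A \<longleftrightarrow> (x', k') \<in> WSAT_Gamma1 d)"
    unfolding fpt_reducible_def by blast
  obtain bs where bs: "list_all2 computes_block bs (ldtm_blocks d)" using ldtm_blocks_exist by blast
  obtain e where e: "\<And>w \<rho>. ev w \<rho> e = 3 * (left_slots d w + w 2) + pairs_at d w"
    "\<And>w \<rho>. iter_le (w 0) w \<rho> e"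
    using definable_parameter[of d] unfolding definable_def by blast
  obtain K q where K: "\<And>N. reduction_time d bs e N \<le> K * (N + 1) ^ q"
    using poly_bound_reduction_time by blast
  define r where "r = 2 * d + 3"
  define E where "E k = limit_value d (g k) 0" for k
  define h where "h = 2 * d + 2"
  \<comment> \<open>The first summand pays for the first program and the scan, with
    \<open>96 * r\<close> from two times \<open>48 * r\<close>; the second pays for the rest of the
    reduction.\<close>
  define F where "F k = (7 + 96 * r) * (f k + 1) + K * (2 * E k * (2 * r * (f k + 1)) ^ h) ^ q" for k
  \<comment> \<open>The bound \<open>Y\<close> below has degree \<open>c + 1\<close> in
    \<open>X\<close>, and the bound on \<open>(N + 1) ^ q\<close> has degree
    \<open>(c + 1) * h * q\<close>; \<open>b\<close> is the sum of both.\<close>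
  define b where "b = (c + 1) * (1 + h * q)"
  have "computable E" unfolding E_def by (rule computable_comp[OF computable_limit_value comp(2)])
  then have "computable F" unfolding F_def
    by (intro computable_add computable_mult computable_power_const computable_const comp)
  moreover have "\<exists>x' k' t s'. exec (Seq p (reduction d bs e)) (init_store x k) t s' \<and> holds_instance s' x' k' \<and>
      t \<le> F k * (length x + 1) ^ b \<and> k' \<le> E k \<and> ((x, k) \<in> A \<longleftrightarrow> (x', k') \<in> LDTM)" for x k
  proof -
    from p[of x k] obtain x1 k1 t1 s1 where
      1: "exec p (init_store x k) t1 s1" "holds_instance s1 x1 k1" "t1 \<le> f k * (length x + 1) ^ c"
        "k1 \<le> g k" "(x, k) \<in> A \<longleftrightarrow> (x1, k1) \<in> WSAT_Gamma1 d" by blast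
    let ?k' = "3 * (tuples d k1 + Suc k1) + tuples d k1 * Suc k1"
    define N where "N = limit_value d k1 (length (dense_part r x1))"
    from runs_reduction[OF 1(2) d bs e r_def N_def] obtain t2 s2 x2 where
      2: "exec (reduction d bs e) s1 t2 s2" "holds_instance s2 x2 ?k'"
        "(x2, ?k') \<in> LDTM \<longleftrightarrow> (x1, k1) \<in> WSAT_Gamma1 d"
        "t2 \<le> 6 + (r * (trues x1 + 1) + 1) * 48 + reduction_time d bs e N"
      unfolding runs_def by blast
    have "limit_value d k1 0 \<le> E k" unfolding E_def using 1(4) by (intro limit_value_mono) auto
    with parameter_le[OF d] have k': "?k' \<le> E k" by (rule order_trans)
    define X where "X = length x + 1"
    \<comment> \<open>A common bound for \<open>t1\<close> and \<open>trues x1 + 1\<close>.\<close>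
    define Y where "Y = (f k + 1) * X ^ (c + 1)"
    have X: "1 \<le> X" by (simp add: X_def)
    have Xc: "X ^ c \<le> X ^ (c + 1)" "X \<le> X ^ (c + 1)"
      using X power_increasing[of 1 "c + 1" X] by (auto intro: power_increasing)
    have fin: "{i. init_store x k ''bits'' i \<noteq> 0} \<subseteq> {..<length x}" by (auto simp: init_store_def split: if_splits)
    then have fin': "finite {i. init_store x k ''bits'' i \<noteq> 0}" by (rule finite_subset) simp
    have "card {i. init_store x k ''bits'' i \<noteq> 0} \<le> length x" using card_mono[OF _ fin] by simp
    with nonzero_cells[OF 1(1) fin'] trues_le_nonzero[OF 1(2)] have "trues x1 \<le> length x + t1" by auto
    then have "trues x1 + 1 \<le> X + f k * X ^ c" using 1(3) by (simp add: X_def)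
    also have "\<dots> \<le> X ^ (c + 1) + f k * X ^ (c + 1)" using Xc by (intro add_mono mult_le_mono2)
    finally have tr: "trues x1 + 1 \<le> Y" by (simp add: Y_def algebra_simps)
    have "1 \<le> X ^ (c + 1)" using X by (rule one_le_power)
    then have Y1: "1 \<le> Y" unfolding Y_def using mult_le_mono[of 1 "f k + 1" 1 "X ^ (c + 1)"] by (simp only: mult_1 le_add2)
    have "f k * X ^ c \<le> Y" unfolding Y_def using Xc by (intro mult_le_mono) auto
    with 1(3) have t1: "t1 \<le> Y" by (simp add: X_def)
    have rY: "r * (trues x1 + 1) \<le> r * Y" using tr by (rule mult_le_mono2)
    have "1 \<le> r * Y" using Y1 by (simp add: r_def)
    then have L: "length (dense_part r x1) + 1 \<le> 2 * r * Y"
      using length_dense_part[of r x1] rY by linarith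
    have "N = limit_value d k1 0 * (length (dense_part r x1) + 1) ^ h"
      unfolding N_def h_def by (rule limit_value_split)
    also have "\<dots> \<le> E k * (2 * r * Y) ^ h"
      using \<open>limit_value d k1 0 \<le> E k\<close> L by (intro mult_le_mono power_mono) auto
    finally have N: "N \<le> E k * (2 * r * Y) ^ h" .
    have "1 \<le> E k" unfolding E_def using limit_value_factors(5)[of 0 d "g k"] by simp
    moreover have "1 \<le> (2 * r * Y) ^ h" using \<open>1 \<le> r * Y\<close> by (intro one_le_power) simp
    ultimately have "1 * 1 \<le> E k * (2 * r * Y) ^ h" by (rule mult_le_mono)
    with N have "N + 1 \<le> 2 * (E k * (2 * r * Y) ^ h)" by linarith
    also have "\<dots> = 2 * E k * (2 * r * Y) ^ h" by (rule mult.assoc[symmetric])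
    also have "\<dots> = 2 * E k * (2 * r * (f k + 1)) ^ h * X ^ ((c + 1) * h)"
    proof -
      have "2 * r * Y = 2 * r * (f k + 1) * X ^ (c + 1)" by (simp only: Y_def mult.assoc)
      then show ?thesis by (simp only: power_mult_distrib power_mult mult.assoc)
    qed
    finally have "(N + 1) ^ q \<le> (2 * E k * (2 * r * (f k + 1)) ^ h * X ^ ((c + 1) * h)) ^ q"
      by (rule power_mono) simp
    also have "\<dots> = (2 * E k * (2 * r * (f k + 1)) ^ h) ^ q * X ^ ((c + 1) * h * q)"
      by (simp only: power_mult_distrib power_mult)
    also have "\<dots> \<le> (2 * E k * (2 * r * (f k + 1)) ^ h) ^ q * X ^ b"
      using X by (intro mult_le_mono2 power_increasing) (auto simp: b_def algebra_simps)
    finally have "K * (N + 1) ^ q \<le> K * ((2 * E k * (2 * r * (f k + 1)) ^ h) ^ q * X ^ b)"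
      by (rule mult_le_mono2)
    with K[of N] have time: "reduction_time d bs e N \<le> K * (2 * E k * (2 * r * (f k + 1)) ^ h) ^ q * X ^ b"
      unfolding mult.assoc[of K] by (rule order_trans)
    have "X ^ (c + 1) \<le> X ^ b" using X by (intro power_increasing) (auto simp: b_def)
    then have Yb: "Y \<le> (f k + 1) * X ^ b" unfolding Y_def by (rule mult_le_mono2)
    have "t1 + (6 + (r * (trues x1 + 1) + 1) * 48) \<le> (7 + 96 * r) * Y"
    proof -
      have "t1 + (6 + (r * (trues x1 + 1) + 1) * 48) \<le> Y + (6 * Y + (r * Y + r * Y) * 48)"
        using t1 rY Y1 \<open>1 \<le> r * Y\<close> by (intro add_mono mult_right_mono) auto
      also have "\<dots> = (7 + 96 * r) * Y" by (simp add: algebra_simps)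
      finally show ?thesis .
    qed
    also have "\<dots> \<le> (7 + 96 * r) * ((f k + 1) * X ^ b)" using Yb by (rule mult_le_mono2)
    finally have "t1 + t2 \<le> (7 + 96 * r) * ((f k + 1) * X ^ b) + K * (2 * E k * (2 * r * (f k + 1)) ^ h) ^ q * X ^ b"
      using 2(4) time by linarith
    also have "\<dots> = F k * X ^ b" unfolding F_def by (simp only: distrib_right mult.assoc)
    finally have "t1 + t2 \<le> F k * (length x + 1) ^ b" unfolding X_def .
    with exec.Seq[OF 1(1) 2(1)] 2(2,3) k' 1(5) show ?thesis by blast
  qed
  ultimately show ?thesis unfolding fpt_reducible_def using \<open>computable E\<close> by blast
qed

theorem theorem5:
  shows "W1_hard LDTM"
  unfolding W1_hard_def W1_def using fpt_reducible_LDTM by blast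

end
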